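(* Let $n=2$. Green's function $G_\varepsilon$ of the Dirichlet problem for $-\Delta$ in $\Omega_\varepsilon$ admits the representation $$\begin{aligned}G_\varepsilon(x,y)={}&G(x,y)+g(\varepsilon^{-1}x,\varepsilon^{-1}y)+\frac{1}{2\pi}\log\big(\varepsilon^{-1}|x-y|\big)\\&+\frac{\Big(\frac{1}{2\pi}\log\varepsilon+\zeta(\varepsilon^{-1}x)-\zeta_\infty+H(x,0)\Big)\Big(\frac{1}{2\pi}\log\varepsilon+\zeta(\varepsilon^{-1}y)-\zeta_\infty+H(0,y)\Big)}{\frac{1}{2\pi}\log\varepsilon+H(0,0)-\zeta_\infty}\\&-\zeta(\varepsilon^{-1}x)-\zeta(\varepsilon^{-1}y)+\zeta_\infty+O(\varepsilon),\end{aligned}$$ where the remainder is bounded by a constant times $\varepsilon$, uniformly with respect to $(x,y)\in\Omega_\varepsilon\times\Omega_\varepsilon$, for all sufficiently small $\varepsilon>0$.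
   Context: Let $n=2$. $\Omega\subset\mathbb R^2$ is a domain with compact closure; $F\subset\mathbb R^2$ is a compact set of positive harmonic capacity; both contain the origin as an interior point. The minimum distance from the origin to $\partial\Omega$ is $1$, and the maximum distance between the origin and the points of $\partial F^c$ is $1$, where $F^c=\mathbb R^2\setminus F$. For small $\varepsilon>0$, $F_\varepsilon=\{x:\varepsilon^{-1}x\in F\}$ and $\Omega_\varepsilon=\Omega\setminus F_\varepsilon$. $G$ and $G_\varepsilon$ are Green's functions of the Dirichlet problem for $-\Delta$ in $\Omega$ and $\Omega_\varepsilon$; $G(x,y)=(2\pi)^{-1}\log|x-y|^{-1}-H(x,y)$, where $H(\cdot,y)$ is harmonic in $\Omega$ with $H(x,y)=(2\pi)^{-1}\log|x-y|^{-1}$ for $x\in\partial\Omega$. $g(\xi,\eta)$ is Green's function of the Dirichlet problem for $-\Delta$ in $F^c$: $\Delta_\xi g+\delta(\xi-\eta)=0$ in $F^c$, $g=0$ on $\partial F$, $g(\xi,\eta)$ bounded as $|\xi|\to\infty$. Define $\zeta(\eta)=\lim_{|\xi|\to\infty}g(\xi,\eta)$ and $\zeta_\infty=\lim_{|\eta|\to\infty}\{\zeta(\eta)-(2\pi)^{-1}\log|\eta|\}$. *)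

theory Defs
  imports "HOL-Analysis.Analysis"
begin

type_synonym pt = "real ^ 2"

definition dpartial :: "2 \<Rightarrow> (pt \<Rightarrow> real) \<Rightarrow> pt \<Rightarrow> real" where
  "dpartial i u x = deriv (\<lambda>t. u (x + t *\<^sub>R axis i 1)) 0"

definition harmonic_on :: "pt set \<Rightarrow> (pt \<Rightarrow> real) \<Rightarrow> bool" where
  "harmonic_on U u \<longleftrightarrow> open U \<and>
     (\<forall>i. \<forall>x\<in>U. (\<lambda>t. u (x + t *\<^sub>R axis i 1)) differentiable (at 0)) \<and>
     (\<forall>i j. \<forall>x\<in>U. (\<lambda>t. dpartial i u (x + t *\<^sub>R axis j 1)) differentiable (at 0)) \<and>
     (\<forall>i j. continuous_on U (dpartial j (dpartial i u))) \<and>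
     (\<forall>x\<in>U. (\<Sum>i\<in>UNIV. dpartial i (dpartial i u) x) = 0)"

definition fund :: "pt \<Rightarrow> pt \<Rightarrow> real" where
  "fund x y = ln (1 / dist x y) / (2 * pi)"

definition green_regular_part :: "pt set \<Rightarrow> (pt \<Rightarrow> pt \<Rightarrow> real) \<Rightarrow> bool" where
  "green_regular_part U H \<longleftrightarrow>
     (\<forall>y\<in>U. harmonic_on U (\<lambda>x. H x y) \<and> continuous_on (closure U) (\<lambda>x. H x y) \<and>
            (\<forall>x\<in>frontier U. H x y = fund x y))"

definition dirichlet_green :: "pt set \<Rightarrow> (pt \<Rightarrow> pt \<Rightarrow> real) \<Rightarrow> bool" where
  "dirichlet_green U G \<longleftrightarrow> (\<exists>H. green_regular_part U H \<and>
     (\<forall>x\<in>U. \<forall>y\<in>U. x \<noteq> y \<longrightarrow> G x y = fund x y - H x y))"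

definition exterior_green :: "pt set \<Rightarrow> (pt \<Rightarrow> pt \<Rightarrow> real) \<Rightarrow> bool" where
  "exterior_green F g \<longleftrightarrow> (\<exists>h. green_regular_part (- F) h \<and>
     (\<forall>\<xi>\<in>- F. \<forall>\<eta>\<in>- F. \<xi> \<noteq> \<eta> \<longrightarrow> g \<xi> \<eta> = fund \<xi> \<eta> - h \<xi> \<eta>) \<and>
     (\<forall>\<eta>\<in>- F. \<exists>R M. \<forall>\<xi>\<in>- F. R \<le> norm \<xi> \<longrightarrow> \<bar>g \<xi> \<eta>\<bar> \<le> M))"

definition zeta :: "(pt \<Rightarrow> pt \<Rightarrow> real) \<Rightarrow> pt \<Rightarrow> real" where
  "zeta g \<eta> = Lim at_infinity (\<lambda>\<xi>. g \<xi> \<eta>)"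

definition zeta_inf :: "(pt \<Rightarrow> pt \<Rightarrow> real) \<Rightarrow> real" where
  "zeta_inf g = Lim at_infinity (\<lambda>\<eta>. zeta g \<eta> - ln (norm \<eta>) / (2 * pi))"

definition scaled_set :: "real \<Rightarrow> pt set \<Rightarrow> pt set" where
  "scaled_set \<epsilon> F = {x. inverse \<epsilon> *\<^sub>R x \<in> F}"

end

theory Submission
  imports Defs "HOL-Complex_Analysis.Complex_Analysis" "HOL-Real_Asymp.Real_Asymp"
begin

text \<open>For fixed \<open>y\<close> the remainder is harmonic in \<open>x\<close> on the perforated domain and continuous up to its
  boundary, so by the maximum principle it suffices to estimate it for \<open>x\<close> on the outer boundary and on
  the boundary of the small hole. The outer estimate needs the behaviour of the exterior Green's
  function at infinity, the inner one a Lipschitz bound for \<open>H\<close> at the origin that is uniform in \<open>y\<close>.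
  The inversion \<open>z \<mapsto> 1 / z\<close> turns the exterior problem into one on a bounded domain containing \<open>0\<close>, where
  infinity becomes an interior point, so that both estimates are instances of the same Lipschitz bound.

  Since \<open>\<zeta>(\<eta>)\<close> is a limit in the first argument of \<open>g\<close> but is used as a harmonic function of \<open>\<eta>\<close>, symmetry of
  Green's function is essential. On a bounded domain with no boundary smoothness it follows by extending two
  (truncated) Green's functions by zero and using that averaging over circles of a fixed radius is a
  self-adjoint operator: applied to Green's function it produces a negative mass near the pole, and a
  positive mass of the same size near the boundary, where the other Green's function is small.

  Harmonic functions are handled through the circular mean value property. By Stone--Weierstrass,
  continuous data on a circle are uniformly approximated by real parts of entire functions, which, with
  the maximum principle, replaces the Poisson integral throughout.\<close>

text \<open>The formula is dictated by the two boundaries. For fixed y the quotient term is a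
  constant q times the factor depending on x, where q is the factor depending on y divided by the
  denominator. On the outer boundary H(x,0) cancels the logarithmic growth of \<zeta> and the
  x-factor is O(\<epsilon>). On the hole \<zeta> vanishes, the x-factor equals the denominator up to
  O(\<epsilon>), and the quotient reproduces the y-factor, which absorbs what the other terms leave
  over. Both errors are multiplied by q, so everything hinges on a bound for q uniform in y,
  although its numerator and denominator may both be of order |log \<epsilon>|. The pole x = y never
  enters: the logarithms cancel and only regular parts are compared. The delicate uniformity
  concerns y near the outer boundary, where H(.,y) is not uniformly bounded on \<Omega>; near the
  origin it is, by positivity of Green's function. Finally, \<zeta> is not assumed continuous; its
  regularity is inherited from h(.,\<xi>) with \<xi> far away.\<close>

section \<open>Means over circles\<close>

definition cmean :: "(complex \<Rightarrow> real) \<Rightarrow> complex \<Rightarrow> real \<Rightarrow> real" where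
  "cmean u x r = integral {0..2*pi} (\<lambda>\<theta>. u (x + of_real r * cis \<theta>)) / (2*pi)"

lemma circle_point_mem_sphere: "0 \<le> r \<Longrightarrow> x + of_real r * cis \<theta> \<in> sphere x r"
  by (simp add: dist_norm norm_mult)

lemma continuous_on_circle:
  assumes "continuous_on (sphere x r) u" "0 \<le> r"
  shows "continuous_on A (\<lambda>\<theta>. u (x + of_real r * cis \<theta>))"
  by (rule continuous_on_compose2[OF assms(1)])
     (use assms(2) circle_point_mem_sphere in \<open>auto intro!: continuous_intros\<close>)

lemma cmean_const [simp]: "cmean (\<lambda>_. c) x r = c"
  by (simp add: cmean_def)

lemma cmean_add:
  assumes "continuous_on (sphere x r) u" "continuous_on (sphere x r) v" "0 \<le> r"
  shows "cmean (\<lambda>z. u z + v z) x r = cmean u x r + cmean v x r"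
  unfolding cmean_def
  by (subst integral_add)
     (auto intro!: integrable_continuous_interval continuous_on_circle assms simp: add_divide_distrib)

lemma cmean_cmult: "cmean (\<lambda>z. c * u z) x r = c * cmean u x r"
  by (simp add: cmean_def)

lemma cmean_minus: "cmean (\<lambda>z. - u z) x r = - cmean u x r"
  using cmean_cmult[of "-1" u] by simp

lemma cmean_diff:
  assumes "continuous_on (sphere x r) u" "continuous_on (sphere x r) v" "0 \<le> r"
  shows "cmean (\<lambda>z. u z - v z) x r = cmean u x r - cmean v x r"
  using cmean_add[of x r u "\<lambda>z. - v z"] assms by (simp add: cmean_minus continuous_on_minus)

lemma cmean_mono:
  assumes "continuous_on (sphere x r) u" "continuous_on (sphere x r) v" "0 \<le> r"
    and "\<And>z. z \<in> sphere x r \<Longrightarrow> u z \<le> v z"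
  shows "cmean u x r \<le> cmean v x r"
  unfolding cmean_def
  by (intro divide_right_mono integral_le integrable_continuous_interval continuous_on_circle assms
      circle_point_mem_sphere) auto

lemma cmean_cong:
  assumes "\<And>z. z \<in> sphere x r \<Longrightarrow> u z = v z" "0 \<le> r"
  shows "cmean u x r = cmean v x r"
  unfolding cmean_def using assms(1)[OF circle_point_mem_sphere[OF assms(2)]] by simp

lemma cmean_le_const:
  assumes "continuous_on (sphere x r) u" "0 \<le> r" "\<And>z. z \<in> sphere x r \<Longrightarrow> u z \<le> c"
  shows "cmean u x r \<le> c"
  using cmean_mono[of x r u "\<lambda>_. c"] assms by simp

lemma cmean_ge_const:
  assumes "continuous_on (sphere x r) u" "0 \<le> r" "\<And>z. z \<in> sphere x r \<Longrightarrow> c \<le> u z"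
  shows "c \<le> cmean u x r"
  using cmean_mono[of x r "\<lambda>_. c" u] assms by simp

lemma cmean_approx:
  assumes "continuous_on (sphere x r) u" "continuous_on (sphere x r) v" "0 \<le> r"
    and "\<And>z. z \<in> sphere x r \<Longrightarrow> \<bar>u z - v z\<bar> \<le> e"
  shows "\<bar>cmean u x r - cmean v x r\<bar> \<le> e"
proof -
  have "u z - v z \<le> e" "-e \<le> u z - v z" if "z \<in> sphere x r" for z
    using assms(4)[OF that] by auto
  then have "cmean (\<lambda>z. u z - v z) x r \<le> e" "-e \<le> cmean (\<lambda>z. u z - v z) x r"
    using assms(1-3) by (auto intro!: cmean_le_const cmean_ge_const continuous_intros simp del: mem_sphere)
  then show ?thesis using cmean_diff[OF assms(1-3)] by auto
qed

text \<open>A continuous nonnegative function with vanishing integral is zero. Angle 0 is enough,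
  because the maximum principle only has to move to the right.\<close>

lemma cmean_eq_imp_const:
  assumes "continuous_on (sphere x r) u" "0 \<le> r" "\<And>z. z \<in> sphere x r \<Longrightarrow> u z \<le> c"
    and "c \<le> cmean u x r"
  shows "u (x + of_real r) = c"
proof -
  let ?f = "\<lambda>\<theta>. c - u (x + of_real r * cis \<theta>)"
  have cf: "continuous_on {0..2*pi} ?f"
    by (intro continuous_intros continuous_on_circle assms)
  have nn: "?f \<theta> \<ge> 0" for \<theta> using assms(3) circle_point_mem_sphere[OF assms(2)] by simp
  have "cmean u x r = c"
    using cmean_le_const[OF assms(1-3)] assms(4) by simp
  then have "integral {0..2*pi} (\<lambda>\<theta>. u (x + of_real r * cis \<theta>)) = 2*pi*c"
    by (simp add: cmean_def field_simps)
  moreover have "integral {0..2*pi} ?f = 2*pi*c - integral {0..2*pi} (\<lambda>\<theta>. u (x + of_real r * cis \<theta>))"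
    by (subst integral_diff)
       (auto intro!: integrable_continuous_interval continuous_on_circle assms)
  ultimately have "integral {0..2*pi} ?f = 0" by simp
  then have "\<forall>\<theta>\<in>{0..2*pi}. ?f \<theta> = 0"
    by (subst (asm) integral_eq_0_iff[OF cf]) (use nn in auto)
  from this[rule_format, of 0] show ?thesis by simp
qed

text \<open>Cauchy's integral formula with dz/(z - x) = i dtheta on the circle; the real part of f
  is read off as the imaginary part of i f.\<close>

lemma cmean_Re_holomorphic:
  assumes "f holomorphic_on S" "cball x r \<subseteq> S" "0 < r"
  shows "cmean (\<lambda>z. Re (f z)) x r = Re (f x)"
proof -
  have "f holomorphic_on cball x r" using assms holomorphic_on_subset by blast
  then have "((\<lambda>u. f u/(u-x)) has_contour_integral (2 * of_real pi * \<i> * f x)) (circlepath x r)"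
    by (rule Cauchy_integral_circlepath_simple) (use assms in auto)
  then have "((\<lambda>t. f (x + r * cis t) / (x + r * cis t - x) * r * \<i> * cis t)
      has_integral (2 * of_real pi * \<i> * f x)) {0..2*pi}"
    unfolding circlepath_def by (subst (asm) has_contour_integral_part_circlepath_iff) auto
  moreover have "f (x + r * cis t) / (x + r * cis t - x) * r * \<i> * cis t = \<i> * f (x + r * cis t)" for t
    using assms(3) by (simp add: field_simps)
  ultimately have "((\<lambda>t. \<i> * f (x + r * cis t)) has_integral (\<i> * (2 * of_real pi * f x))) {0..2*pi}"
    by (simp add: mult_ac)
  then have "((\<lambda>t. Im (\<i> * f (x + r * cis t))) has_integral Im (\<i> * (2 * of_real pi * f x))) {0..2*pi}"
    by (rule has_integral_Im)
  then have "integral {0..2*pi} (\<lambda>t. Re (f (x + r * cis t))) = 2 * pi * Re (f x)"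
    by (simp add: integral_unique)
  then show ?thesis by (simp add: cmean_def)
qed

section \<open>Functions below their circular means, and the maximum principle\<close>

text \<open>Only small radii are demanded, with a bound depending on the point. This makes the
  notion local, hence easy to verify for glued functions; \<open>submean_on_le_cmean\<close>
  recovers the inequality for every closed disc in the domain.\<close>

definition submean_on :: "complex set \<Rightarrow> (complex \<Rightarrow> real) \<Rightarrow> bool" where
  "submean_on U u \<longleftrightarrow> open U \<and> continuous_on U u \<and>
     (\<forall>x\<in>U. \<exists>r0>0. \<forall>r. 0 < r \<and> r < r0 \<longrightarrow> u x \<le> cmean u x r)"

lemma submean_onD:
  assumes "submean_on U u" "x \<in> U"
  obtains r0 where "r0 > 0" "cball x r0 \<subseteq> U" "\<And>r. 0 < r \<Longrightarrow> r \<le> r0 \<Longrightarrow> u x \<le> cmean u x r"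
proof -
  obtain r1 where r1: "r1 > 0" "\<And>r. 0 < r \<Longrightarrow> r < r1 \<Longrightarrow> u x \<le> cmean u x r"
    using assms unfolding submean_on_def by meson
  obtain r2 where r2: "r2 > 0" "cball x r2 \<subseteq> U"
    using assms open_contains_cball unfolding submean_on_def by metis
  show thesis
  proof (rule that[of "min (r1/2) r2"])
    show "cball x (min (r1/2) r2) \<subseteq> U" using r2 by auto
  qed (use r1 r2 in auto)
qed

lemma submean_onI:
  assumes "open U" "continuous_on U u"
    and "\<And>x. x \<in> U \<Longrightarrow> \<exists>r0>0. \<forall>r. 0 < r \<longrightarrow> r < r0 \<longrightarrow> cball x r \<subseteq> U \<longrightarrow> u x \<le> cmean u x r"
  shows "submean_on U u"
  unfolding submean_on_def
proof (intro conjI ballI assms)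
  fix x assume x: "x \<in> U"
  then obtain r1 where r1: "r1 > 0" "\<forall>r. 0 < r \<longrightarrow> r < r1 \<longrightarrow> cball x r \<subseteq> U \<longrightarrow> u x \<le> cmean u x r"
    using assms(3) by blast
  obtain r2 where r2: "r2 > 0" "cball x r2 \<subseteq> U"
    using assms(1) x open_contains_cball by metis
  have "cball x r \<subseteq> U" if "r < r2" for r using that r2 by (meson cball_subset_cball_iff less_imp_le order_trans subset_cball)
  then show "\<exists>r0>0. \<forall>r. 0 < r \<and> r < r0 \<longrightarrow> u x \<le> cmean u x r"
    using r1 r2 by (intro exI[of _ "min r1 r2"]) auto
qed

lemma sphere_subset_if_cball: "cball x r \<subseteq> U \<Longrightarrow> sphere x r \<subseteq> U"
  using sphere_cball by blast

lemma submean_on_add: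
  assumes "submean_on U u" "submean_on U v"
  shows "submean_on U (\<lambda>z. u z + v z)"
proof (rule submean_onI)
  show "open U" "continuous_on U (\<lambda>z. u z + v z)"
    using assms by (auto simp: submean_on_def intro!: continuous_intros)
  fix x assume x: "x \<in> U"
  obtain r1 r2 where r: "r1 > 0" "\<And>r. 0 < r \<Longrightarrow> r \<le> r1 \<Longrightarrow> u x \<le> cmean u x r"
      "r2 > 0" "\<And>r. 0 < r \<Longrightarrow> r \<le> r2 \<Longrightarrow> v x \<le> cmean v x r"
    using submean_onD[OF assms(1) x] submean_onD[OF assms(2) x] by metis
  show "\<exists>r0>0. \<forall>r. 0 < r \<longrightarrow> r < r0 \<longrightarrow> cball x r \<subseteq> U \<longrightarrow> u x + v x \<le> cmean (\<lambda>z. u z + v z) x r"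
  proof (intro exI[of _ "min r1 r2"] conjI allI impI)
    fix r assume *: "0 < r" "r < min r1 r2" "cball x r \<subseteq> U"
    have "continuous_on (sphere x r) u" "continuous_on (sphere x r) v"
      using assms *(3) sphere_subset_if_cball continuous_on_subset unfolding submean_on_def by metis+
    then show "u x + v x \<le> cmean (\<lambda>z. u z + v z) x r"
      using * r(2)[of r] r(4)[of r] by (simp add: cmean_add)
  qed (use r in auto)
qed

lemma submean_on_cmult:
  assumes "submean_on U u" "0 \<le> c"
  shows "submean_on U (\<lambda>z. c * u z)"
  unfolding submean_on_def cmean_cmult
proof (intro conjI ballI)
  show "open U" "continuous_on U (\<lambda>z. c * u z)"
    using assms by (auto simp: submean_on_def intro!: continuous_intros)
  show "\<exists>r0>0. \<forall>r. 0 < r \<and> r < r0 \<longrightarrow> c * u x \<le> c * cmean u x r" if "x \<in> U" for x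
    using assms that mult_left_mono[OF _ assms(2)] unfolding submean_on_def by meson
qed

lemma submean_on_const: "open U \<Longrightarrow> submean_on U (\<lambda>_. c)"
  unfolding submean_on_def by (auto intro!: exI[of _ 1])

lemma submean_on_subset: "submean_on U u \<Longrightarrow> open V \<Longrightarrow> V \<subseteq> U \<Longrightarrow> submean_on V u"
  unfolding submean_on_def using continuous_on_subset by blast

lemma submean_on_Re_holomorphic:
  assumes "f holomorphic_on U" "open U"
  shows "submean_on U (\<lambda>z. Re (f z))"
proof (rule submean_onI)
  show "continuous_on U (\<lambda>z. Re (f z))"
    by (intro continuous_intros holomorphic_on_imp_continuous_on assms)
qed (use assms in \<open>auto intro!: exI[of _ 1] simp: cmean_Re_holomorphic\<close>)

lemma submean_on_cong:
  assumes "submean_on U u" "\<And>z. z \<in> U \<Longrightarrow> u z = v z"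
  shows "submean_on U v"
proof (rule submean_onI)
  show "open U" using assms by (auto simp: submean_on_def)
  show "continuous_on U v"
    using assms continuous_on_eq unfolding submean_on_def by metis
  fix x assume x: "x \<in> U"
  obtain r1 where r: "r1 > 0" "\<And>r. 0 < r \<Longrightarrow> r \<le> r1 \<Longrightarrow> u x \<le> cmean u x r"
    using submean_onD[OF assms(1) x] by metis
  show "\<exists>r0>0. \<forall>r. 0 < r \<longrightarrow> r < r0 \<longrightarrow> cball x r \<subseteq> U \<longrightarrow> v x \<le> cmean v x r"
  proof (intro exI[of _ r1] conjI allI impI)
    fix r assume *: "0 < r" "r < r1" "cball x r \<subseteq> U"
    have "cmean u x r = cmean v x r"
      using * sphere_subset_if_cball[OF *(3)] assms(2) by (intro cmean_cong) auto
    then show "v x \<le> cmean v x r" using r(2)[of r] * assms(2)[OF x] by simp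
  qed (use r in auto)
qed

text \<open>At a point of the maximum set with largest real part, the mean inequality forces the maximum
  also at a point further to the right.\<close>

lemma submean_max_principle:
  assumes sub: "submean_on U u" and bdd: "bounded U" and cont: "continuous_on (closure U) u"
    and bdry: "\<And>x. x \<in> frontier U \<Longrightarrow> u x \<le> c" and x: "x \<in> U"
  shows "u x \<le> c"
proof (rule ccontr)
  assume neg: "\<not> u x \<le> c"
  have op: "open U" using sub by (simp add: submean_on_def)
  have cpt: "compact (closure U)" using bdd by (simp add: compact_closure)
  obtain m where m: "m \<in> closure U" "\<And>y. y \<in> closure U \<Longrightarrow> u y \<le> u m"
    using continuous_attains_sup[OF cpt _ cont] x closure_subset by blast
  have mc: "u m > c" using m(2)[of x] x closure_subset neg by fastforce
  define M where "M = {y \<in> closure U. u y = u m}"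
  have "closed M" unfolding M_def
    using continuous_closed_preimage_constant[OF cont closed_closure] by simp
  moreover have "bounded M" using bdd unfolding M_def by (auto intro: bounded_subset[OF bounded_closure])
  ultimately have cM: "compact M" by (simp add: compact_eq_bounded_closed)
  have MU: "M \<subseteq> U"
  proof
    fix y assume y: "y \<in> M"
    then have "y \<notin> frontier U" using bdry[of y] mc unfolding M_def by auto
    then show "y \<in> U" using y op unfolding M_def frontier_def by (simp add: interior_open)
  qed
  have "M \<noteq> {}" using m unfolding M_def by auto
  then obtain p where p: "p \<in> M" "\<And>y. y \<in> M \<Longrightarrow> Re y \<le> Re p"
    using continuous_attains_sup[OF cM, of Re] continuous_on_Re[OF continuous_on_id] by auto
  obtain r where r: "r > 0" "cball p r \<subseteq> U" "\<And>s. 0 < s \<Longrightarrow> s \<le> r \<Longrightarrow> u p \<le> cmean u p s"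
    using submean_onD[OF sub] p MU by (metis subsetD)
  have sU: "sphere p r \<subseteq> U" using r sphere_subset_if_cball by blast
  have "u (p + of_real r) = u m"
  proof (rule cmean_eq_imp_const)
    show "continuous_on (sphere p r) u"
      using sU closure_subset by (blast intro: continuous_on_subset[OF cont])
    show "u z \<le> u m" if "z \<in> sphere p r" for z using m that sU closure_subset by blast
    show "u m \<le> cmean u p r" using r(3)[of r] r(1) p(1) unfolding M_def by auto
  qed (use r in auto)
  moreover have "p + of_real r \<in> closure U"
    using r(1,2) closure_subset[of U] by (auto simp: dist_norm intro!: subsetD[OF r(2)] subsetD[OF closure_subset])
  ultimately have "p + of_real r \<in> M" unfolding M_def by simp
  then show False using p(2)[of "p + of_real r"] r by simp
qed

subsection \<open>Approximation on circles\<close>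

text \<open>On the unit circle cnj z = 1/z, so a polynomial in Re z and Im z is a Laurent polynomial
  in z; the power z^n clears its negative exponents.\<close>

lemma real_polynomial_function_unit_circle_Laurent:
  fixes f :: "complex \<Rightarrow> real"
  assumes "real_polynomial_function f"
  shows "\<exists>n p. \<forall>z\<in>sphere 0 1. of_real (f z) * z ^ n = poly p z"
  using assms
proof induction
  case (linear f)
  interpret bounded_linear f by fact
  \<comment> \<open>Re z = (z + 1/z)/2 and Im z = (z - 1/z)/(2i); after multiplication by z the
    linear coefficient is 0.\<close>
  have "of_real (f z) * z ^ 1 = poly [:of_real (f 1)/2 + \<i> * of_real (f \<i>)/2, 0,
      of_real (f 1)/2 - \<i> * of_real (f \<i>)/2:] z" if "z \<in> sphere 0 1" for z
  proof -
    have "f z = Re z * f 1 + Im z * f \<i>"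
      using add[of "Re z *\<^sub>R 1" "Im z *\<^sub>R \<i>"] scaleR[of "Re z" 1] scaleR[of "Im z" \<i>]
      by (metis complex_eq scaleR_conv_of_real mult.commute mult.right_neutral real_scaleR_def)
    then have fz: "of_real (f z) = of_real (Re z) * of_real (f 1) + of_real (Im z) * (of_real (f \<i>) :: complex)"
      by simp
    have ReIm: "of_real (Re z) = (z + cnj z)/2" "of_real (Im z) = (z - cnj z)/(2*\<i>)"
      by (auto simp: complex_eq_iff)
    have zz: "cnj z * z = 1"
      using that by (simp add: mult.commute flip: complex_norm_square)
    have "of_real (f z) * z = ((z*z + cnj z * z)/2) * of_real (f 1) + ((z*z - cnj z * z)/(2*\<i>)) * of_real (f \<i>)"
      unfolding fz ReIm by (simp add: field_simps)
    also have "\<dots> = ((z*z + 1)/2) * of_real (f 1) + ((z*z - 1)/(2*\<i>)) * of_real (f \<i>)"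
      by (simp only: zz)
    also have "(z*z - 1)/(2*\<i>) = - \<i> * (z*z - 1)/2" by (simp add: field_simps)
    finally show ?thesis by (simp add: algebra_simps add_divide_distrib diff_divide_distrib)
  qed
  then show ?case by metis
next
  case (const c)
  then show ?case by (intro exI[of _ 0] exI[of _ "[:of_real c:]"]) auto
next
  case (add f g)
  then obtain n p m q where "\<forall>z\<in>sphere 0 1. of_real (f z) * z ^ n = poly p z"
     "\<forall>z\<in>sphere 0 1. of_real (g z) * z ^ m = poly q z" by blast
  then show ?case
    by (intro exI[of _ "n+m"] exI[of _ "p * monom 1 m + q * monom 1 n"])
       (auto simp: algebra_simps power_add poly_monom)
next
  case (mult f g)
  then obtain n p m q where "\<forall>z\<in>sphere 0 1. of_real (f z) * z ^ n = poly p z"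
     "\<forall>z\<in>sphere 0 1. of_real (g z) * z ^ m = poly q z" by blast
  note np = this
  have eq: "of_real (f z * g z) * z ^ (n+m) = (of_real (f z) * z ^ n) * (of_real (g z) * z ^ m)" for z :: complex
    by (simp add: power_add)
  have "\<forall>z\<in>sphere 0 1. of_real (f z * g z) * z ^ (n+m) = poly (p * q) z"
    unfolding eq poly_mult
    by (intro ballI) (simp only: np(1)[rule_format] np(2)[rule_format])
  then show ?case by blast
qed

text \<open>Conjugation leaves the real part unchanged: for |z| = 1, Re (a z^(-m)) = Re (cnj a *
  z^m). So the negative powers can be traded for positive ones, and the result extends into the
  disc.\<close>

lemma Re_divide_power_unit_circle:
  assumes "z \<in> sphere 0 1"
  shows "Re (poly p z / z ^ n) = Re (\<Sum>i\<le>degree p. if n \<le> i then coeff p i * z ^ (i - n) else cnj (coeff p i) * z ^ (n - i))"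
proof -
  have zz: "z * cnj z = 1"
    using assms by (simp flip: complex_norm_square)
  have z0: "z \<noteq> 0" using assms by auto
  have inv: "inverse z = cnj z" using zz z0 by (simp add: field_simps)
  have "Re (coeff p i * z ^ i / z ^ n) = Re (if n \<le> i then coeff p i * z ^ (i - n) else cnj (coeff p i) * z ^ (n - i))" for i
  proof (cases "n \<le> i")
    case True then show ?thesis using z0 by (simp add: power_diff)
  next
    case False
    then have "z ^ i / z ^ n = inverse z ^ (n - i)"
      using z0 by (simp add: power_diff field_simps)
    then have "coeff p i * z ^ i / z ^ n = coeff p i * inverse z ^ (n - i)"
      by (metis times_divide_eq_right)
    then have "coeff p i * z ^ i / z ^ n = cnj (cnj (coeff p i) * z ^ (n - i))"
      by (simp add: inv)
    then have "Re (coeff p i * z ^ i / z ^ n) = Re (cnj (coeff p i) * z ^ (n - i))"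
      by (simp only: cnj.sel)
    then show ?thesis using False by simp
  qed
  then show ?thesis
    by (simp add: poly_altdef sum_divide_distrib)
qed

text \<open>Having an entire P, not just a function harmonic in the disc, gives exact means over
  every circle and allows composition with holomorphic maps.\<close>

lemma continuous_on_sphere_approx_Re_entire:
  fixes u :: "complex \<Rightarrow> real"
  assumes cont: "continuous_on (sphere x s) u" and s: "0 < s" and e: "0 < e"
  obtains P where "P holomorphic_on UNIV" "\<And>z. z \<in> sphere x s \<Longrightarrow> \<bar>u z - Re (P z)\<bar> < e"
proof -
  have "continuous_on (sphere 0 1) (\<lambda>w. u (x + of_real s * w))"
    by (rule continuous_on_compose2[OF cont]) (use s in \<open>auto intro!: continuous_intros simp: dist_norm norm_mult\<close>)
  then obtain f where f: "real_polynomial_function f"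
      "\<And>w. w \<in> sphere 0 1 \<Longrightarrow> \<bar>u (x + of_real s * w) - f w\<bar> < e"
    using Stone_Weierstrass_real_polynomial_function[OF compact_sphere _ e] by metis
  obtain n p where np: "\<And>z. z\<in>sphere 0 1 \<Longrightarrow> of_real (f z) * z ^ n = poly p z"
    using real_polynomial_function_unit_circle_Laurent[OF f(1)] by blast
  define Q where "Q z = (\<Sum>i\<le>degree p. if n \<le> i then coeff p i * z ^ (i - n) else cnj (coeff p i) * z ^ (n - i))" for z
  have holQ: "Q holomorphic_on UNIV"
    unfolding Q_def
  proof (intro holomorphic_intros)
    show "(\<lambda>z. if n \<le> i then coeff p i * z ^ (i - n) else cnj (coeff p i) * z ^ (n - i)) holomorphic_on UNIV" for i
      by (cases "n \<le> i") (auto intro!: holomorphic_intros)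
  qed
  have fQ: "f w = Re (Q w)" if "w \<in> sphere 0 1" for w
  proof -
    have "of_real (f w) = poly p w / w ^ n" using np[OF that] that by (subst eq_divide_eq) auto
    then have "f w = Re (poly p w / w ^ n)" by (metis Re_complex_of_real)
    then show ?thesis using Re_divide_power_unit_circle[OF that] by (simp add: Q_def)
  qed
  show thesis
  proof
    show "(\<lambda>z. Q ((z - x) / of_real s)) holomorphic_on UNIV"
      by (rule holomorphic_on_compose_gen[OF _ holQ, unfolded o_def]) (use s in \<open>auto intro!: holomorphic_intros\<close>)
    fix z assume "z \<in> sphere x s"
    then have "(z - x) / of_real s \<in> sphere 0 1" using s by (simp add: norm_divide dist_norm norm_minus_commute)
    from f(2)[OF this] fQ[OF this] s show "\<bar>u z - Re (Q ((z - x) / of_real s))\<bar> < e" by simp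
  qed
qed

text \<open>From small circles to all of them: if Re P is within e/2 of u on the circle, the maximum
  principle gives u - Re P \<le> e/2 at the centre, where Re P equals its own mean.\<close>

lemma submean_on_le_cmean:
  assumes sub: "submean_on U u" and cb: "cball x s \<subseteq> U" and s: "0 < s"
  shows "u x \<le> cmean u x s"
proof (rule field_le_epsilon)
  fix e :: real assume "0 < e"
  then have e: "0 < e/2" by simp
  have cont: "continuous_on (cball x s) u"
    using sub cb continuous_on_subset unfolding submean_on_def by blast
  have conts: "continuous_on (sphere x s) u" using cont by (rule continuous_on_subset) auto
  obtain P where P: "P holomorphic_on UNIV" "\<And>z. z \<in> sphere x s \<Longrightarrow> \<bar>u z - Re (P z)\<bar> < e/2"
    using continuous_on_sphere_approx_Re_entire[OF conts s e] by blast
  have cP: "continuous_on A (\<lambda>z. Re (P z))" for A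
    by (intro continuous_intros holomorphic_on_imp_continuous_on holomorphic_on_subset[OF P(1)]) auto
  have "u x + Re (- P x) \<le> e/2"
  proof (rule submean_max_principle[where U = "ball x s" and u = "\<lambda>x. u x + Re (- P x)"])
    show "submean_on (ball x s) (\<lambda>x. u x + Re (- P x))"
    proof (rule submean_on_add)
      show "submean_on (ball x s) u"
        by (rule submean_on_subset[OF sub]) (use cb ball_subset_cball in auto)
      show "submean_on (ball x s) (\<lambda>x. Re (- P x))"
        by (rule submean_on_Re_holomorphic) (auto intro!: holomorphic_intros holomorphic_on_subset[OF P(1)])
    qed
    show "continuous_on (closure (ball x s)) (\<lambda>x. u x + Re (- P x))"
      using s by (simp add: continuous_on_diff cont cP)
    show "u y + Re (- P y) \<le> e/2" if "y \<in> frontier (ball x s)" for y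
    proof -
      have "\<bar>u y - Re (P y)\<bar> < e/2" using P(2)[of y] that s by (simp add: frontier_ball)
      then show ?thesis unfolding uminus_complex.sel(1) by linarith
    qed
  qed (use s in auto)
  moreover have "\<bar>cmean u x s - cmean (\<lambda>z. Re (P z)) x s\<bar> \<le> e/2"
    by (rule cmean_approx) (use conts cP s P(2) in \<open>auto intro: less_imp_le simp del: mem_sphere\<close>)
  moreover have "cmean (\<lambda>z. Re (P z)) x s = Re (P x)"
    by (rule cmean_Re_holomorphic[OF P(1)]) (use s in auto)
  ultimately show "u x \<le> cmean u x s + e" unfolding uminus_complex.sel(1) by linarith
qed

section \<open>Harmonic functions through mean values\<close>

text \<open>Harmonicity without derivatives: this form passes to uniform limits and gives the
  maximum principle for both signs.\<close>

definition harm_on :: "complex set \<Rightarrow> (complex \<Rightarrow> real) \<Rightarrow> bool" where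
  "harm_on U u \<longleftrightarrow> submean_on U u \<and> submean_on U (\<lambda>x. - u x)"

lemma harm_on_submean: "harm_on U u \<Longrightarrow> submean_on U u" "harm_on U u \<Longrightarrow> submean_on U (\<lambda>x. - u x)"
  by (auto simp: harm_on_def)

lemma harm_on_open: "harm_on U u \<Longrightarrow> open U"
  by (auto simp: harm_on_def submean_on_def)

lemma harm_on_continuous: "harm_on U u \<Longrightarrow> continuous_on U u"
  by (auto simp: harm_on_def submean_on_def)

lemma harm_on_cmean:
  assumes "harm_on U u" "cball x s \<subseteq> U" "0 < s"
  shows "cmean u x s = u x"
  using submean_on_le_cmean[of U u x s] submean_on_le_cmean[of U "\<lambda>x. - u x" x s] assms
  by (simp add: harm_on_def cmean_minus)

lemma harm_onI:
  assumes "open U" "continuous_on U u"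
    and "\<And>x. x \<in> U \<Longrightarrow> \<exists>r0>0. \<forall>r. 0 < r \<longrightarrow> r < r0 \<longrightarrow> cball x r \<subseteq> U \<longrightarrow> cmean u x r = u x"
  shows "harm_on U u"
  unfolding harm_on_def
  by (intro conjI submean_onI continuous_on_minus assms; drule assms(3); force simp: cmean_minus)

lemma harm_on_add: "harm_on U u \<Longrightarrow> harm_on U v \<Longrightarrow> harm_on U (\<lambda>x. u x + v x)"
  using submean_on_add[of U "\<lambda>x. - u x" "\<lambda>x. - v x"] submean_on_add[of U u v]
  by (simp add: harm_on_def)

lemma harm_on_cmult:
  assumes "harm_on U u" shows "harm_on U (\<lambda>x. c * u x)"
proof (cases "c \<ge> 0")
  case True
  then show ?thesis using assms submean_on_cmult[of U u c] submean_on_cmult[of U "\<lambda>x. - u x" c]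
    by (simp add: harm_on_def)
next
  case False
  then show ?thesis using assms submean_on_cmult[of U u "-c"] submean_on_cmult[of U "\<lambda>x. - u x" "-c"]
    by (simp add: harm_on_def)
qed

lemma harm_on_minus: "harm_on U u \<Longrightarrow> harm_on U (\<lambda>x. - u x)"
  by (simp add: harm_on_def)

lemma harm_on_diff: "harm_on U u \<Longrightarrow> harm_on U v \<Longrightarrow> harm_on U (\<lambda>x. u x - v x)"
  using harm_on_add[of U u "\<lambda>x. - v x"] harm_on_minus by simp

lemma harm_on_const: "open U \<Longrightarrow> harm_on U (\<lambda>_. c)"
  by (simp add: harm_on_def submean_on_const)

lemma harm_on_subset: "harm_on U u \<Longrightarrow> open V \<Longrightarrow> V \<subseteq> U \<Longrightarrow> harm_on V u"
  unfolding harm_on_def using submean_on_subset by blast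

lemma harm_on_cong: "harm_on U u \<Longrightarrow> (\<And>z. z \<in> U \<Longrightarrow> u z = v z) \<Longrightarrow> harm_on U v"
  unfolding harm_on_def by (metis (mono_tags, lifting) submean_on_cong)

lemma harm_on_Un:
  assumes "harm_on U u" "harm_on V u"
  shows "harm_on (U \<union> V) u"
  using assms unfolding harm_on_def submean_on_def
  by (auto intro: continuous_on_open_Un)

lemma harm_on_Re_holomorphic: "f holomorphic_on U \<Longrightarrow> open U \<Longrightarrow> harm_on U (\<lambda>z. Re (f z))"
  using submean_on_Re_holomorphic[of f U] submean_on_Re_holomorphic[of "\<lambda>z. - f z" U]
  by (simp add: harm_on_def holomorphic_on_minus)

lemma harm_on_approx_Re_entire:
  assumes "harm_on U u" "cball x s \<subseteq> U" "0 < s" "0 < e"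
  obtains P where "P holomorphic_on UNIV" "\<And>z. z \<in> cball x s \<Longrightarrow> \<bar>u z - Re (P z)\<bar> \<le> e"
proof -
  have cont: "continuous_on (cball x s) u"
    using harm_on_continuous[OF assms(1)] assms(2) continuous_on_subset by blast
  have "continuous_on (sphere x s) u" using cont by (rule continuous_on_subset) auto
  then obtain P where P: "P holomorphic_on UNIV" "\<And>z. z \<in> sphere x s \<Longrightarrow> \<bar>u z - Re (P z)\<bar> < e"
    using continuous_on_sphere_approx_Re_entire[OF _ assms(3,4)] by blast
  have cP: "continuous_on A (\<lambda>z. Re (P z))" for A
    by (intro continuous_intros holomorphic_on_imp_continuous_on holomorphic_on_subset[OF P(1)]) auto
  have h: "harm_on (ball x s) (\<lambda>z. u z - Re (P z))"
    by (intro harm_on_diff harm_on_Re_holomorphic holomorphic_on_subset[OF P(1)] harm_on_subset[OF assms(1)])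
       (use assms(2) ball_subset_cball in auto)
  have "\<bar>u z - Re (P z)\<bar> \<le> e" if "z \<in> cball x s" for z
  proof (cases "z \<in> sphere x s")
    case True then show ?thesis using P(2) less_imp_le by blast
  next
    case False
    then have z: "z \<in> ball x s" using that by auto
    have b: "\<bar>u y - Re (P y)\<bar> \<le> e" if "y \<in> frontier (ball x s)" for y
      using P(2)[of y] that assms(3) by (simp add: frontier_ball)
    have c: "continuous_on (closure (ball x s)) (\<lambda>z. u z - Re (P z))"
      using assms(3) by (simp add: continuous_on_diff cont cP)
    have "u z - Re (P z) \<le> e"
      using submean_max_principle[OF harm_on_submean(1)[OF h] bounded_ball c _ z] b by (simp add: abs_le_iff)
    moreover have "- (u z - Re (P z)) \<le> e"
      using submean_max_principle[OF harm_on_submean(2)[OF h] bounded_ball continuous_on_minus[OF c] _ z] b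
      by (simp add: abs_le_iff)
    ultimately show ?thesis by simp
  qed
  then show thesis using that P(1) by blast
qed

lemma continuous_on_uniform_approx:
  fixes u :: "'a::metric_space \<Rightarrow> real"
  assumes "\<And>e. 0 < e \<Longrightarrow> \<exists>v. continuous_on S v \<and> (\<forall>x\<in>S. \<bar>u x - v x\<bar> \<le> e)"
  shows "continuous_on S u"
proof -
  have "\<forall>n. \<exists>v. continuous_on S v \<and> (\<forall>x\<in>S. \<bar>u x - v x\<bar> \<le> 1 / real (Suc n))"
    using assms by simp
  then obtain v where v: "\<And>n. continuous_on S (v n)" "\<And>n x. x \<in> S \<Longrightarrow> \<bar>u x - v n x\<bar> \<le> 1 / real (Suc n)"
    by metis
  have "uniform_limit S v u sequentially"
  proof (rule uniform_limitI)
    fix e :: real assume "0 < e"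
    then obtain N where N: "1 / real (Suc N) < e" using nat_approx_posE by blast
    show "\<forall>\<^sub>F n in sequentially. \<forall>x\<in>S. dist (v n x) (u x) < e"
    proof (rule eventually_sequentiallyI[of N], intro ballI)
      fix n x assume "N \<le> n" "x \<in> S"
      have "1 / real (Suc n) \<le> 1 / real (Suc N)" using \<open>N \<le> n\<close> by (simp add: frac_le)
      then show "dist (v n x) (u x) < e" using v(2)[OF \<open>x \<in> S\<close>, of n] N by (simp add: dist_real_def abs_minus_commute)
    qed
  qed
  then show ?thesis using v(1) by (intro uniform_limit_theorem[where F = sequentially]) auto
qed

text \<open>On a fixed circle both sides of the mean value identity pass to the uniform limit.
  Removable singularities and the harmonicity of \<zeta> are obtained in this way.\<close>

lemma harm_on_uniform_approx:
  assumes op: "open U" and "\<And>e. 0 < e \<Longrightarrow> \<exists>v. harm_on U v \<and> (\<forall>x\<in>U. \<bar>u x - v x\<bar> \<le> e)"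
  shows "harm_on U u"
proof (rule harm_onI[OF op])
  show cont: "continuous_on U u"
    by (rule continuous_on_uniform_approx) (use assms harm_on_continuous in metis)
  have "cmean u x r = u x" if x: "x \<in> U" and r: "0 < r" "cball x r \<subseteq> U" for x r
  proof -
    have "\<bar>cmean u x r - u x\<bar> \<le> 0 + e" if e: "0 < e" for e
    proof -
      obtain v where v: "harm_on U v" "\<And>x. x \<in> U \<Longrightarrow> \<bar>u x - v x\<bar> \<le> e/2" using assms(2)[of "e/2"] e by auto
      have sU: "sphere x r \<subseteq> U" using r sphere_subset_if_cball by blast
      have "\<bar>cmean u x r - cmean v x r\<bar> \<le> e/2"
        using v(2) sU r by (intro cmean_approx continuous_on_subset[OF cont sU]
            continuous_on_subset[OF harm_on_continuous[OF v(1)] sU]) (auto simp del: mem_sphere)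
      then show ?thesis using harm_on_cmean[OF v(1) r(2,1)] v(2)[OF x] by (simp add: abs_if split: if_splits)
    qed
    then have "\<bar>cmean u x r - u x\<bar> \<le> 0" by (rule field_le_epsilon)
    then show ?thesis by simp
  qed
  then show "\<exists>r0>0. \<forall>r. 0 < r \<longrightarrow> r < r0 \<longrightarrow> cball x r \<subseteq> U \<longrightarrow> cmean u x r = u x" if "x \<in> U" for x
    using that by (intro exI[of _ 1]) auto
qed

text \<open>Near f x the function u is uniformly close to some Re P, and P after f is holomorphic,
  so its real part has exact means. Used for the inversion and for the scaling by
  \<epsilon>.\<close>

lemma harm_on_compose_holomorphic:
  assumes u: "harm_on U u" and f: "f holomorphic_on V" "open V" "f ` V \<subseteq> U"
  shows "harm_on V (\<lambda>z. u (f z))"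
proof (rule harm_onI[OF f(2)])
  have cf: "continuous_on V f" using f(1) holomorphic_on_imp_continuous_on by blast
  show cont: "continuous_on V (\<lambda>z. u (f z))"
    by (rule continuous_on_compose2[OF harm_on_continuous[OF u] cf f(3)])
  fix x assume x: "x \<in> V"
  obtain \<rho> where \<rho>: "\<rho> > 0" "cball (f x) \<rho> \<subseteq> U"
    using u f(3) x harm_on_open open_contains_cball by (metis image_subset_iff)
  have "open (V \<inter> f -` ball (f x) \<rho>)"
    using cf f(2) continuous_open_preimage by blast
  then obtain r0 where r0: "r0 > 0" "cball x r0 \<subseteq> V \<inter> f -` ball (f x) \<rho>"
    using x \<rho>(1) open_contains_cball by (metis IntI centre_in_ball vimageI)
  show "\<exists>r0>0. \<forall>r. 0 < r \<longrightarrow> r < r0 \<longrightarrow> cball x r \<subseteq> V \<longrightarrow> cmean (\<lambda>z. u (f z)) x r = u (f x)"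
  proof (intro exI[of _ r0] conjI allI impI)
    fix r assume r: "0 < r" "r < r0" "cball x r \<subseteq> V"
    have cb: "f z \<in> cball (f x) \<rho>" if "z \<in> cball x r" for z
    proof -
      have "z \<in> cball x r0" using that r by auto
      then show ?thesis using r0(2) ball_subset_cball by blast
    qed
    have sV: "sphere x r \<subseteq> V" using r sphere_subset_if_cball by blast
    have "\<bar>cmean (\<lambda>z. u (f z)) x r - u (f x)\<bar> \<le> 0 + e" if e: "0 < e" for e
    proof -
      obtain P where P: "P holomorphic_on UNIV" "\<And>z. z \<in> cball (f x) \<rho> \<Longrightarrow> \<bar>u z - Re (P z)\<bar> \<le> e/2"
        using harm_on_approx_Re_entire[OF u \<rho>(2,1), of "e/2"] e by auto
      have hol: "(\<lambda>z. P (f z)) holomorphic_on V"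
        by (rule holomorphic_on_compose_gen[OF f(1) P(1), unfolded o_def]) auto
      have "\<bar>cmean (\<lambda>z. u (f z)) x r - cmean (\<lambda>z. Re (P (f z))) x r\<bar> \<le> e/2"
      proof (rule cmean_approx)
        show "continuous_on (sphere x r) (\<lambda>z. u (f z))" using cont sV continuous_on_subset by blast
        show "continuous_on (sphere x r) (\<lambda>z. Re (P (f z)))"
          by (intro continuous_intros holomorphic_on_imp_continuous_on holomorphic_on_subset[OF hol] sV)
        show "\<bar>u (f z) - Re (P (f z))\<bar> \<le> e/2" if "z \<in> sphere x r" for z
          using P(2)[OF cb] that by auto
      qed (use r in auto)
      moreover have "cmean (\<lambda>z. Re (P (f z))) x r = Re (P (f x))"
        by (rule cmean_Re_holomorphic[OF hol r(3,1)])
      moreover have "\<bar>u (f x) - Re (P (f x))\<bar> \<le> e/2" using P(2)[OF cb] r by auto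
      ultimately show ?thesis by (simp add: abs_if split: if_splits)
    qed
    then have "\<bar>cmean (\<lambda>z. u (f z)) x r - u (f x)\<bar> \<le> 0" by (rule field_le_epsilon)
    then show "cmean (\<lambda>z. u (f z)) x r = u (f x)" by simp
  qed (use r0 in auto)
qed

text \<open>On the disc about x that reaches up to a, (z - a)/(x - a) has positive real part, so its
  principal logarithm is holomorphic there and has real part ln |z - a| up to a constant.\<close>

lemma harm_on_ln_norm: "harm_on (- {a}) (\<lambda>z. ln (norm (z - a)))"
proof (rule harm_onI)
  show "continuous_on (- {a}) (\<lambda>z. ln (norm (z - a)))" by (intro continuous_intros) auto
  fix x assume x: "x \<in> - {a}"
  show "\<exists>r0>0. \<forall>r. 0 < r \<longrightarrow> r < r0 \<longrightarrow> cball x r \<subseteq> - {a} \<longrightarrow>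
      cmean (\<lambda>z. ln (norm (z - a))) x r = ln (norm (x - a))"
  proof (intro exI[of _ "norm (x - a)"] conjI allI impI)
    fix r assume r: "0 < r" "r < norm (x - a)"
    have near: "norm (z - x) < norm (x - a)" if "z \<in> ball x (norm (x - a))" for z
      using that by (simp add: dist_norm norm_minus_commute)
    have Re_pos: "Re ((z - a) / (x - a)) > 0" if "z \<in> ball x (norm (x - a))" for z
    proof -
      have eq: "(z - a) / (x - a) = 1 + (z - x) / (x - a)"
        using x by (simp add: divide_eq_eq distrib_right)
      have "norm ((z - x) / (x - a)) < 1" using near[OF that] x by (simp add: norm_divide)
      then have "\<bar>Re ((z - x) / (x - a))\<bar> < 1" using abs_Re_le_cmod order_le_less_trans by blast
      then show ?thesis unfolding eq plus_complex.sel one_complex.sel by linarith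
    qed
    have nonpos: "(z - a) / (x - a) \<notin> \<real>\<^sub>\<le>\<^sub>0" if "z \<in> ball x (norm (x - a))" for z
      using Re_pos[OF that] unfolding complex_nonpos_Reals_iff by linarith
    have hol: "(\<lambda>z. of_real (ln (norm (x - a))) + Ln ((z - a) / (x - a))) holomorphic_on ball x (norm (x - a))"
      using x by (intro holomorphic_intros nonpos) auto
    have eq: "Re (of_real (ln (norm (x - a))) + Ln ((z - a) / (x - a))) = ln (norm (z - a))"
      if "z \<in> ball x (norm (x - a))" for z
    proof -
      have "z \<noteq> a" using Re_pos[OF that] by auto
      then show ?thesis using x by (simp add: Re_Ln norm_divide ln_div)
    qed
    have "cmean (\<lambda>z. ln (norm (z - a))) x r = cmean (\<lambda>z. Re (of_real (ln (norm (x - a))) + Ln ((z - a) / (x - a)))) x r"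
      by (rule cmean_cong) (use r eq in \<open>auto simp: dist_norm\<close>)
    also have "\<dots> = Re (of_real (ln (norm (x - a))) + Ln ((x - a) / (x - a)))"
      by (rule cmean_Re_holomorphic[OF hol]) (use r in auto)
    finally show "cmean (\<lambda>z. ln (norm (z - a))) x r = ln (norm (x - a))" using x by simp
  qed (use x in auto)
qed auto

section \<open>The complex plane and the coordinate plane\<close>

definition to_pt :: "complex \<Rightarrow> pt" where
  "to_pt z = (\<chi> i. if i = 1 then Re z else Im z)"

lemma to_pt_add_real: "to_pt (z + of_real t) = to_pt z + t *\<^sub>R axis 1 1"
  and to_pt_add_imag: "to_pt (z + \<i> * of_real t) = to_pt z + t *\<^sub>R axis 2 1"
  by (auto simp: to_pt_def vec_eq_iff axis_def forall_2)

lemma linear_to_pt: "linear to_pt"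
  by (rule linearI) (auto simp: to_pt_def vec_eq_iff)

lemma norm_to_pt [simp]: "norm (to_pt z) = norm z"
  by (simp add: norm_vec_def L2_set_def sum_2 to_pt_def cmod_def)

lemma dist_to_pt [simp]: "dist (to_pt z) (to_pt w) = dist z w"
  by (metis dist_norm linear_diff linear_to_pt norm_to_pt)

lemma to_pt_scaleR: "to_pt (c *\<^sub>R z) = c *\<^sub>R to_pt z"
  by (rule linear_scale[OF linear_to_pt])

lemma to_pt_0 [simp]: "to_pt 0 = 0"
  by (rule linear_0[OF linear_to_pt])

lemma bij_to_pt: "bij to_pt"
proof (rule bijI)
  show "inj to_pt" by (rule injI) (metis dist_eq_0_iff dist_to_pt)
  show "surj to_pt"
  proof (rule surjI)
    show "to_pt (Complex (x $ 1) (x $ 2)) = x" for x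
      by (simp add: to_pt_def vec_eq_iff forall_2)
  qed
qed

lemma continuous_on_to_pt: "continuous_on A to_pt"
  using linear_continuous_on linear_to_pt linear_conv_bounded_linear by blast

subsection \<open>The classical maximum principle\<close>

text \<open>The first derivative exists in a neighbourhood, the second at 0 only. This is what
  \<open>harmonic_on\<close> yields along a coordinate direction.\<close>

definition second_deriv_at0 :: "(real \<Rightarrow> real) \<Rightarrow> real \<Rightarrow> bool" where
  "second_deriv_at0 f d \<longleftrightarrow> (\<exists>f'. (\<forall>\<^sub>F t in nhds 0. (f has_real_derivative f' t) (at t)) \<and>
     (f' has_real_derivative d) (at 0))"

lemma second_deriv_at0_add:
  "second_deriv_at0 f c \<Longrightarrow> second_deriv_at0 g d \<Longrightarrow> second_deriv_at0 (\<lambda>t. f t + g t) (c + d)"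
  unfolding second_deriv_at0_def
proof (elim exE conjE, intro exI conjI)
  fix f' g'
  assume "\<forall>\<^sub>F t in nhds 0. (f has_real_derivative f' t) (at t)"
     "\<forall>\<^sub>F t in nhds 0. (g has_real_derivative g' t) (at t)"
  then show "\<forall>\<^sub>F t in nhds 0. ((\<lambda>t. f t + g t) has_real_derivative f' t + g' t) (at t)"
    by eventually_elim (rule DERIV_add)
qed (auto intro: DERIV_add)

lemma second_deriv_at0_cmult:
  "second_deriv_at0 f c \<Longrightarrow> second_deriv_at0 (\<lambda>t. k * f t) (k * c)"
  unfolding second_deriv_at0_def
proof (elim exE conjE, intro exI conjI)
  fix f'
  assume "\<forall>\<^sub>F t in nhds 0. (f has_real_derivative f' t) (at t)"
  then show "\<forall>\<^sub>F t in nhds 0. ((\<lambda>t. k * f t) has_real_derivative k * f' t) (at t)"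
    by eventually_elim (rule DERIV_cmult)
qed (auto intro: DERIV_cmult)

text \<open>If d > 0, then f' is positive just to the right of its zero at 0, and the mean value
  theorem makes f exceed f 0 there.\<close>

lemma second_deriv_at0_local_max:
  assumes "second_deriv_at0 f d" and max: "\<forall>\<^sub>F t in nhds 0. f t \<le> f 0"
  shows "d \<le> 0"
proof (rule ccontr)
  assume neg: "\<not> d \<le> 0"
  obtain f' where f': "\<forall>\<^sub>F t in nhds 0. (f has_real_derivative f' t) (at t)" "(f' has_real_derivative d) (at 0)"
    using assms unfolding second_deriv_at0_def by blast
  obtain e where e: "e > 0" "\<And>t. \<bar>t\<bar> < e \<Longrightarrow> (f has_real_derivative f' t) (at t)" "\<And>t. \<bar>t\<bar> < e \<Longrightarrow> f t \<le> f 0"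
    using eventually_conj[OF f'(1) max] unfolding eventually_nhds_metric by (auto simp: dist_real_def)
  have "f' 0 = 0"
    by (rule DERIV_local_max[OF e(2)[of 0] e(1)]) (use e in \<open>auto simp: abs_minus_commute\<close>)
  moreover obtain \<delta> where \<delta>: "\<delta> > 0" "\<And>h. 0 < h \<Longrightarrow> h < \<delta> \<Longrightarrow> f' 0 < f' (0 + h)"
    using DERIV_pos_inc_right[OF f'(2)] neg by (metis not_le)
  ultimately have pos: "f' t > 0" if "0 < t" "t < \<delta>" for t using that by force
  define t where "t = min e \<delta> / 2"
  have t: "0 < t" "t < e" "t < \<delta>" using e \<delta> by (auto simp: t_def)
  obtain z where z: "0 < z" "z < t" "f t - f 0 = (t - 0) * f' z"
    using MVT2[OF t(1), of f f'] e(2) t by force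
  then have "f t - f 0 > 0" using pos[of z] t by simp
  then show False using e(3)[of t] t by simp
qed

text \<open>Adding a small multiple of the squared distance makes the Laplacian strictly positive.\<close>

lemma laplacian_max_principle:
  fixes w :: "complex \<Rightarrow> real"
  assumes cont: "continuous_on (cball x s) w" and s: "0 < s"
    and lap: "\<And>z. z \<in> ball x s \<Longrightarrow> \<exists>a b. a + b = 0 \<and> second_deriv_at0 (\<lambda>t. w (z + of_real t)) a \<and>
        second_deriv_at0 (\<lambda>t. w (z + \<i> * of_real t)) b"
    and bdry: "\<And>z. z \<in> sphere x s \<Longrightarrow> w z \<le> c"
    and z: "z \<in> cball x s"
  shows "w z \<le> c"
proof (rule ccontr)
  assume neg: "\<not> w z \<le> c"
  \<comment> \<open>Half the excess of w z over c, divided by the squared radius: the added term is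
    then too small to lift v on the circle up to v z.\<close>
  define \<delta> where "\<delta> = (w z - c) / (2 * s\<^sup>2)"
  have \<delta>: "\<delta> > 0" "\<delta> * s\<^sup>2 < w z - c" using neg s by (auto simp: \<delta>_def field_simps)
  define v where "v y = w y + \<delta> * (norm (y - x))\<^sup>2" for y
  have "continuous_on (cball x s) v" unfolding v_def by (intro continuous_intros cont)
  then obtain p where p: "p \<in> cball x s" "\<And>y. y \<in> cball x s \<Longrightarrow> v y \<le> v p"
    using continuous_attains_sup[of "cball x s" v] s by auto
  have "v y < v z" if y: "y \<in> sphere x s" for y
  proof -
    have "norm (y - x) = s" using y by (simp add: dist_norm norm_minus_commute)
    then have "v y \<le> c + \<delta> * s\<^sup>2" using bdry[OF y] by (simp add: v_def)
    also have "\<dots> < w z" using \<delta> by simp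
    also have "\<dots> \<le> v z" using \<delta> by (simp add: v_def)
    finally show ?thesis .
  qed
  then have "p \<notin> sphere x s" using p(2)[OF z] by fastforce
  then have pb: "p \<in> ball x s" using p(1) by auto
  then obtain e where e: "e > 0" "ball p e \<subseteq> ball x s" using open_ball open_contains_ball by metis
  obtain a b where ab: "a + b = 0" "second_deriv_at0 (\<lambda>t. w (p + of_real t)) a"
      "second_deriv_at0 (\<lambda>t. w (p + \<i> * of_real t)) b"
    using lap[OF pb] by auto
  have max: "\<forall>\<^sub>F t in nhds (0::real). v (p + k * of_real t) \<le> v (p + k * of_real 0)" if "norm k = 1" for k
    unfolding eventually_nhds_metric
  proof (intro exI[of _ e] conjI allI impI)
    fix t :: real assume "dist t 0 < e"
    then have "p + k * of_real t \<in> ball p e" using that by (simp add: dist_norm norm_mult)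
    then show "v (p + k * of_real t) \<le> v (p + k * of_real 0)" using e p(2) by (auto simp: subset_iff)
  qed (rule e)
  have sq: "second_deriv_at0 (\<lambda>t. (norm (p + k * of_real t - x))\<^sup>2) 2" if k: "k = 1 \<or> k = \<i>" for k
    unfolding second_deriv_at0_def
  proof (intro exI conjI)
    show "\<forall>\<^sub>F t in nhds 0. ((\<lambda>t. (norm (p + k * of_real t - x))\<^sup>2) has_real_derivative
        2 * (if k = 1 then Re (p - x) + t else Im (p - x) + t)) (at t)"
      using k by (auto simp: cmod_power2 intro!: always_eventually derivative_eq_intros)
    show "((\<lambda>t. 2 * (if k = 1 then Re (p - x) + t else Im (p - x) + t)) has_real_derivative 2) (at 0)"
      by (cases "k = 1") (auto intro!: derivative_eq_intros)
  qed
  have "second_deriv_at0 (\<lambda>t. v (p + 1 * of_real t)) (a + \<delta> * 2)"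
    unfolding v_def using ab(2) by (intro second_deriv_at0_add second_deriv_at0_cmult sq) auto
  from second_deriv_at0_local_max[OF this max] have "a + \<delta> * 2 \<le> 0" by simp
  moreover have "second_deriv_at0 (\<lambda>t. v (p + \<i> * of_real t)) (b + \<delta> * 2)"
    unfolding v_def using ab(3) by (intro second_deriv_at0_add second_deriv_at0_cmult sq) auto
  from second_deriv_at0_local_max[OF this max] have "b + \<delta> * 2 \<le> 0" by simp
  ultimately show False using ab(1) \<delta> by simp
qed

text \<open>The factor \<open>k * k\<close> is 1 for the real and -1 for the imaginary direction, so
  the two second derivatives cancel.\<close>

lemma second_deriv_at0_Re_holomorphic:
  assumes "P holomorphic_on UNIV"
  shows "second_deriv_at0 (\<lambda>t. Re (P (z + k * of_real t))) (Re (k * k * deriv (deriv P) z))"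
  unfolding second_deriv_at0_def
proof (intro exI conjI)
  have hol: "deriv P holomorphic_on UNIV" using assms by (auto intro: holomorphic_deriv)
  have d: "((\<lambda>t. Q (z + k * of_real t)) has_vector_derivative k * deriv Q (z + k * of_real t)) (at t)"
    if "Q holomorphic_on UNIV" for Q and t :: real
  proof -
    have "(Q has_field_derivative deriv Q (z + k * of_real t)) (at (z + k * of_real t))"
      by (rule holomorphic_derivI[OF that open_UNIV]) auto
    moreover have "((\<lambda>t. z + k * of_real t) has_vector_derivative k) (at t)"
      by (auto intro!: derivative_eq_intros)
    ultimately show ?thesis using field_vector_diff_chain_at[of "\<lambda>t. z + k * of_real t" k t Q] by (simp add: o_def)
  qed
  have Re: "((\<lambda>t. Re (f t)) has_real_derivative Re f') (at t)" if "(f has_vector_derivative f') (at t)" for f f' and t :: real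
    using bounded_linear.has_vector_derivative[OF bounded_linear_Re that] by (simp add: has_real_derivative_iff_has_vector_derivative)
  show "\<forall>\<^sub>F t in nhds 0. ((\<lambda>t. Re (P (z + k * of_real t))) has_real_derivative Re (k * deriv P (z + k * of_real t))) (at t)"
    by (intro always_eventually allI Re d assms)
  have "((\<lambda>t. k * deriv P (z + k * of_real t)) has_vector_derivative k * (k * deriv (deriv P) (z + k * of_real 0))) (at 0)"
    by (intro has_vector_derivative_mult_right d hol)
  from Re[OF this] show "((\<lambda>t. Re (k * deriv P (z + k * of_real t))) has_real_derivative Re (k * k * deriv (deriv P) z)) (at 0)"
    by (simp add: mult.assoc)
qed

lemma harmonic_on_second_deriv_at0:
  assumes "harmonic_on U u" "x \<in> U"
  shows "second_deriv_at0 (\<lambda>t. u (x + t *\<^sub>R axis i 1)) (dpartial i (dpartial i u) x)"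
  unfolding second_deriv_at0_def
proof (intro exI conjI)
  let ?l = "\<lambda>t. x + t *\<^sub>R axis i (1::real)"
  have op: "open U" using assms by (simp add: harmonic_on_def)
  have "continuous_on UNIV ?l" by (intro continuous_intros)
  then have "open (?l -` U)" using op open_vimage by blast
  moreover have "0 \<in> ?l -` U" using assms by simp
  ultimately have "\<forall>\<^sub>F t in nhds 0. t \<in> ?l -` U" by (rule eventually_nhds_in_open)
  then show "\<forall>\<^sub>F t in nhds 0. ((\<lambda>t. u (?l t)) has_real_derivative dpartial i u (?l t)) (at t)"
  proof eventually_elim
    case (elim t)
    then have "(\<lambda>h. u (?l t + h *\<^sub>R axis i 1)) differentiable (at 0)"
      using assms by (simp add: harmonic_on_def)
    then have "((\<lambda>h. u (?l t + h *\<^sub>R axis i 1)) has_real_derivative dpartial i u (?l t)) (at 0)"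
      unfolding dpartial_def by (metis DERIV_deriv_iff_real_differentiable)
    then have "((\<lambda>h. u (?l (h + t))) has_real_derivative dpartial i u (?l t)) (at 0)"
      by (simp add: algebra_simps)
    then show ?case using DERIV_shift[of "\<lambda>t. u (?l t)" "dpartial i u (?l t)" 0 t] by (simp add: algebra_simps)
  qed
  have "(\<lambda>t. dpartial i u (?l t)) differentiable (at 0)"
    using assms by (simp add: harmonic_on_def)
  then show "((\<lambda>t. dpartial i u (?l t)) has_real_derivative dpartial i (dpartial i u) x) (at 0)"
    unfolding dpartial_def[of i "dpartial i u"] by (metis DERIV_deriv_iff_real_differentiable)
qed

text \<open>The passage from partial derivatives to mean values. On a circle u is close to some Re
  P; the classical maximum principle, applied to both signs of the difference, carries this to the
  centre, where Re P is its own mean.\<close>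

lemma harmonic_on_imp_harm_on:
  assumes har: "harmonic_on U u" and cont: "continuous_on U u"
  shows "harm_on (to_pt -` U) (\<lambda>z. u (to_pt z))"
proof (rule harm_onI)
  let ?V = "to_pt -` U" and ?u = "\<lambda>z. u (to_pt z)"
  show "open ?V"
    using har continuous_on_to_pt[of UNIV] open_vimage by (auto simp: harmonic_on_def)
  show cu: "continuous_on ?V ?u"
    by (rule continuous_on_compose2[OF cont continuous_on_to_pt]) auto
  have "cmean ?u x s = ?u x" if cb: "cball x s \<subseteq> ?V" and s: "0 < s" for x s
  proof -
    have c: "continuous_on (cball x s) ?u" using cu cb continuous_on_subset by blast
    have cs: "continuous_on (sphere x s) ?u" using c by (rule continuous_on_subset) auto
    have "\<bar>cmean ?u x s - ?u x\<bar> \<le> 0 + e" if e: "0 < e" for e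
    proof -
      obtain P where P: "P holomorphic_on UNIV" "\<And>z. z \<in> sphere x s \<Longrightarrow> \<bar>?u z - Re (P z)\<bar> < e/2"
        using continuous_on_sphere_approx_Re_entire[OF cs s, of "e/2"] e by auto
      have cP: "continuous_on A (\<lambda>z. Re (P z))" for A
        by (intro continuous_intros holomorphic_on_imp_continuous_on holomorphic_on_subset[OF P(1)]) auto
      have le: "k * ?u x + (-k) * Re (P x) \<le> e/2" if k: "k = 1 \<or> k = -1" for k
      proof (rule laplacian_max_principle[where w = "\<lambda>x. k * ?u x + (-k) * Re (P x)"])
        show "continuous_on (cball x s) (\<lambda>x. k * ?u x + (-k) * Re (P x))"
          by (intro continuous_on_add continuous_on_mult continuous_on_const c cP)
        show "k * ?u z + (-k) * Re (P z) \<le> e/2" if "z \<in> sphere x s" for z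
        proof -
          have "\<bar>?u z - Re (P z)\<bar> < e/2" using P(2)[OF that] .
          then have "?u z - Re (P z) \<le> e/2" "- (?u z - Re (P z)) \<le> e/2" by linarith+
          then show ?thesis using k by auto
        qed
        show "\<exists>a b. a + b = 0 \<and> second_deriv_at0 (\<lambda>t. k * ?u (z + of_real t) + (-k) * Re (P (z + of_real t))) a \<and>
          second_deriv_at0 (\<lambda>t. k * ?u (z + \<i> * of_real t) + (-k) * Re (P (z + \<i> * of_real t))) b"
          if "z \<in> ball x s" for z
        proof (intro exI conjI)
          have zU: "to_pt z \<in> U" using that cb by (auto simp: subset_iff)
          show "second_deriv_at0 (\<lambda>t. k * ?u (z + of_real t) + (-k) * Re (P (z + of_real t)))
            (k * dpartial 1 (dpartial 1 u) (to_pt z) + (-k) * Re (1 * 1 * deriv (deriv P) z))"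
            using second_deriv_at0_Re_holomorphic[OF P(1), of z 1] harmonic_on_second_deriv_at0[OF har zU, of 1]
            by (intro second_deriv_at0_add second_deriv_at0_cmult) (auto simp: to_pt_add_real)
          show "second_deriv_at0 (\<lambda>t. k * ?u (z + \<i> * of_real t) + (-k) * Re (P (z + \<i> * of_real t)))
            (k * dpartial 2 (dpartial 2 u) (to_pt z) + (-k) * Re (\<i> * \<i> * deriv (deriv P) z))"
            using second_deriv_at0_Re_holomorphic[OF P(1), of z \<i>] harmonic_on_second_deriv_at0[OF har zU, of 2]
            by (intro second_deriv_at0_add second_deriv_at0_cmult) (auto simp: to_pt_add_imag)
          have "(\<Sum>i\<in>UNIV. dpartial i (dpartial i u) (to_pt z)) = 0" using har zU by (simp add: harmonic_on_def)
          then have "dpartial 1 (dpartial 1 u) (to_pt z) = - dpartial 2 (dpartial 2 u) (to_pt z)" by (simp add: sum_2)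
          then show "(k * dpartial 1 (dpartial 1 u) (to_pt z) + (-k) * Re (1 * 1 * deriv (deriv P) z)) +
            (k * dpartial 2 (dpartial 2 u) (to_pt z) + (-k) * Re (\<i> * \<i> * deriv (deriv P) z)) = 0" by simp
        qed
      qed (use s in auto)
      have "\<bar>?u x - Re (P x)\<bar> \<le> e/2" using le[of 1] le[of "-1"] by (simp only: abs_le_iff) linarith
      moreover have "\<bar>cmean ?u x s - cmean (\<lambda>z. Re (P z)) x s\<bar> \<le> e/2"
        using P(2) s by (intro cmean_approx cs cP) (auto intro: less_imp_le simp del: mem_sphere)
      moreover have "cmean (\<lambda>z. Re (P z)) x s = Re (P x)"
        by (rule cmean_Re_holomorphic[OF P(1)]) (use s in auto)
      ultimately show ?thesis by (simp add: abs_if split: if_splits)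
    qed
    then have "\<bar>cmean ?u x s - ?u x\<bar> \<le> 0" by (rule field_le_epsilon)
    then show ?thesis by simp
  qed
  then show "\<exists>r0>0. \<forall>r. 0 < r \<longrightarrow> r < r0 \<longrightarrow> cball x r \<subseteq> ?V \<longrightarrow> cmean ?u x r = ?u x" for x
    by (intro exI[of _ 1]) auto
qed

subsection \<open>Removable singularities and the Lipschitz estimate\<close>

text \<open>A small multiple of ln (|z| / s) serves as barrier: it vanishes on the outer circle and
  tends to minus infinity at 0, where it beats the bound M.\<close>

lemma submean_on_punctured_max_principle:
  assumes sub: "submean_on (ball 0 r - {0}) w" and s: "0 < s" "s < r"
    and bdd: "\<And>z. z \<in> ball 0 r - {0} \<Longrightarrow> w z \<le> M"
    and bdry: "\<And>z. z \<in> sphere 0 s \<Longrightarrow> w z \<le> c"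
    and z: "z \<in> ball 0 s - {0}"
  shows "w z \<le> c"
proof (rule field_le_epsilon)
  fix e :: real assume e: "0 < e"
  have z': "0 < norm z" "norm z < s" using z by auto
  define L where "L = ln (s / norm z)"
  have L: "L > 0" unfolding L_def using z' by (intro ln_gt_zero) (simp only: less_divide_eq_1_pos)
  \<comment> \<open>With this factor the barrier costs exactly e at the given point z.\<close>
  define \<delta> where "\<delta> = e / L"
  have \<delta>: "\<delta> > 0" "\<delta> * L = e" using e L by (auto simp: \<delta>_def)
  \<comment> \<open>The inner circle leaves z outside and is so small that the barrier on it
    outweighs M - c.\<close>
  define \<rho> where "\<rho> = min (norm z / 2) (s * exp (- (\<bar>M - c\<bar> / \<delta>)))"
  have \<rho>: "0 < \<rho>" "\<rho> < norm z" using z' s by (auto simp: \<rho>_def intro: min.strict_coboundedI1)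
  have "\<rho> / s \<le> exp (- (\<bar>M - c\<bar> / \<delta>))" using s by (auto simp: \<rho>_def divide_le_eq mult.commute)
  then have "ln (\<rho> / s) \<le> - (\<bar>M - c\<bar> / \<delta>)" using \<rho> s by (metis divide_pos_pos exp_gt_zero ln_exp ln_le_cancel_iff)
  then have "\<delta> * ln (\<rho> / s) \<le> - \<bar>M - c\<bar>" using \<delta> by (simp add: field_simps)
  then have inner: "M + \<delta> * ln (\<rho> / s) \<le> c" by (simp add: abs_if split: if_splits)
  let ?A = "ball 0 s - cball (0::complex) \<rho>"
  let ?v = "\<lambda>z. w z + (\<delta> * ln (norm (z - 0)) + - \<delta> * ln s)"
  have closA: "closure ?A \<subseteq> cball 0 s - ball 0 \<rho>"
    by (rule closure_minimal) (auto intro!: closed_Diff)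
  have sub': "cball 0 s - ball 0 \<rho> \<subseteq> ball (0::complex) r - {0}" using s \<rho> by auto
  have "?v z \<le> c"
  proof (rule submean_max_principle[where U = ?A and u = ?v])
    have op: "open ?A" by auto
    show "submean_on ?A ?v"
    proof (intro submean_on_add submean_on_const op)
      show "submean_on ?A w" by (rule submean_on_subset[OF sub op]) (use s \<rho> in auto)
      show "submean_on ?A (\<lambda>z. \<delta> * ln (norm (z - 0)))"
        by (rule submean_on_subset[OF submean_on_cmult[OF harm_on_submean(1)[OF harm_on_ln_norm[of 0]]] op])
           (use \<delta> \<rho> in auto)
    qed
    show "continuous_on (closure ?A) ?v"
    proof (intro continuous_on_add continuous_on_mult continuous_on_const)
      have cl: "closure ?A \<subseteq> ball 0 r - {0}" using closA sub' by blast
      show "continuous_on (closure ?A) w"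
        using sub cl continuous_on_subset unfolding submean_on_def by blast
      show "continuous_on (closure ?A) (\<lambda>z. ln (norm (z - 0)))"
        by (rule continuous_on_subset[OF harm_on_continuous[OF harm_on_ln_norm[of 0]]]) (use cl in auto)
    qed
    fix y assume y: "y \<in> frontier ?A"
    have yc: "y \<in> cball 0 s - ball 0 \<rho>" using y closA by (auto simp: frontier_def)
    have "y \<notin> ?A" using y op by (simp add: frontier_def interior_open)
    then have "norm y = s \<or> norm y = \<rho>" using yc by auto
    then show "?v y \<le> c"
    proof
      assume "norm y = s" then show ?thesis using bdry[of y] by simp
    next
      assume ny: "norm y = \<rho>"
      have "w y \<le> M" using yc sub' bdd by blast
      then show ?thesis using inner ny \<rho> s by (simp add: ln_div algebra_simps)
    qed
  qed (use z' \<rho> in auto)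
  moreover have "\<delta> * ln (norm z) + - \<delta> * ln s = - e"
    using \<delta>(2) z' by (simp add: L_def ln_div algebra_simps)
  ultimately show "w z \<le> c + e" by simp
qed

text \<open>The missing value is the mean over a circle. If Re P is close to u on that circle, it is
  close in the whole punctured disc, and the mean is close to Re (P 0); so the extension is a
  uniform limit of harmonic functions.\<close>

lemma harm_on_removable_singularity:
  assumes u: "harm_on (ball 0 r - {0}) u" and bdd: "\<And>z. z \<in> ball 0 r - {0} \<Longrightarrow> \<bar>u z\<bar> \<le> M" and r: "0 < r"
  obtains c where "harm_on (ball 0 r) (u(0 := c))"
proof -
  define s where "s = r/2"
  have s: "0 < s" "s < r" using r by (auto simp: s_def)
  have "sphere 0 s \<subseteq> ball 0 r - {0}" using s by auto
  then have cs: "continuous_on (sphere 0 s) u" using harm_on_continuous[OF u] continuous_on_subset by blast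
  define v where "v = u(0 := cmean u 0 s)"
  have "harm_on (ball 0 s) v"
  proof (rule harm_on_uniform_approx)
    fix e :: real assume e: "0 < e"
    obtain P where P: "P holomorphic_on UNIV" "\<And>z. z \<in> sphere 0 s \<Longrightarrow> \<bar>u z - Re (P z)\<bar> < e"
      using continuous_on_sphere_approx_Re_entire[OF cs s(1) e] by blast
    have cP: "continuous_on A (\<lambda>z. Re (P z))" for A
      by (intro continuous_intros holomorphic_on_imp_continuous_on holomorphic_on_subset[OF P(1)]) auto
    have hP: "harm_on A (\<lambda>z. Re (P z))" if "open A" for A
      using that P(1) by (intro harm_on_Re_holomorphic) (auto intro: holomorphic_on_subset)
    have h: "harm_on (ball 0 r - {0}) (\<lambda>z. u z - Re (P z))"
      by (intro harm_on_diff u hP) auto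
    have "compact ((\<lambda>z. Re (P z)) ` cball 0 r)" by (intro compact_continuous_image cP) auto
    then obtain B where B: "\<And>z. z \<in> cball 0 r \<Longrightarrow> \<bar>Re (P z)\<bar> \<le> B"
      using compact_imp_bounded bounded_iff by (metis imageI real_norm_def)
    have B': "\<bar>u z - Re (P z)\<bar> \<le> M + B" if "z \<in> ball 0 r - {0}" for z
      using bdd[OF that] B[of z] that by (simp add: abs_le_iff)
    have le: "\<bar>u z - Re (P z)\<bar> \<le> e" if z: "z \<in> ball 0 s - {0}" for z
    proof -
      have "u z - Re (P z) \<le> e"
        by (rule submean_on_punctured_max_principle[OF harm_on_submean(1)[OF h] s _ _ z, where M = "M + B"])
           (use B' P(2) in \<open>auto simp: abs_le_iff abs_less_iff intro: less_imp_le simp del: mem_sphere\<close>)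
      moreover have "- (u z - Re (P z)) \<le> e"
        by (rule submean_on_punctured_max_principle[OF harm_on_submean(2)[OF h] s _ _ z, where M = "M + B"])
           (use B' P(2) in \<open>auto simp: abs_le_iff abs_less_iff intro: less_imp_le simp del: mem_sphere\<close>)
      ultimately show ?thesis by (simp add: abs_le_iff)
    qed
    have "\<bar>cmean u 0 s - cmean (\<lambda>z. Re (P z)) 0 s\<bar> \<le> e"
      using P(2) s by (intro cmean_approx cs cP) (auto intro: less_imp_le simp del: mem_sphere)
    moreover have "cmean (\<lambda>z. Re (P z)) 0 s = Re (P 0)"
      by (rule cmean_Re_holomorphic[OF P(1)]) (use s in auto)
    ultimately have "\<forall>x\<in>ball 0 s. \<bar>v x - Re (P x)\<bar> \<le> e" using le by (auto simp: v_def)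
    then show "\<exists>v'. harm_on (ball 0 s) v' \<and> (\<forall>x\<in>ball 0 s. \<bar>v x - v' x\<bar> \<le> e)" using hP by blast
  qed auto
  moreover have "harm_on (ball 0 r - {0}) v" by (rule harm_on_cong[OF u]) (auto simp: v_def)
  ultimately have "harm_on (ball 0 s \<union> (ball 0 r - {0})) v" by (rule harm_on_Un)
  moreover have "ball 0 s \<union> (ball 0 r - {0}) = ball (0::complex) r" using s by auto
  ultimately show thesis using that by (simp add: v_def)
qed

text \<open>The exponential turns a bounded real part into a bounded holomorphic function, to which
  the Schwarz lemma applies.\<close>

lemma Re_entire_Lipschitz:
  assumes P: "P holomorphic_on UNIV" and s: "0 < s" and M: "0 < M"
    and bdd: "\<And>z. z \<in> cball 0 s \<Longrightarrow> \<bar>Re (P z)\<bar> \<le> M" and z: "norm z < s"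
  shows "\<bar>Re (P z) - Re (P 0)\<bar> \<le> 21 * M * norm z / s"
proof -
  define E where "E w = exp (P (of_real s * w) / of_real M)" for w
  have nE: "norm (E w) = exp (Re (P (of_real s * w)) / M)" for w by (simp add: E_def)
  have bE: "1/3 \<le> norm (E w)" "norm (E w) \<le> 3" if "norm w < 1" for w
  proof -
    have "of_real s * w \<in> cball 0 s" using that s by (simp add: norm_mult)
    then have "\<bar>Re (P (of_real s * w)) / M\<bar> \<le> 1" using bdd M by (simp add: abs_le_iff field_simps)
    then have "exp (-1) \<le> norm (E w)" "norm (E w) \<le> exp 1" unfolding nE exp_le_cancel_iff abs_le_iff by auto
    moreover have "exp (-1::real) \<ge> 1/3" using exp_le by (simp add: exp_minus field_simps)
    ultimately show "1/3 \<le> norm (E w)" "norm (E w) \<le> 3" using exp_le by auto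
  qed
  \<comment> \<open>Both norms are at most e \<le> 3, so the difference has norm at most 6. Division
    by 7 gives a map of the unit disc into itself that fixes 0.\<close>
  define f where "f w = (E w - E 0) / 7" for w
  have "(\<lambda>w. P (of_real s * w)) holomorphic_on UNIV"
    by (rule holomorphic_on_compose_gen[OF _ P, unfolded o_def]) (auto intro!: holomorphic_intros)
  then have "f holomorphic_on UNIV" unfolding f_def E_def using M by (intro holomorphic_intros) auto
  then have fh: "f holomorphic_on ball 0 1" using holomorphic_on_subset by blast
  have f1: "norm (f w) < 1" if "norm w < 1" for w
    using bE[OF that] bE[of 0] norm_triangle_ineq4[of "E w" "E 0"] by (simp add: f_def norm_divide)
  define w where "w = z / of_real s"
  have w: "norm w < 1" "norm w = norm z / s" "of_real s * w = z" using z s by (auto simp: w_def norm_divide)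
  have "norm (f w) \<le> norm w"
    by (rule Schwarz_Lemma(1)[OF fh _ f1 w(1)]) (auto simp: f_def)
  then have "norm (E w - E 0) \<le> 7 * norm w" by (simp add: f_def norm_divide)
  then have d: "\<bar>norm (E w) - norm (E 0)\<bar> \<le> 7 * norm w" using norm_triangle_ineq3 order_trans by blast
  \<comment> \<open>The logarithm undoes the exponential. Above 1/3 its Lipschitz constant is 3,
    whence 21 = 3 * 7.\<close>
  have ln_le: "ln a - ln b \<le> 3 * \<bar>a - b\<bar>" if "1/3 \<le> a" "1/3 \<le> b" for a b :: real
  proof -
    have "ln a - ln b = ln (a / b)" using that by (simp add: ln_div)
    also have "\<dots> \<le> a / b - 1" using that by (intro ln_le_minus_one) simp
    also have "\<dots> = (a - b) / b" using that by (simp add: field_simps)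
    also have "\<dots> \<le> \<bar>a - b\<bar> / b" using that by (intro divide_right_mono) auto
    also have "\<dots> \<le> \<bar>a - b\<bar> / (1/3)" using that by (intro divide_left_mono) auto
    finally show ?thesis by simp
  qed
  have "\<bar>ln (norm (E w)) - ln (norm (E 0))\<bar> \<le> 3 * (7 * norm w)"
  proof -
    have b: "1/3 \<le> norm (E w)" "1/3 \<le> norm (E 0)" using bE(1)[OF w(1)] bE(1)[of 0] by simp_all
    have "ln (norm (E w)) - ln (norm (E 0)) \<le> 3 * (7 * norm w)"
      by (rule order_trans[OF ln_le[OF b]]) (use d in simp)
    moreover have "- (ln (norm (E w)) - ln (norm (E 0))) \<le> 3 * (7 * norm w)"
      using order_trans[OF ln_le[OF b(2,1)], of "3 * (7 * norm w)"] d by (simp add: abs_minus_commute)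
    ultimately show ?thesis by (rule abs_leI)
  qed
  moreover have "ln (norm (E w)) = Re (P z) / M" "ln (norm (E 0)) = Re (P 0) / M"
    by (auto simp: nE w)
  ultimately show ?thesis using M w(2) s by (simp add: field_simps flip: diff_divide_distrib)
qed

lemma harm_on_Lipschitz_at_0:
  assumes u: "harm_on U u" and cb: "cball 0 s \<subseteq> U" and s: "0 < s" and M: "0 < M"
    and bdd: "\<And>z. z \<in> cball 0 s \<Longrightarrow> \<bar>u z\<bar> \<le> M" and z: "norm z < s"
  shows "\<bar>u z - u 0\<bar> \<le> 42 * M / s * norm z"
proof (rule field_le_epsilon)
  fix e :: real assume "0 < e"
  \<comment> \<open>The approximating real part is then bounded by M + d \<le> 2 * M, which doubles
    the constant 21.\<close>
  define d where "d = min (e/2) M"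
  have d: "0 < d" "d \<le> e/2" "d \<le> M" using \<open>0 < e\<close> M by (auto simp: d_def)
  obtain P where P: "P holomorphic_on UNIV" "\<And>z. z \<in> cball 0 s \<Longrightarrow> \<bar>u z - Re (P z)\<bar> \<le> d"
    using harm_on_approx_Re_entire[OF u cb s d(1)] by blast
  have "\<bar>Re (P z)\<bar> \<le> 2 * M" if "z \<in> cball 0 s" for z
    using P(2)[OF that] bdd[OF that] d by linarith
  then have "\<bar>Re (P z) - Re (P 0)\<bar> \<le> 21 * (2 * M) * norm z / s"
    by (intro Re_entire_Lipschitz[OF P(1) s _ _ z]) (use M in auto)
  moreover have "\<bar>u z - Re (P z)\<bar> \<le> d" "\<bar>u 0 - Re (P 0)\<bar> \<le> d" using P(2) z s by auto
  ultimately show "\<bar>u z - u 0\<bar> \<le> 42 * M / s * norm z + e" using d by simp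
qed

subsection \<open>The regular part of Green's function\<close>

text \<open>The regular part for the pole y: Green's function is
  \<open>- ln (dist x y) / (2*pi) - u x\<close>. As a predicate on u it covers \<Omega>, the
  perforated domains and the inverted exterior domain alike.\<close>

definition green_corr :: "complex set \<Rightarrow> complex \<Rightarrow> (complex \<Rightarrow> real) \<Rightarrow> bool" where
  "green_corr D y u \<longleftrightarrow> harm_on D u \<and> continuous_on (closure D) u \<and>
     (\<forall>x\<in>frontier D. u x = - ln (dist x y) / (2 * pi))"

section \<open>Truncated logarithms and bounds for regular parts\<close>

text \<open>Freezing the logarithm within distance t of the pole keeps it continuous and below its
  means, so the maximum principle can be applied across the pole.\<close>

definition trunc_ln :: "real \<Rightarrow> complex \<Rightarrow> complex \<Rightarrow> real" where
  "trunc_ln t a x = ln (max (norm (x - a)) t)"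

lemma continuous_on_trunc_ln: "0 < t \<Longrightarrow> continuous_on A (trunc_ln t a)"
  unfolding trunc_ln_def by (intro continuous_intros) (auto simp: max_def)

lemma trunc_ln_ge: "0 < t \<Longrightarrow> ln t \<le> trunc_ln t a x"
  by (simp add: trunc_ln_def)

text \<open>Where the truncation is active the value is the global minimum; elsewhere the harmonic
  logarithm agrees at the point and lies below on the circle.\<close>

lemma submean_on_trunc_ln:
  assumes t: "0 < t"
  shows "submean_on UNIV (trunc_ln t a)"
proof (rule submean_onI)
  fix x
  show "\<exists>r0>0. \<forall>r. 0 < r \<longrightarrow> r < r0 \<longrightarrow> cball x r \<subseteq> UNIV \<longrightarrow> trunc_ln t a x \<le> cmean (trunc_ln t a) x r"
  proof (cases "norm (x - a) \<le> t")
    case True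
    then have "trunc_ln t a x = ln t" by (simp add: trunc_ln_def max_def)
    then show ?thesis
      by (auto intro!: exI[of _ 1] cmean_ge_const continuous_on_trunc_ln trunc_ln_ge t)
  next
    case False
    show ?thesis
    proof (intro exI[of _ "norm (x - a)"] conjI allI impI)
      fix r assume r: "0 < r" "r < norm (x - a)"
      have cb: "cball x r \<subseteq> - {a}" using r by (auto simp: dist_norm)
      have "trunc_ln t a x = ln (norm (x - a))" using False by (simp add: trunc_ln_def max_def)
      also have "\<dots> = cmean (\<lambda>z. ln (norm (z - a))) x r"
        using harm_on_cmean[OF harm_on_ln_norm cb r(1)] by simp
      also have "\<dots> \<le> cmean (trunc_ln t a) x r"
      proof (rule cmean_mono)
        show "continuous_on (sphere x r) (\<lambda>z. ln (norm (z - a)))"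
          by (rule continuous_on_subset[OF harm_on_continuous[OF harm_on_ln_norm]])
             (use cb sphere_subset_if_cball in auto)
        show "ln (norm (z - a)) \<le> trunc_ln t a z" if "z \<in> sphere x r" for z
        proof -
          have "z \<noteq> a" using that cb by (auto simp: subset_iff)
          then show ?thesis unfolding trunc_ln_def by (intro ln_mono) auto
        qed
      qed (use r continuous_on_trunc_ln[OF t] in auto)
      finally show "trunc_ln t a x \<le> cmean (trunc_ln t a) x r" .
    qed (use False t in auto)
  qed
qed (use continuous_on_trunc_ln[OF t] in auto)

text \<open>Positivity of Green's function with its pole cut off: the frontier does not see the
  truncation, so the boundary values cancel.\<close>

lemma green_corr_le_trunc:
  assumes D: "bounded D" and gc: "green_corr D y u" and t: "0 < t" and fr: "\<And>x. x \<in> frontier D \<Longrightarrow> t \<le> dist x y"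
    and x: "x \<in> D"
  shows "u x + 1/(2*pi) * trunc_ln t y x \<le> 0"
proof (rule submean_max_principle[where U = D and u = "\<lambda>x. u x + 1/(2*pi) * trunc_ln t y x"])
  have op: "open D" using gc harm_on_open by (auto simp: green_corr_def)
  show "submean_on D (\<lambda>x. u x + 1/(2*pi) * trunc_ln t y x)"
    using gc submean_on_subset[OF submean_on_trunc_ln[OF t] op]
    by (intro submean_on_add submean_on_cmult) (auto simp: green_corr_def harm_on_def)
  show "continuous_on (closure D) (\<lambda>x. u x + 1/(2*pi) * trunc_ln t y x)"
    using gc by (intro continuous_intros continuous_on_trunc_ln t) (auto simp: green_corr_def)
  show "u x + 1/(2*pi) * trunc_ln t y x \<le> 0" if "x \<in> frontier D" for x
    using gc that fr[OF that] by (simp add: green_corr_def trunc_ln_def dist_norm max_def)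
qed (use D x in auto)

lemma green_corr_le_fund:
  assumes D: "bounded D" and y: "y \<in> D" and gc: "green_corr D y u" and x: "x \<in> D" "x \<noteq> y"
  shows "u x \<le> - ln (dist x y) / (2*pi)"
proof -
  have op: "open D" using gc harm_on_open by (auto simp: green_corr_def)
  then obtain r where r: "0 < r" "cball y r \<subseteq> D" using y open_contains_cball by metis
  \<comment> \<open>So small that neither the frontier nor x sees the truncation.\<close>
  define t where "t = min r (dist x y)"
  have t: "0 < t" using r x by (simp add: t_def)
  have "u x + 1/(2*pi) * trunc_ln t y x \<le> 0"
  proof (rule green_corr_le_trunc[OF D gc t _ x(1)])
    fix z assume "z \<in> frontier D"
    then have "z \<notin> cball y r" using r op by (auto simp: frontier_def interior_open)
    then show "t \<le> dist z y" by (simp add: t_def dist_commute)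
  qed
  moreover have "trunc_ln t y x = ln (dist x y)" by (simp add: trunc_ln_def t_def dist_norm max_def)
  ultimately show ?thesis by (simp add: field_simps)
qed

text \<open>C must not depend on y, even for y near 0 or near the frontier. From below the size of D
  suffices. From above, either y is at least d/4 away from the frontier, which bounds the boundary
  values, or it is at least d/4 away from x, and positivity of Green's function bounds u x.\<close>

lemma green_corr_bounded_near_0:
  assumes D: "bounded D" and d: "0 < d" "ball 0 d \<subseteq> D"
  obtains C where "0 < C"
    "\<And>y u x. y \<in> D \<Longrightarrow> green_corr D y u \<Longrightarrow> norm x \<le> d/2 \<Longrightarrow> \<bar>u x\<bar> \<le> C"
proof -
  obtain B where B: "0 < B" "D \<subseteq> cball 0 B"
    using D bounded_pos[of D] by (auto simp: subset_iff)
  define C where "C = 1 + \<bar>ln (2*B)\<bar> + \<bar>ln (d/4)\<bar>"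
  have div: "a / (2*pi) \<le> \<bar>a\<bar>" for a :: real
  proof -
    have "a / (2*pi) \<le> \<bar>a\<bar> / (2*pi)" by (intro divide_right_mono) auto
    also have "\<dots> \<le> \<bar>a\<bar> / 1" using pi_gt3 by (intro divide_left_mono) auto
    finally show ?thesis by simp
  qed
  have "\<bar>u x\<bar> \<le> C" if y: "y \<in> D" and gc: "green_corr D y u" and nx: "norm x \<le> d/2" for y u x
  proof -
    have op: "open D" using gc harm_on_open by (auto simp: green_corr_def)
    have x: "x \<in> D" using d nx by (auto simp: subset_iff)
    have cu: "continuous_on (closure D) u" using gc by (auto simp: green_corr_def)
    have clD: "closure D \<subseteq> cball 0 B" using B by (intro closure_minimal) auto
    have fr: "u z = - ln (dist z y) / (2*pi)" "0 < dist z y" "dist z y \<le> 2*B" "norm z \<ge> d" if "z \<in> frontier D" for z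
    proof -
      show "u z = - ln (dist z y) / (2*pi)" using gc that by (auto simp: green_corr_def)
      have nD: "z \<notin> D" using that op by (auto simp: frontier_def interior_open)
      then show "0 < dist z y" using y by auto
      have "norm z \<le> B" "norm y \<le> B" using that clD B y by (auto simp: frontier_def)
      then show "dist z y \<le> 2*B" using norm_triangle_ineq4[of z y] by (simp add: dist_norm)
      show "norm z \<ge> d" using nD d by (metis in_mono mem_ball_0 not_le)
    qed
    have "- u x \<le> ln (2*B) / (2*pi)"
    proof (rule submean_max_principle[OF _ D continuous_on_minus[OF cu] _ x])
      show "submean_on D (\<lambda>x. - u x)" using gc by (auto simp: green_corr_def harm_on_def)
      show "- u z \<le> ln (2*B) / (2*pi)" if "z \<in> frontier D" for z
        using fr[OF that] B by (auto intro!: divide_right_mono ln_mono)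
    qed
    moreover have "u x \<le> - ln (d/4) / (2*pi)"
    proof (cases "norm y < 3*d/4")
      case True
      show ?thesis
      proof (rule submean_max_principle[OF _ D cu _ x])
        show "submean_on D u" using gc by (auto simp: green_corr_def harm_on_def)
        show "u z \<le> - ln (d/4) / (2*pi)" if "z \<in> frontier D" for z
        proof -
          have "d/4 \<le> dist z y" using fr(4)[OF that] True norm_triangle_ineq2[of z y] by (simp add: dist_norm)
          then have "ln (d/4) \<le> ln (dist z y)" using d by (intro ln_mono) auto
          then show ?thesis using fr(1)[OF that] by (simp add: divide_right_mono)
        qed
      qed
    next
      case False
      have "norm y \<le> norm x + norm (x - y)" by (metis norm_triangle_sub norm_minus_commute add.commute)
      then have xy: "d/4 \<le> dist x y" using False nx by (simp add: dist_norm)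
      then have "x \<noteq> y" using d by auto
      from green_corr_le_fund[OF D y gc x this] have "u x \<le> - ln (dist x y) / (2*pi)" .
      also have "\<dots> \<le> - ln (d/4) / (2*pi)" using xy d by (intro divide_right_mono) (auto intro!: ln_mono)
      finally show ?thesis .
    qed
    moreover have "\<bar>- ln (d/4)\<bar> = \<bar>ln (d/4)\<bar>" by simp
    ultimately show ?thesis using div[of "ln (2*B)"] div[of "- ln (d/4)"] unfolding C_def by linarith
  qed
  moreover have "0 < C" by (simp add: C_def add_pos_nonneg)
  ultimately show thesis using that by blast
qed

lemma green_corr_Lipschitz_at_0:
  assumes D: "bounded D" and d: "0 < d" "ball 0 d \<subseteq> D"
  obtains C where "0 < C"
    "\<And>y u x. y \<in> D \<Longrightarrow> green_corr D y u \<Longrightarrow> norm x < d/2 \<Longrightarrow> \<bar>u x - u 0\<bar> \<le> C * norm x"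
proof -
  obtain M where M: "0 < M" "\<And>y u x. y \<in> D \<Longrightarrow> green_corr D y u \<Longrightarrow> norm x \<le> d/2 \<Longrightarrow> \<bar>u x\<bar> \<le> M"
    using green_corr_bounded_near_0[OF assms] by blast
  show thesis
  proof (rule that[of "42 * M / (d/2)"])
    show "\<bar>u x - u 0\<bar> \<le> 42 * M / (d/2) * norm x" if "y \<in> D" "green_corr D y u" "norm x < d/2" for y u x
    proof (rule harm_on_Lipschitz_at_0[where U = D])
      show "cball 0 (d/2) \<subseteq> D" using d by (auto simp: subset_iff)
    qed (use that M d in \<open>auto simp: green_corr_def\<close>)
  qed (use M d in auto)
qed

subsection \<open>Symmetry of Green's function\<close>

lemma integral_UNIV_cbox:
  fixes f :: "complex \<Rightarrow> real"
  assumes "\<And>x. x \<notin> cbox a b \<Longrightarrow> f x = 0"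
  shows "integral UNIV f = integral (cbox a b) f"
proof -
  have "f = (\<lambda>x. if x \<in> cbox a b then f x else 0)" using assms by auto
  then show ?thesis by (metis integral_restrict_UNIV)
qed

lemma ball_subset_symmetric_cbox: "ball 0 R \<subseteq> cbox (Complex (-R) (-R)) (Complex R R)"
proof
  fix x assume "x \<in> ball (0::complex) R"
  then have "\<bar>Re x\<bar> \<le> R" "\<bar>Im x\<bar> \<le> R"
    using abs_Re_le_cmod[of x] abs_Im_le_cmod[of x] by auto
  then show "x \<in> cbox (Complex (-R) (-R)) (Complex R R)"
    by (auto simp: in_cbox_complex_iff abs_le_iff)
qed

lemma compact_support_integrable:
  fixes f :: "complex \<Rightarrow> real"
  assumes "continuous_on UNIV f" "\<And>x. x \<notin> ball 0 R \<Longrightarrow> f x = 0"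
  shows "f integrable_on UNIV"
proof (rule integrable_on_superset)
  show "f integrable_on cbox (Complex (-R) (-R)) (Complex R R)"
    by (rule integrable_continuous) (use assms continuous_on_subset in blast)
  show "f x = 0" if "x \<notin> cbox (Complex (-R) (-R)) (Complex R R)" for x
    using that assms(2) ball_subset_symmetric_cbox by blast
qed auto

lemma integral_UNIV_translate:
  fixes f :: "complex \<Rightarrow> real"
  assumes "\<And>x. x \<notin> ball 0 R \<Longrightarrow> f x = 0"
  shows "integral UNIV (\<lambda>x. f (x + v)) = integral UNIV f"
proof -
  let ?a = "Complex (-R) (-R)" and ?b = "Complex R R"
  have 0: "f x = 0" if "x \<notin> cbox ?a ?b" for x using that assms ball_subset_symmetric_cbox by blast
  have "integral UNIV (\<lambda>x. f (x + v)) = integral (cbox (?a - v) (?b - v)) (f \<circ> (+) v)"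
    unfolding o_def add.commute[of v]
  proof (rule integral_UNIV_cbox)
    fix x assume "x \<notin> cbox (?a - v) (?b - v)"
    then have "x + v \<notin> cbox ?a ?b" by (auto simp: in_cbox_complex_iff)
    then show "f (x + v) = 0" by (rule 0)
  qed
  also have "\<dots> = integral (cbox ?a ?b) f" by (simp add: integral_shift_cbox_plus)
  also have "\<dots> = integral UNIV f" using integral_UNIV_cbox[OF 0] by simp
  finally show ?thesis .
qed

text \<open>Needed because moving a translation from one factor of an integral to the other reverses
  its sign. The half-turn is a shift of the angle by pi.\<close>

lemma integral_circle_reflect:
  fixes f :: "complex \<Rightarrow> real"
  assumes "continuous_on UNIV f"
  shows "integral {0..2*pi} (\<lambda>\<theta>. f (- cis \<theta>)) = integral {0..2*pi} (\<lambda>\<theta>. f (cis \<theta>))"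
proof -
  let ?F = "\<lambda>\<theta>. f (cis \<theta>)"
  have c: "continuous_on A ?F" "continuous_on A (\<lambda>\<theta>. f (- cis \<theta>))" for A
    by (auto intro!: continuous_on_compose2[OF assms] continuous_intros)
  have sh: "?F \<circ> (+) pi = (\<lambda>\<theta>. f (- cis \<theta>))" "?F \<circ> (+) (2*pi) = ?F"
    by (auto simp: cis_mult[symmetric])
  have "integral {0..2*pi} (\<lambda>\<theta>. f (- cis \<theta>)) =
      integral {0..pi} (\<lambda>\<theta>. f (- cis \<theta>)) + integral {pi..2*pi} (\<lambda>\<theta>. f (- cis \<theta>))"
    by (rule Henstock_Kurzweil_Integration.integral_combine[symmetric]) (auto intro!: integrable_continuous_interval c)
  also have "integral {0..pi} (\<lambda>\<theta>. f (- cis \<theta>)) = integral {pi..2*pi} ?F"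
    using integral_shift_Icc_real[of 0 pi ?F pi] sh by simp
  also have "integral {pi..2*pi} (\<lambda>\<theta>. f (- cis \<theta>)) = integral {2*pi..3*pi} ?F"
    using integral_shift_Icc_real[of pi "2*pi" ?F pi] sh by simp
  also have "\<dots> = integral {0..pi} ?F"
    using integral_shift_Icc_real[of 0 pi ?F "2*pi"] sh by simp
  also have "integral {pi..2*pi} ?F + integral {0..pi} ?F = integral {0..2*pi} ?F"
    by (subst add.commute, rule Henstock_Kurzweil_Integration.integral_combine)
       (auto intro!: integrable_continuous_interval c)
  finally show ?thesis .
qed

lemma continuous_on_cmean:
  assumes "continuous_on UNIV q"
  shows "continuous_on A (\<lambda>x. cmean q x s)"
proof -
  have "continuous_on (A \<times> cbox 0 (2*pi)) (\<lambda>(x, \<theta>). q (x + of_real s * cis \<theta>))"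
    unfolding case_prod_beta
    by (rule continuous_on_compose2[OF assms]) (auto intro!: continuous_intros)
  then have "continuous_on A (\<lambda>x. integral (cbox 0 (2*pi)) (\<lambda>\<theta>. q (x + of_real s * cis \<theta>)))"
    by (rule integral_continuous_on_param)
  then show ?thesis unfolding cmean_def by (auto intro!: continuous_intros)
qed

lemma cmean_compact_support:
  assumes "\<And>x. x \<notin> ball 0 R \<Longrightarrow> q x = 0" "0 \<le> s" "x \<notin> ball 0 (R + s)"
  shows "cmean q x s = 0"
proof -
  have "cmean q x s = cmean (\<lambda>_. 0) x s"
  proof (rule cmean_cong)
    fix z assume "z \<in> sphere x s"
    then have "norm x \<le> norm z + s" by (metis dist_norm mem_sphere norm_triangle_sub)
    then show "q z = 0" using assms by (intro assms(1)) auto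
  qed (rule assms)
  then show ?thesis by simp
qed

text \<open>Fubini, followed by a translation that moves the shift from q to p. The box is enlarged
  by s because averaging spreads the support of q by s.\<close>

lemma integral_mult_cmean:
  assumes p: "continuous_on UNIV p" and q: "continuous_on UNIV q" "\<And>x. x \<notin> ball 0 R \<Longrightarrow> q x = 0" and s: "0 \<le> s"
  shows "integral UNIV (\<lambda>x. p x * cmean q x s) =
    integral {0..2*pi} (\<lambda>\<theta>. integral UNIV (\<lambda>x. p (x - of_real s * cis \<theta>) * q x)) / (2*pi)"
proof -
  define a b where "a = Complex (-(R+s)) (-(R+s))" and "b = Complex (R+s) (R+s)"
  have box: "ball 0 (R+s) \<subseteq> cbox a b" unfolding a_def b_def by (rule ball_subset_symmetric_cbox)
  have "integral UNIV (\<lambda>x. p x * cmean q x s) = integral (cbox a b) (\<lambda>x. p x * cmean q x s)"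
  proof (rule integral_UNIV_cbox)
    fix x assume "x \<notin> cbox a b"
    then have "x \<notin> ball 0 (R + s)" using box by blast
    then have "cmean q x s = 0" using q(2) by (intro cmean_compact_support[where R = R and q = q, OF _ s])
    then show "p x * cmean q x s = 0" by simp
  qed
  also have "\<dots> = integral (cbox a b) (\<lambda>x. integral (cbox 0 (2*pi)) (\<lambda>\<theta>. p x * q (x + of_real s * cis \<theta>))) / (2*pi)"
    by (simp add: cmean_def)
  also have "integral (cbox a b) (\<lambda>x. integral (cbox 0 (2*pi)) (\<lambda>\<theta>. p x * q (x + of_real s * cis \<theta>))) =
     integral (cbox 0 (2*pi)) (\<lambda>\<theta>. integral (cbox a b) (\<lambda>x. p x * q (x + of_real s * cis \<theta>)))"
    by (rule integral_swap_continuous, unfold case_prod_beta)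
       (intro continuous_intros continuous_on_compose2[OF p] continuous_on_compose2[OF q(1)]; auto intro!: continuous_intros)
  also have "(\<lambda>\<theta>. integral (cbox a b) (\<lambda>x. p x * q (x + of_real s * cis \<theta>))) =
     (\<lambda>\<theta>. integral UNIV (\<lambda>x. p (x - of_real s * cis \<theta>) * q x))"
  proof
    fix \<theta>
    have "integral (cbox a b) (\<lambda>x. p x * q (x + of_real s * cis \<theta>)) = integral UNIV (\<lambda>x. p x * q (x + of_real s * cis \<theta>))"
    proof (rule integral_UNIV_cbox[symmetric])
      fix x assume "x \<notin> cbox a b"
      then have "x \<notin> ball 0 (R + s)" using box by blast
      moreover have "norm x \<le> norm (x + of_real s * cis \<theta>) + s"
        using norm_triangle_ineq4[of "x + of_real s * cis \<theta>" "of_real s * cis \<theta>"] s by (simp add: norm_mult)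
      ultimately have "q (x + of_real s * cis \<theta>) = 0" by (intro q(2)) auto
      then show "p x * q (x + of_real s * cis \<theta>) = 0" by simp
    qed
    also have "\<dots> = integral UNIV (\<lambda>x. (\<lambda>y. p (y - of_real s * cis \<theta>) * q y) (x + of_real s * cis \<theta>))" by simp
    also have "\<dots> = integral UNIV (\<lambda>x. p (x - of_real s * cis \<theta>) * q x)"
      by (rule integral_UNIV_translate[of R]) (use q(2) in auto)
    finally show "integral (cbox a b) (\<lambda>x. p x * q (x + of_real s * cis \<theta>)) =
      integral UNIV (\<lambda>x. p (x - of_real s * cis \<theta>) * q x)" .
  qed
  finally show ?thesis by simp
qed

lemma integral_cmean:
  assumes "continuous_on UNIV q" "\<And>x. x \<notin> ball 0 R \<Longrightarrow> q x = 0" "0 \<le> s"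
  shows "integral UNIV (\<lambda>x. cmean q x s) = integral UNIV q"
  using integral_mult_cmean[of "\<lambda>_. 1" q R s] assms by simp

text \<open>The shift arrives at p with the opposite sign, which the reflection symmetry of the
  circle repairs.\<close>

lemma integral_mult_cmean_symmetric:
  assumes p: "continuous_on UNIV p" "\<And>x. x \<notin> ball 0 R \<Longrightarrow> p x = 0"
    and q: "continuous_on UNIV q" "\<And>x. x \<notin> ball 0 R \<Longrightarrow> q x = 0" and s: "0 \<le> s"
  shows "integral UNIV (\<lambda>x. p x * cmean q x s) = integral UNIV (\<lambda>x. q x * cmean p x s)"
proof -
  define a b where "a = Complex (-R) (-R)" and "b = Complex R R"
  have box: "ball 0 R \<subseteq> cbox a b" unfolding a_def b_def by (rule ball_subset_symmetric_cbox)
  have q0: "q x = 0" if "x \<notin> cbox a b" for x using that box q(2) by blast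
  define f where "f w = integral (cbox a b) (\<lambda>x. q x * p (x + of_real s * w))" for w
  have "continuous_on (UNIV \<times> cbox a b) (\<lambda>(w, x). q x * p (x + of_real s * w))"
    unfolding case_prod_beta
    by (intro continuous_intros continuous_on_compose2[OF p(1)] continuous_on_compose2[OF q(1)]) auto
  then have cf: "continuous_on UNIV f"
    unfolding f_def by (rule integral_continuous_on_param)
  have f: "integral UNIV (\<lambda>x. q x * p (x + of_real s * w)) = f w" for w
    unfolding f_def by (rule integral_UNIV_cbox) (simp add: q0)
  have "integral UNIV (\<lambda>x. p x * cmean q x s) = integral {0..2*pi} (\<lambda>\<theta>. f (- cis \<theta>)) / (2*pi)"
    using integral_mult_cmean[OF p(1) q s] f[of "- cis _"] by (simp add: mult.commute)
  also have "\<dots> = integral {0..2*pi} (\<lambda>\<theta>. f (cis \<theta>)) / (2*pi)"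
    using integral_circle_reflect[OF cf] by simp
  also have "\<dots> = integral (cbox 0 (2*pi)) (\<lambda>\<theta>. integral (cbox a b) (\<lambda>x. q x * p (x + of_real s * cis \<theta>))) / (2*pi)"
    by (simp add: f_def)
  also have "integral (cbox 0 (2*pi)) (\<lambda>\<theta>. integral (cbox a b) (\<lambda>x. q x * p (x + of_real s * cis \<theta>))) =
     integral (cbox a b) (\<lambda>x. integral (cbox 0 (2*pi)) (\<lambda>\<theta>. q x * p (x + of_real s * cis \<theta>)))"
    by (rule integral_swap_continuous, unfold case_prod_beta)
       (intro continuous_intros continuous_on_compose2[OF p(1)] continuous_on_compose2[OF q(1)]; auto intro!: continuous_intros)
  also have "\<dots> / (2*pi) = integral (cbox a b) (\<lambda>x. q x * cmean p x s)"
    by (simp add: cmean_def)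
  also have "\<dots> = integral UNIV (\<lambda>x. q x * cmean p x s)"
    by (rule integral_UNIV_cbox[symmetric]) (simp add: q0)
  finally show ?thesis .
qed

text \<open>Up to the factor $2\pi$, the density of the smeared-out pole that the mean value operator sees
  in the truncated fundamental solution.\<close>

definition pole_density :: "real \<Rightarrow> real \<Rightarrow> complex \<Rightarrow> real" where
  "pole_density s t x = cmean (trunc_ln t 0) x s - trunc_ln t 0 x"

lemma trunc_ln_translate: "trunc_ln t a x = trunc_ln t 0 (x - a)"
  by (simp add: trunc_ln_def)

lemma cmean_trunc_ln_translate: "cmean (trunc_ln t a) x s = cmean (trunc_ln t 0) (x - a) s"
  unfolding cmean_def trunc_ln_translate[of t a] by (simp add: algebra_simps)

lemma pole_density_translate: "pole_density s t (x - a) = cmean (trunc_ln t a) x s - trunc_ln t a x"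
  unfolding pole_density_def cmean_trunc_ln_translate[of t a] trunc_ln_translate[of t a x] by simp

lemma pole_density_nonneg: "0 < t \<Longrightarrow> 0 < s \<Longrightarrow> 0 \<le> pole_density s t x"
  using submean_on_le_cmean[OF submean_on_trunc_ln, of t x s 0] by (simp add: pole_density_def)

lemma pole_density_eq_0:
  assumes "0 < t" "0 < s" "s + t < norm x"
  shows "pole_density s t x = 0"
proof -
  have h: "harm_on (- cball 0 t) (trunc_ln t 0)"
  proof (rule harm_on_cong)
    show "harm_on (- cball 0 t) (\<lambda>z. ln (norm (z - 0)))"
      by (rule harm_on_subset[OF harm_on_ln_norm]) (use assms in auto)
    show "ln (norm (z - 0)) = trunc_ln t 0 z" if "z \<in> - cball 0 t" for z
      using that by (simp add: trunc_ln_def max_def)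
  qed
  have "cball x s \<subseteq> - cball 0 t"
  proof
    fix z assume "z \<in> cball x s"
    then have "norm x \<le> norm z + s"
      using norm_triangle_sub[of x z] by (simp add: dist_norm)
    then show "z \<in> - cball 0 t" using assms by simp
  qed
  then show ?thesis using harm_on_cmean[OF h _ assms(2)] by (simp add: pole_density_def)
qed

lemma continuous_on_pole_density: "0 < t \<Longrightarrow> continuous_on A (pole_density s t)"
  unfolding pole_density_def by (intro continuous_intros continuous_on_cmean continuous_on_trunc_ln)

lemma pole_density_support:
  assumes "0 < t" "0 < s" "s < t" "x \<notin> ball 0 (3*t)"
  shows "pole_density s t x = 0"
  using assms by (intro pole_density_eq_0) auto

text \<open>A vanishing integral would make the density zero everywhere. This fails at the point t
  of the truncation circle: the logarithm is minimal there, but the circle of radius s around it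
  reaches t + s. The symmetry proof finally divides by this mass.\<close>

lemma integral_pole_density_pos:
  assumes t: "0 < t" and s: "0 < s" "s < t"
  shows "0 < integral UNIV (pole_density s t)"
proof -
  let ?\<psi> = "pole_density s t"
  define a b where "a = Complex (-(3*t)) (-(3*t))" and "b = Complex (3*t) (3*t)"
  have box: "ball 0 (3*t) \<subseteq> cbox a b" unfolding a_def b_def by (rule ball_subset_symmetric_cbox)
  have int: "?\<psi> integrable_on UNIV"
    using compact_support_integrable[OF continuous_on_pole_density[OF t]] pole_density_support[OF t s] by blast
  have eq: "integral UNIV ?\<psi> = integral (cbox a b) ?\<psi>"
    by (rule integral_UNIV_cbox) (use box pole_density_support[OF t s] in blast)
  have "integral UNIV ?\<psi> \<noteq> 0"
  proof
    assume "integral UNIV ?\<psi> = 0"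
    then have hi: "(?\<psi> has_integral 0) (cbox a b)"
      using eq integrable_integral[OF integrable_continuous[OF continuous_on_pole_density[OF t, of "cbox a b" s]]] by simp
    have "of_real t \<in> cbox a b" using t by (auto simp: a_def b_def in_cbox_complex_iff)
    moreover have "0 \<in> box a b" using t by (auto simp: a_def b_def in_box_complex_iff)
    ultimately have "?\<psi> (of_real t) = 0"
      using has_integral_0_cbox_imp_0[OF continuous_on_pole_density[OF t] _ hi] pole_density_nonneg[OF t s(1)] by blast
    then have "cmean (trunc_ln t 0) (of_real t) s = ln t"
      using t by (simp add: pole_density_def trunc_ln_def)
    then have "- ln t \<le> cmean (\<lambda>z. - trunc_ln t 0 z) (of_real t) s" by (simp add: cmean_minus)
    then have "- trunc_ln t 0 (of_real t + of_real s) = - ln t"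
      using s by (intro cmean_eq_imp_const continuous_on_minus continuous_on_trunc_ln t)
        (auto intro!: trunc_ln_ge[OF t])
    moreover have "trunc_ln t 0 (of_real t + of_real s) = ln (t + s)"
      using t s by (simp add: trunc_ln_def max_def flip: of_real_add)
    ultimately show False using t s by simp
  qed
  moreover have "0 \<le> integral UNIV ?\<psi>"
    by (rule integral_nonneg[OF int]) (use pole_density_nonneg[OF t s(1)] in auto)
  ultimately show ?thesis by simp
qed

section \<open>Truncated Green's functions extended by zero\<close>

definition trunc_green :: "complex set \<Rightarrow> real \<Rightarrow> complex \<Rightarrow> (complex \<Rightarrow> real) \<Rightarrow> complex \<Rightarrow> real" where
  "trunc_green D t b u x = (if x \<in> D then - u x - 1/(2*pi) * trunc_ln t b x else 0)"

lemma trunc_green_frontier: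
  assumes gc: "green_corr D b u" and cb: "cball b t \<subseteq> D" and x: "x \<in> frontier D"
  shows "t \<le> dist x b" "u x + 1/(2*pi) * trunc_ln t b x = 0"
proof -
  have op: "open D" using gc harm_on_open by (auto simp: green_corr_def)
  have "x \<notin> D" using x op by (auto simp: frontier_def interior_open)
  then show td: "t \<le> dist x b" using cb by (metis dist_commute linear mem_cball subsetD)
  show "u x + 1/(2*pi) * trunc_ln t b x = 0"
    using gc x td by (simp add: green_corr_def trunc_ln_def dist_norm max_def)
qed

text \<open>The closed sets closure D and - D overlap exactly in the frontier, where both formulas
  give 0; continuity of u up to the frontier is all that is needed.\<close>

lemma trunc_green_continuous:
  assumes gc: "green_corr D b u" and t: "0 < t" and cb: "cball b t \<subseteq> D"
  shows "continuous_on UNIV (trunc_green D t b u)"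
proof -
  have op: "open D" using gc harm_on_open by (auto simp: green_corr_def)
  have fr: "frontier D = closure D - D" using op by (simp add: frontier_def interior_open)
  have "continuous_on (closure D \<union> - D) (trunc_green D t b u)"
  proof (rule continuous_on_closed_Un)
    show "continuous_on (- D) (trunc_green D t b u)"
      by (rule continuous_on_eq[of _ "\<lambda>_. 0"]) (auto simp: trunc_green_def)
    have "continuous_on (closure D) (\<lambda>x. - u x - 1/(2*pi) * trunc_ln t b x)"
      using gc by (intro continuous_intros continuous_on_trunc_ln t) (auto simp: green_corr_def)
    then show "continuous_on (closure D) (trunc_green D t b u)"
    proof (rule continuous_on_eq)
      fix x assume "x \<in> closure D"
      then show "- u x - 1/(2*pi) * trunc_ln t b x = trunc_green D t b u x"
        using trunc_green_frontier(2)[OF gc cb, of x] fr by (auto simp: trunc_green_def)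
    qed
  qed (use op in auto)
  moreover have "closure D \<union> - D = UNIV" using closure_subset by blast
  ultimately show ?thesis by simp
qed

lemma trunc_green_nonneg:
  assumes D: "bounded D" and gc: "green_corr D b u" and t: "0 < t" and cb: "cball b t \<subseteq> D"
  shows "0 \<le> trunc_green D t b u x"
  using green_corr_le_trunc[OF D gc t trunc_green_frontier(1)[OF gc cb], of x]
  by (auto simp: trunc_green_def)

text \<open>The regular part drops out by the mean value property, leaving the smeared pole with
  negative sign.\<close>

lemma cmean_trunc_green_inside:
  assumes gc: "green_corr D b u" and t: "0 < t" and s: "0 < s" and x: "cball x s \<subseteq> D"
  shows "cmean (trunc_green D t b u) x s - trunc_green D t b u x = - 1/(2*pi) * pole_density s t (x - b)"
proof -
  have hu: "harm_on D u" using gc by (auto simp: green_corr_def)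
  have sD: "sphere x s \<subseteq> D" using x sphere_subset_if_cball by blast
  have c: "continuous_on (sphere x s) u" using harm_on_continuous[OF hu] sD continuous_on_subset by blast
  have "cmean (trunc_green D t b u) x s = cmean (\<lambda>x. - u x - 1/(2*pi) * trunc_ln t b x) x s"
    by (rule cmean_cong) (use sD s in \<open>auto simp: trunc_green_def simp del: mem_sphere\<close>)
  also have "\<dots> = - cmean u x s - 1/(2*pi) * cmean (trunc_ln t b) x s"
    using s by (subst cmean_diff) (auto intro!: continuous_intros c continuous_on_trunc_ln t simp only: cmean_cmult cmean_minus less_imp_le)
  also have "cmean u x s = u x" by (rule harm_on_cmean[OF hu x s])
  finally have "cmean (trunc_green D t b u) x s = - u x - 1/(2*pi) * cmean (trunc_ln t b) x s" .
  moreover have "x \<in> D" using x s by auto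
  ultimately show ?thesis by (simp add: trunc_green_def pole_density_translate algebra_simps)
qed

text \<open>Away from the truncation disc the zero extension lies below its means: outside D its
  value 0 is minimal, and inside D it has exact means over small circles.\<close>

lemma cmean_trunc_green_outside:
  assumes D: "bounded D" and gc: "green_corr D b u" and t: "0 < t" and s: "0 < s" "s < t"
    and cb: "cball b (3*t) \<subseteq> D" and x: "\<not> cball x s \<subseteq> D"
  shows "trunc_green D t b u x \<le> cmean (trunc_green D t b u) x s" "pole_density s t (x - b) = 0"
proof -
  let ?Q = "trunc_green D t b u"
  have op: "open D" using gc harm_on_open by (auto simp: green_corr_def)
  have cbt: "cball b t \<subseteq> D" using cb t by (auto simp: subset_iff)
  have cont: "continuous_on UNIV ?Q" by (rule trunc_green_continuous[OF gc t cbt])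
  \<comment> \<open>Otherwise the disc about x would lie in the disc of radius 3 * t about b, hence
    in D.\<close>
  have far: "2*t < dist x b"
  proof (rule ccontr)
    assume "\<not> 2*t < dist x b"
    then have "cball x s \<subseteq> cball b (3*t)" using s by (simp add: cball_subset_cball_iff)
    then show False using x cb by blast
  qed
  then show "pole_density s t (x - b) = 0"
    using s t by (intro pole_density_eq_0) (auto simp: dist_norm)
  have "submean_on (- cball b t) ?Q"
  proof (rule submean_onI)
    fix y assume y: "y \<in> - cball b t"
    show "\<exists>r0>0. \<forall>r. 0 < r \<longrightarrow> r < r0 \<longrightarrow> cball y r \<subseteq> - cball b t \<longrightarrow> ?Q y \<le> cmean ?Q y r"
    proof (cases "y \<in> D")
      case False
      then have "?Q y = 0" by (simp add: trunc_green_def)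
      then show ?thesis
        using trunc_green_nonneg[OF D gc t cbt]
        by (auto intro!: exI[of _ 1] cmean_ge_const continuous_on_subset[OF cont])
    next
      case True
      then obtain r0 where r0: "0 < r0" "cball y r0 \<subseteq> D" using op open_contains_cball by metis
      define r1 where "r1 = min r0 (dist y b - t)"
      have r1: "0 < r1" using r0 y by (simp add: r1_def dist_commute)
      have "?Q y \<le> cmean ?Q y r" if r: "0 < r" "r < r1" for r
      proof -
        have cbr: "cball y r \<subseteq> D" using r r0 by (auto simp: r1_def subset_iff)
        have "pole_density r t (y - b) = 0"
          using r t by (intro pole_density_eq_0) (auto simp: r1_def dist_norm)
        then show ?thesis using cmean_trunc_green_inside[OF gc t r(1) cbr] by simp
      qed
      then show ?thesis using r1 by blast
    qed
  qed (auto intro: continuous_on_subset[OF cont])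
  moreover have "cball x s \<subseteq> - cball b t"
  proof
    fix z assume "z \<in> cball x s"
    then show "z \<in> - cball b t" using far s dist_triangle[of x b z] by (simp add: dist_commute)
  qed
  ultimately show "?Q x \<le> cmean ?Q x s" by (rule submean_on_le_cmean[OF _ _ s(1)])
qed

text \<open>By the mean value operator, the pole of $Q$ at $b$ is paired against $P$, while the mass swept to
  the boundary only sees values of $P$ that are at most $\eta$.\<close>

lemma pole_pairing_estimate:
  assumes D: "bounded D" and gc: "green_corr D b u" and t: "0 < t" and s: "0 < s" "s < t"
    and cb: "cball b (3*t) \<subseteq> D"
    and P: "continuous_on UNIV P" "\<And>x. x \<notin> D \<Longrightarrow> P x = 0" "\<And>x. 0 \<le> P x"
    and near: "\<And>x. \<not> cball x s \<subseteq> D \<Longrightarrow> P x \<le> \<eta>"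
    and osc: "\<And>x. x \<in> cball b (2*t) \<Longrightarrow> \<bar>P x - P b\<bar> \<le> \<eta>"
  shows "\<bar>integral UNIV (\<lambda>x. P x * (cmean (trunc_green D t b u) x s - trunc_green D t b u x))
    + P b * (integral UNIV (pole_density s t) / (2*pi))\<bar> \<le> 2 * \<eta> * (integral UNIV (pole_density s t) / (2*pi))"
proof -
  define Q where "Q = trunc_green D t b u"
  define \<psi> where "\<psi> x = pole_density s t (x - b) / (2*pi)" for x
  define c where "c = integral UNIV (pole_density s t) / (2*pi)"
  \<comment> \<open>The density of the swept mass: zero where the disc of radius s stays in D,
    nonnegative elsewhere, and of total mass c because averaging preserves integrals.\<close>
  define E where "E x = cmean Q x s - Q x + \<psi> x" for x
  have cbt: "cball b t \<subseteq> D" using cb t by (auto simp: subset_iff)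
  have cQ: "continuous_on A Q" for A
    unfolding Q_def using trunc_green_continuous[OF gc t cbt] continuous_on_subset by blast
  have c\<psi>: "continuous_on A \<psi>" for A
    unfolding \<psi>_def by (intro continuous_intros continuous_on_compose2[OF continuous_on_pole_density[OF t, of UNIV]]) auto
  have \<psi>0: "0 \<le> \<psi> x" for x unfolding \<psi>_def using pole_density_nonneg[OF t s(1)] by simp
  have \<psi>1: "x \<in> cball b (2*t)" if "\<psi> x \<noteq> 0" for x
    using that pole_density_eq_0[OF t s(1), of "x - b"] s by (force simp: \<psi>_def dist_norm norm_minus_commute)
  obtain B where B: "D \<subseteq> cball 0 B" "0 < B" using D bounded_pos[of D] by (auto simp: subset_iff)
  define R where "R = B + norm b + 3*t + 1"
  have DR: "D \<subseteq> ball 0 R"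
  proof
    fix x assume "x \<in> D"
    then have "norm x \<le> B" using B by auto
    then have "norm x < R" unfolding R_def using t norm_ge_zero[of b] by linarith
    then show "x \<in> ball 0 R" by simp
  qed
  have QR: "Q x = 0" if "x \<notin> ball 0 R" for x using that DR by (auto simp: Q_def trunc_green_def)
  have PR: "P x = 0" if "x \<notin> ball 0 R" for x using that DR P(2) by blast
  have \<psi>R: "\<psi> x = 0" if "x \<notin> ball 0 R" for x
  proof (rule ccontr)
    assume "\<psi> x \<noteq> 0"
    then have "dist b x \<le> 2*t" using \<psi>1 by simp
    then have "norm x \<le> norm b + 2*t" using norm_triangle_sub[of x b] by (simp add: dist_norm norm_minus_commute)
    then show False using that t B by (simp add: R_def)
  qed
  have mQR: "cmean Q x s = 0" if "x \<notin> ball 0 (R + s)" for x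
    by (rule cmean_compact_support[where R = R and q = Q, OF QR _ that]) (use s in auto)
  have RR: "ball 0 R \<subseteq> ball (0::complex) (R + s)" using s by auto
  have ER: "E x = 0" if "x \<notin> ball 0 (R + s)" for x
    using that mQR QR \<psi>R RR unfolding E_def by (metis add.right_neutral diff_zero subsetD)
  have cm: "continuous_on A (\<lambda>x. cmean Q x s)" for A by (rule continuous_on_cmean[OF cQ])
  have cE: "continuous_on A E" for A unfolding E_def by (intro continuous_intros cm cQ c\<psi>)
  have int\<psi>: "\<psi> integrable_on UNIV" by (rule compact_support_integrable[OF c\<psi> \<psi>R])
  have intQ: "Q integrable_on UNIV" by (rule compact_support_integrable[OF cQ QR])
  have intm: "(\<lambda>x. cmean Q x s) integrable_on UNIV" by (rule compact_support_integrable[OF cm mQR])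
  have intE: "E integrable_on UNIV" by (rule compact_support_integrable[OF cE ER])
  have intPE: "(\<lambda>x. P x * E x) integrable_on UNIV"
    by (rule compact_support_integrable[of _ R]) (auto intro!: continuous_intros P(1) cE simp: PR)
  have intP\<psi>: "(\<lambda>x. P x * \<psi> x) integrable_on UNIV"
    by (rule compact_support_integrable[of _ R]) (auto intro!: continuous_intros P(1) c\<psi> simp: PR)
  have I\<psi>: "integral UNIV \<psi> = c"
  proof -
    have "integral UNIV (\<lambda>x. pole_density s t (x + (- b))) = integral UNIV (pole_density s t)"
      by (rule integral_UNIV_translate[OF pole_density_support[OF t s]])
    then show ?thesis by (simp add: \<psi>_def[abs_def] c_def)
  qed
  have IE: "integral UNIV E = c"
  proof -
    have "integral UNIV E = integral UNIV (\<lambda>x. cmean Q x s) - integral UNIV Q + integral UNIV \<psi>"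
      unfolding E_def by (simp add: Henstock_Kurzweil_Integration.integral_add Henstock_Kurzweil_Integration.integral_diff
          integrable_diff intm intQ int\<psi>)
    also have "integral UNIV (\<lambda>x. cmean Q x s) = integral UNIV Q"
      using integral_cmean[OF cQ QR] s by simp
    finally show ?thesis using I\<psi> by simp
  qed
  have E0: "E x = 0" if "cball x s \<subseteq> D" for x
    using cmean_trunc_green_inside[OF gc t s(1) that] by (simp add: E_def Q_def \<psi>_def)
  have E1: "0 \<le> E x" for x
  proof (cases "cball x s \<subseteq> D")
    case False
    then show ?thesis using cmean_trunc_green_outside[OF D gc t s cb False] by (simp add: E_def Q_def \<psi>_def)
  qed (use E0 in auto)
  have PE: "0 \<le> P x * E x" "P x * E x \<le> \<eta> * E x" for x
  proof -
    show "0 \<le> P x * E x" using P(3) E1 by simp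
    show "P x * E x \<le> \<eta> * E x"
      by (cases "cball x s \<subseteq> D") (use E0 near E1 in \<open>auto intro: mult_right_mono\<close>)
  qed
  have "integral UNIV (\<lambda>x. P x * E x) \<le> integral UNIV (\<lambda>x. \<eta> * E x)"
    by (rule integral_le[OF intPE]) (use PE(2) intE in \<open>auto intro: integrable_on_mult_right\<close>)
  then have A1: "integral UNIV (\<lambda>x. P x * E x) \<le> \<eta> * c" using IE by simp
  have A0: "0 \<le> integral UNIV (\<lambda>x. P x * E x)" by (rule integral_nonneg[OF intPE]) (use PE in auto)
  have P\<psi>: "(P b - \<eta>) * \<psi> x \<le> P x * \<psi> x" "P x * \<psi> x \<le> (P b + \<eta>) * \<psi> x" for x
  proof -
    have "(P b - \<eta>) * \<psi> x \<le> P x * \<psi> x \<and> P x * \<psi> x \<le> (P b + \<eta>) * \<psi> x"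
    proof (cases "\<psi> x = 0")
      case False
      from osc[OF \<psi>1[OF this]] show ?thesis using \<psi>0 by (auto intro!: mult_right_mono simp: abs_le_iff)
    qed auto
    then show "(P b - \<eta>) * \<psi> x \<le> P x * \<psi> x" "P x * \<psi> x \<le> (P b + \<eta>) * \<psi> x" by auto
  qed
  have "integral UNIV (\<lambda>x. (P b - \<eta>) * \<psi> x) \<le> integral UNIV (\<lambda>x. P x * \<psi> x)"
    by (rule integral_le[OF _ intP\<psi>]) (use P\<psi> int\<psi> in \<open>auto intro: integrable_on_mult_right\<close>)
  then have B1: "(P b - \<eta>) * c \<le> integral UNIV (\<lambda>x. P x * \<psi> x)" using I\<psi> by simp
  have "integral UNIV (\<lambda>x. P x * \<psi> x) \<le> integral UNIV (\<lambda>x. (P b + \<eta>) * \<psi> x)"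
    by (rule integral_le[OF intP\<psi>]) (use P\<psi> int\<psi> in \<open>auto intro: integrable_on_mult_right\<close>)
  then have B2: "integral UNIV (\<lambda>x. P x * \<psi> x) \<le> (P b + \<eta>) * c" using I\<psi> by simp
  have "(\<lambda>x. P x * (cmean Q x s - Q x)) = (\<lambda>x. P x * E x - P x * \<psi> x)"
    by (auto simp: E_def algebra_simps)
  then have "integral UNIV (\<lambda>x. P x * (cmean Q x s - Q x)) = integral UNIV (\<lambda>x. P x * E x) - integral UNIV (\<lambda>x. P x * \<psi> x)"
    by (simp add: Henstock_Kurzweil_Integration.integral_diff intPE intP\<psi>)
  moreover have "0 \<le> c" using I\<psi> integral_nonneg[OF int\<psi>] \<psi>0 by fastforce
  \<comment> \<open>The swept mass contributes between 0 and \<eta> * c, the oscillation of P near b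
    at most \<eta> * c; hence the factor 2.\<close>
  ultimately have "\<bar>integral UNIV (\<lambda>x. P x * (cmean Q x s - Q x)) + P b * c\<bar> \<le> 2 * \<eta> * c"
    using A0 A1 B1 B2 by (simp add: abs_le_iff algebra_simps)
  then show ?thesis unfolding Q_def c_def .
qed

text \<open>If the disc about x leaves D, then P has a zero within distance s of x, and uniform
  continuity on a large ball applies.\<close>

lemma small_near_complement:
  fixes P :: "complex \<Rightarrow> real"
  assumes P: "continuous_on UNIV P" "\<And>x. x \<notin> D \<Longrightarrow> P x = 0" and D: "bounded D" and \<eta>: "0 < \<eta>"
  obtains s0 where "0 < s0" "\<And>s x. s < s0 \<Longrightarrow> \<not> cball x s \<subseteq> D \<Longrightarrow> P x \<le> \<eta>"
proof -
  obtain B where B: "D \<subseteq> cball 0 B" "0 < B" using D bounded_pos[of D] by (auto simp: subset_iff)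
  have "uniformly_continuous_on (cball 0 (B+1)) P"
    by (rule compact_uniformly_continuous[OF continuous_on_subset[OF P(1)]]) auto
  then obtain d where d: "0 < d"
    "\<And>x y. x \<in> cball 0 (B+1) \<Longrightarrow> y \<in> cball 0 (B+1) \<Longrightarrow> dist y x < d \<Longrightarrow> dist (P y) (P x) < \<eta>"
    using \<eta> unfolding uniformly_continuous_on_def by metis
  show thesis
  proof (rule that[of "min d 1"])
    fix s x assume s: "s < min d 1" and n: "\<not> cball x s \<subseteq> D"
    show "P x \<le> \<eta>"
    proof (cases "x \<in> D")
      case True
      obtain y where y: "y \<in> cball x s" "y \<notin> D" using n by blast
      have x: "norm x \<le> B" using True B by auto
      have "norm y \<le> norm x + dist x y" using norm_triangle_sub[of y x] by (simp add: dist_norm norm_minus_commute)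
      then have "dist (P x) (P y) < \<eta>" using y s x by (intro d(2)) auto
      then show ?thesis using P(2)[OF y(2)] by (simp add: dist_real_def)
    qed (use P \<eta> in auto)
  qed (use d in auto)
qed

lemma green_corr_symmetric:
  assumes D: "bounded D" and ab: "a \<in> D" "b \<in> D" and ga: "green_corr D a ua" and gb: "green_corr D b ub"
  shows "ua b = ub a"
proof (cases "a = b")
  \<comment> \<open>For equal poles both regular parts have the same boundary data, so this case is
    uniqueness.\<close>
  case True
  have op: "open D" using ga harm_on_open by (auto simp: green_corr_def)
  have h: "harm_on D (\<lambda>x. ua x - ub x)" using ga gb by (auto simp: green_corr_def intro: harm_on_diff)
  have c: "continuous_on (closure D) (\<lambda>x. ua x - ub x)"
    using ga gb by (auto simp: green_corr_def intro: continuous_intros)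
  have fr: "ua x - ub x = 0" if "x \<in> frontier D" for x using ga gb that True by (auto simp: green_corr_def)
  have "ua b - ub b \<le> 0"
    by (rule submean_max_principle[OF harm_on_submean(1)[OF h] D c _ ab(2)]) (use fr in auto)
  moreover have "- (ua b - ub b) \<le> 0"
    by (rule submean_max_principle[OF harm_on_submean(2)[OF h] D continuous_on_minus[OF c] _ ab(2)]) (use fr in auto)
  ultimately show ?thesis using True by simp
next
  case False
  have op: "open D" using ga harm_on_open by (auto simp: green_corr_def)
  define p where "p x = - ua x - 1/(2*pi) * ln (norm (x - a))" for x
  define q where "q x = - ub x - 1/(2*pi) * ln (norm (x - b))" for x
  have "\<bar>ua b - ub a\<bar> \<le> 0"
  proof (rule field_le_epsilon)
    fix e :: real assume "0 < e"
    \<comment> \<open>Each of the two pairings has error 2 * \<eta> * c; together this is e *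
      c.\<close>
    define \<eta> where "\<eta> = e/4"
    have \<eta>: "0 < \<eta>" using \<open>0 < e\<close> by (simp add: \<eta>_def)
    have "continuous_on (D - {a}) p" unfolding p_def
      using ga harm_on_continuous by (auto simp: green_corr_def intro!: continuous_intros intro: continuous_on_subset)
    then have "isCont p b" using op ab False by (intro continuous_on_interior[of "D - {a}"]) (auto simp: interior_open open_Diff)
    then obtain d1 where d1: "0 < d1" "\<And>x. dist x b < d1 \<Longrightarrow> dist (p x) (p b) < \<eta>"
      using \<eta> unfolding continuous_at_eps_delta by (metis dist_real_def)
    have "continuous_on (D - {b}) q" unfolding q_def
      using gb harm_on_continuous by (auto simp: green_corr_def intro!: continuous_intros intro: continuous_on_subset)
    then have "isCont q a" using op ab False by (intro continuous_on_interior[of "D - {b}"]) (auto simp: interior_open open_Diff)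
    then obtain d2 where d2: "0 < d2" "\<And>x. dist x a < d2 \<Longrightarrow> dist (q x) (q a) < \<eta>"
      using \<eta> unfolding continuous_at_eps_delta by (metis dist_real_def)
    obtain r1 r2 where r: "0 < r1" "cball a r1 \<subseteq> D" "0 < r2" "cball b r2 \<subseteq> D"
      using op ab open_contains_cball by metis
    \<comment> \<open>The division by 3 keeps points within 2 * t of one pole at distance at least t
      from the other, so there P and Q agree with the untruncated p and q.\<close>
    define t where "t = min (min d1 d2) (min (min r1 r2) (dist a b)) / 3"
    have t: "0 < t" "2*t < d1" "2*t < d2" "3*t \<le> r1" "3*t \<le> r2" "3*t \<le> dist a b"
      using d1 d2 r False by (auto simp: t_def)
    have cba: "cball a (3*t) \<subseteq> D" using r t by (meson order_trans subset_cball)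
    have cbb: "cball b (3*t) \<subseteq> D" using r t by (meson order_trans subset_cball)
    have cba': "cball a t \<subseteq> D" using cba t by (auto simp: subset_iff)
    have cbb': "cball b t \<subseteq> D" using cbb t by (auto simp: subset_iff)
    define P where "P = trunc_green D t a ua"
    define Q where "Q = trunc_green D t b ub"
    have cP: "continuous_on UNIV P" unfolding P_def by (rule trunc_green_continuous[OF ga t(1) cba'])
    have cQ: "continuous_on UNIV Q" unfolding Q_def by (rule trunc_green_continuous[OF gb t(1) cbb'])
    have P0: "P x = 0" "Q x = 0" if "x \<notin> D" for x using that by (auto simp: P_def Q_def trunc_green_def)
    have Pn: "0 \<le> P x" "0 \<le> Q x" for x
      using trunc_green_nonneg[OF D ga t(1) cba'] trunc_green_nonneg[OF D gb t(1) cbb'] by (auto simp: P_def Q_def)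
    have Pp: "P x = p x" if "x \<in> cball b (2*t)" for x
    proof -
      have "x \<in> D" using that cbb t by (auto simp: subset_iff)
      moreover have "t \<le> dist x a" using that t(6) dist_triangle[of a b x] by (simp add: dist_commute)
      ultimately show ?thesis by (simp add: P_def trunc_green_def p_def trunc_ln_def dist_norm max_def)
    qed
    have Qq: "Q x = q x" if "x \<in> cball a (2*t)" for x
    proof -
      have "x \<in> D" using that cba t by (auto simp: subset_iff)
      moreover have "t \<le> dist x b" using that t(6) dist_triangle[of a b x] by (simp add: dist_commute)
      ultimately show ?thesis by (simp add: Q_def trunc_green_def q_def trunc_ln_def dist_norm max_def)
    qed
    obtain s1 where s1: "0 < s1" "\<And>s x. s < s1 \<Longrightarrow> \<not> cball x s \<subseteq> D \<Longrightarrow> P x \<le> \<eta>"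
      using small_near_complement[OF cP P0(1) D \<eta>] by blast
    obtain s2 where s2: "0 < s2" "\<And>s x. s < s2 \<Longrightarrow> \<not> cball x s \<subseteq> D \<Longrightarrow> Q x \<le> \<eta>"
      using small_near_complement[OF cQ P0(2) D \<eta>] by blast
    \<comment> \<open>Chosen after t: how small s must be depends on P and Q, which involve
      t.\<close>
    define s where "s = min t (min s1 s2) / 2"
    have s: "0 < s" "s < t" "s < s1" "s < s2" using t(1) s1(1) s2(1) by (auto simp: s_def)
    define c where "c = integral UNIV (pole_density s t) / (2*pi)"
    have c: "0 < c" using integral_pole_density_pos[OF t(1) s(1,2)] by (simp add: c_def)
    have bb: "b \<in> cball b (2*t)" "a \<in> cball a (2*t)" using t by auto
    have 1: "\<bar>integral UNIV (\<lambda>x. P x * (cmean Q x s - Q x)) + P b * c\<bar> \<le> 2 * \<eta> * c"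
      unfolding Q_def c_def
    proof (rule pole_pairing_estimate[OF D gb t(1) s(1,2) cbb cP P0(1) Pn(1) s1(2)[OF s(3)]])
      show "\<bar>P x - P b\<bar> \<le> \<eta>" if "x \<in> cball b (2*t)" for x
        using d1(2)[of x] that t Pp[OF that] Pp[OF bb(1)] by (simp add: dist_commute dist_real_def)
    qed auto
    have 2: "\<bar>integral UNIV (\<lambda>x. Q x * (cmean P x s - P x)) + Q a * c\<bar> \<le> 2 * \<eta> * c"
      unfolding P_def c_def
    proof (rule pole_pairing_estimate[OF D ga t(1) s(1,2) cba cQ P0(2) Pn(2) s2(2)[OF s(4)]])
      show "\<bar>Q x - Q a\<bar> \<le> \<eta>" if "x \<in> cball a (2*t)" for x
        using d2(2)[of x] that t Qq[OF that] Qq[OF bb(2)] by (simp add: dist_commute dist_real_def)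
    qed auto
    obtain R where R: "D \<subseteq> ball 0 R" using D bounded_subset_ballD by blast
    have PR: "P x = 0" "Q x = 0" if "x \<notin> ball 0 R" for x using P0 R that by blast+
    have "(\<lambda>x. P x * cmean Q x s) integrable_on UNIV" "(\<lambda>x. Q x * cmean P x s) integrable_on UNIV"
      "(\<lambda>x. P x * Q x) integrable_on UNIV"
      by (rule compact_support_integrable[of _ R]; auto intro!: continuous_intros cP cQ continuous_on_cmean simp: PR)+
    \<comment> \<open>The products of P and Q cancel, so by self-adjointness both pairings are the
      same number.\<close>
    then have "integral UNIV (\<lambda>x. P x * (cmean Q x s - Q x)) = integral UNIV (\<lambda>x. Q x * (cmean P x s - P x))"
      using integral_mult_cmean_symmetric[OF cP PR(1) cQ PR(2)] s
      by (simp add: right_diff_distrib Henstock_Kurzweil_Integration.integral_diff mult.commute)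
    then have "\<bar>P b * c - Q a * c\<bar> \<le> 4 * \<eta> * c" using 1 2 by linarith
    then have "\<bar>P b - Q a\<bar> * c \<le> e * c" using c by (simp add: \<eta>_def abs_mult left_diff_distrib[symmetric])
    then have "\<bar>P b - Q a\<bar> \<le> e" using c by simp
    moreover have "P b - Q a = ub a - ua b"
      using Pp[OF bb(1)] Qq[OF bb(2)] by (simp add: p_def q_def norm_minus_commute)
    ultimately show "\<bar>ua b - ub a\<bar> \<le> 0 + e" by (simp add: abs_minus_commute)
  qed
  then show ?thesis by simp
qed

subsection \<open>The exterior problem\<close>

lemma abs_ln_diff_le:
  fixes a b m :: real
  assumes "0 < m" "m \<le> a" "m \<le> b"
  shows "\<bar>ln a - ln b\<bar> \<le> \<bar>a - b\<bar> / m"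
proof -
  have *: "ln x - ln y \<le> \<bar>x - y\<bar> / m" if "m \<le> x" "m \<le> y" for x y
  proof -
    have "ln x - ln y = ln (x / y)" using that assms by (simp add: ln_div)
    also have "\<dots> \<le> x / y - 1" using that assms by (intro ln_le_minus_one) simp
    also have "\<dots> = (x - y) / y" using that assms by (simp add: field_simps)
    also have "\<dots> \<le> \<bar>x - y\<bar> / y" using that assms by (intro divide_right_mono) auto
    also have "\<dots> \<le> \<bar>x - y\<bar> / m" using that assms by (intro divide_left_mono) auto
    finally show ?thesis .
  qed
  show ?thesis using *[OF assms(2,3)] *[OF assms(3,2)] by (simp add: abs_minus_commute abs_le_iff)
qed

lemma dist_inverse_complex:
  fixes z w :: complex
  assumes "z \<noteq> 0" "w \<noteq> 0"
  shows "dist (inverse z) (inverse w) = dist z w / (norm z * norm w)"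
proof -
  have "inverse z - inverse w = (w - z) / (z * w)" using assms by (simp add: field_simps)
  then show ?thesis by (simp add: dist_norm norm_divide norm_mult norm_minus_commute)
qed

text \<open>The exterior problem in complex form. The centre 0 of the inversion is interior to F, so
  the inverted domain is bounded.\<close>

locale exterior_problem =
  fixes F :: "complex set" and h g :: "complex \<Rightarrow> complex \<Rightarrow> real"
  assumes compact_F: "compact F" and zero_F: "0 \<in> interior F"
    and harm_h: "\<And>\<eta>. \<eta> \<notin> F \<Longrightarrow> harm_on (- F) (\<lambda>\<xi>. h \<xi> \<eta>)"
    and cont_h: "\<And>\<eta>. \<eta> \<notin> F \<Longrightarrow> continuous_on (closure (- F)) (\<lambda>\<xi>. h \<xi> \<eta>)"
    and bdry_h: "\<And>\<xi> \<eta>. \<eta> \<notin> F \<Longrightarrow> \<xi> \<in> frontier (- F) \<Longrightarrow> h \<xi> \<eta> = - ln (dist \<xi> \<eta>) / (2*pi)"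
    and g_eq: "\<And>\<xi> \<eta>. \<xi> \<notin> F \<Longrightarrow> \<eta> \<notin> F \<Longrightarrow> \<xi> \<noteq> \<eta> \<Longrightarrow> g \<xi> \<eta> = - ln (dist \<xi> \<eta>) / (2*pi) - h \<xi> \<eta>"
    and g_bdd: "\<And>\<eta>. \<eta> \<notin> F \<Longrightarrow> \<exists>R M. \<forall>\<xi>. \<xi> \<notin> F \<longrightarrow> R \<le> norm \<xi> \<longrightarrow> \<bar>g \<xi> \<eta>\<bar> \<le> M"
begin

lemma open_compl_F: "open (- F)"
  using compact_F compact_imp_closed by blast

lemma zero_mem_F: "0 \<in> F"
  using zero_F interior_subset by blast

section \<open>Inversion of the exterior domain\<close>

text \<open>The inverted exterior domain, completed by the image 0 of infinity. The explicit
  disjunct matters, since \<open>inverse 0 = 0\<close> lies in F.\<close>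

definition D :: "complex set" where
  "D = {z. z = 0 \<or> inverse z \<notin> F}"

text \<open>Since |1/z - 1/w| = |z - w| / (|z| |w|), these logarithms turn the exterior regular part
  into the one for D with pole w.\<close>

definition k :: "complex \<Rightarrow> complex \<Rightarrow> real" where
  "k w z = h (inverse z) (inverse w) - (ln (norm z) + ln (norm w)) / (2*pi)"

lemma ball_subset_D: "\<exists>d>0. ball 0 d \<subseteq> D"
proof -
  obtain B where B: "0 < B" "\<And>x. x \<in> F \<Longrightarrow> norm x \<le> B"
    using compact_imp_bounded[OF compact_F] bounded_pos by metis
  have "ball 0 (inverse B) \<subseteq> D"
  proof
    fix z :: complex assume z: "z \<in> ball 0 (inverse B)"
    have "inverse z \<notin> F" if "z \<noteq> 0"
    proof
      assume "inverse z \<in> F"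
      then have "inverse (norm z) \<le> B" using B(2) by (metis norm_inverse)
      then have "inverse B \<le> norm z" using that by (metis inverse_inverse_eq le_imp_inverse_le positive_imp_inverse_positive zero_less_norm_iff)
      then show False using z by simp
    qed
    then show "z \<in> D" by (auto simp: D_def)
  qed
  then show ?thesis using B by (intro exI[of _ "inverse B"]) auto
qed

lemma bounded_D: "bounded D"
proof -
  obtain r where r: "0 < r" "cball 0 r \<subseteq> F" using zero_F unfolding mem_interior_cball by blast
  have "norm z \<le> inverse r" if "z \<in> D" for z
  proof (cases "z = 0")
    case False
    then have "inverse z \<notin> cball 0 r" using that r by (auto simp: D_def)
    then have "r < inverse (norm z)" by (simp add: norm_inverse)
    then show ?thesis using r by (metis inverse_inverse_eq le_imp_inverse_le less_imp_le)
  qed (use r in auto)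
  then show ?thesis unfolding bounded_iff by blast
qed

lemma open_D_minus_0: "open (D - {0})"
proof -
  have "D - {0} = (- {0}) \<inter> inverse -` (- F)" by (auto simp: D_def)
  moreover have "continuous_on (- {0::complex}) inverse" by (intro continuous_intros) auto
  ultimately show ?thesis using continuous_open_preimage[of "- {0}" inverse "- F"] open_compl_F by auto
qed

lemma open_D: "open D"
proof -
  obtain d where d: "0 < d" "ball 0 d \<subseteq> D" using ball_subset_D by blast
  have "D = (D - {0}) \<union> ball 0 d" using d by (auto simp: subset_iff)
  then show ?thesis using open_D_minus_0 by (metis open_Un open_ball)
qed

lemma inverse_closure_D:
  assumes "z \<in> closure D" "z \<noteq> 0"
  shows "inverse z \<in> closure (- F)"
proof (rule ccontr)
  assume "inverse z \<notin> closure (- F)"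
  then have i: "inverse z \<in> interior F" by (simp add: closure_complement)
  have "continuous_on (- {0::complex}) inverse" by (intro continuous_intros) auto
  then have op: "open ((- {0}) \<inter> inverse -` interior F)"
    using continuous_open_preimage[of "- {0}" inverse "interior F"] by auto
  moreover have "((- {0}) \<inter> inverse -` interior F) \<inter> D = {}"
    using interior_subset by (auto simp: D_def)
  moreover have "z \<in> (- {0}) \<inter> inverse -` interior F" using i assms by auto
  ultimately show False using assms(1) open_Int_closure_eq_empty[OF op, of D] by blast
qed

lemma frontier_D:
  assumes "z \<in> frontier D"
  shows "z \<noteq> 0" "inverse z \<in> frontier (- F)"
proof -
  have z: "z \<in> closure D" "z \<notin> D" using assms open_D by (auto simp: frontier_def interior_open)
  then show z0: "z \<noteq> 0" by (auto simp: D_def)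
  have "inverse z \<in> F" using z by (auto simp: D_def)
  then show "inverse z \<in> frontier (- F)"
    using inverse_closure_D[OF z(1) z0] open_compl_F by (auto simp: frontier_def interior_open)
qed

lemma k_eq_fund_minus_g:
  assumes "z \<in> D - {0}" "w \<in> D - {0}" "z \<noteq> w"
  shows "k w z = - ln (dist z w) / (2*pi) - g (inverse z) (inverse w)"
proof -
  have "inverse z \<notin> F" "inverse w \<notin> F" "inverse z \<noteq> inverse w" using assms by (auto simp: D_def)
  then have "g (inverse z) (inverse w) = - ln (dist (inverse z) (inverse w)) / (2*pi) - h (inverse z) (inverse w)"
    by (rule g_eq)
  moreover have "ln (dist (inverse z) (inverse w)) = ln (dist z w) - (ln (norm z) + ln (norm w))"
    using assms by (simp add: dist_inverse_complex ln_div ln_mult)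
  ultimately show ?thesis by (simp add: k_def field_simps)
qed

lemma harm_k:
  assumes "w \<in> D - {0}"
  shows "harm_on (D - {0}) (k w)"
proof -
  have wF: "inverse w \<notin> F" using assms by (auto simp: D_def)
  have 1: "harm_on (D - {0}) (\<lambda>z. h (inverse z) (inverse w))"
    by (rule harm_on_compose_holomorphic[OF harm_h[OF wF] _ open_D_minus_0])
       (auto intro!: holomorphic_intros simp: D_def)
  have 2: "harm_on (D - {0}) (\<lambda>z. 1/(2*pi) * ln (norm (z - 0)))"
    by (rule harm_on_subset[OF harm_on_cmult[OF harm_on_ln_norm] open_D_minus_0]) auto
  have "harm_on (D - {0}) (\<lambda>z. (h (inverse z) (inverse w) - 1/(2*pi) * ln (norm (z - 0))) - ln (norm w) / (2*pi))"
    by (intro harm_on_diff 1 2 harm_on_const open_D_minus_0)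
  then show ?thesis by (rule harm_on_cong) (simp add: k_def add_divide_distrib)
qed

lemma continuous_on_k:
  assumes "w \<in> D - {0}"
  shows "continuous_on (closure D - {0}) (k w)"
proof -
  have wF: "inverse w \<notin> F" using assms by (auto simp: D_def)
  have "continuous_on (closure D - {0}) (\<lambda>z. h (inverse z) (inverse w))"
    by (rule continuous_on_compose2[OF cont_h[OF wF]])
       (use inverse_closure_D in \<open>auto intro!: continuous_intros\<close>)
  then show ?thesis unfolding k_def by (intro continuous_intros) auto
qed

text \<open>\<open>k w\<close> is a logarithm with pole at w minus g, and g is bounded at infinity.
  So \<open>k w\<close> is bounded near 0, the singularity is removable, and the extension is the
  regular part for D.\<close>

lemma ex_green_corr:
  assumes w: "w \<in> D - {0}"
  shows "\<exists>c. green_corr D w ((k w)(0 := c))"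
proof -
  have wF: "inverse w \<notin> F" using w by (auto simp: D_def)
  obtain R M where RM: "\<And>\<xi>. \<xi> \<notin> F \<Longrightarrow> R \<le> norm \<xi> \<Longrightarrow> \<bar>g \<xi> (inverse w)\<bar> \<le> M" using g_bdd[OF wF] by blast
  obtain d where d: "0 < d" "ball 0 d \<subseteq> D" using ball_subset_D by blast
  \<comment> \<open>In this disc z stays away from w, and its inverse lies in the range where g is
    bounded.\<close>
  define r where "r = min (min d (norm w / 2)) (1 / (\<bar>R\<bar> + 1))"
  have r: "0 < r" "r \<le> d" "r \<le> norm w / 2" "r \<le> 1 / (\<bar>R\<bar> + 1)" using d w by (auto simp: r_def)
  have brD: "ball 0 r \<subseteq> D" using d r by (auto simp: subset_iff)
  define L where "L = \<bar>ln (norm w / 2)\<bar> + \<bar>ln (2 * norm w)\<bar>"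
  have bdd: "\<bar>k w z\<bar> \<le> L / (2*pi) + M" if z: "z \<in> ball 0 r - {0}" for z
  proof -
    have nz: "norm z < norm w / 2" "z \<noteq> 0" using z r by auto
    have zD: "z \<in> D - {0}" using z brD by auto
    have "\<bar>R\<bar> + 1 \<le> 1 / r" using r by (simp add: field_simps)
    also have "\<dots> \<le> inverse (norm z)" unfolding inverse_eq_divide using z r by (intro divide_left_mono) auto
    finally have "R \<le> norm (inverse z)" by (simp add: norm_inverse)
    then have g: "\<bar>g (inverse z) (inverse w)\<bar> \<le> M" using zD by (intro RM) (auto simp: D_def)
    have "norm w / 2 \<le> dist z w" "dist z w \<le> 2 * norm w"
      using nz norm_triangle_ineq2[of w z] norm_triangle_ineq4[of z w] by (auto simp: dist_norm norm_minus_commute)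
    then have "ln (norm w / 2) \<le> ln (dist z w)" "ln (dist z w) \<le> ln (2 * norm w)"
      using w nz by (auto intro!: ln_mono)
    then have "\<bar>ln (dist z w)\<bar> \<le> L" unfolding L_def by linarith
    then have "\<bar>- ln (dist z w) / (2*pi)\<bar> \<le> L / (2*pi)" by (simp add: abs_divide divide_right_mono)
    moreover have "k w z = - ln (dist z w) / (2*pi) - g (inverse z) (inverse w)"
      using zD w nz by (intro k_eq_fund_minus_g) auto
    ultimately show ?thesis using g by linarith
  qed
  have "harm_on (ball 0 r - {0}) (k w)"
    by (rule harm_on_subset[OF harm_k[OF w]]) (use brD in auto)
  then obtain c where c: "harm_on (ball 0 r) ((k w)(0 := c))"
    by (rule harm_on_removable_singularity[where u = "k w", OF _ bdd r(1)])
  define u where "u = (k w)(0 := c)"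
  have "harm_on (D - {0}) u" by (rule harm_on_cong[OF harm_k[OF w]]) (auto simp: u_def)
  then have "harm_on ((D - {0}) \<union> ball 0 r) u" using c harm_on_Un unfolding u_def by blast
  moreover have "(D - {0}) \<union> ball 0 r = D" using brD r by auto
  ultimately have hD: "harm_on D u" by simp
  have "continuous_on (cball 0 (r/2) \<union> (closure D - ball 0 (r/2))) u"
  proof (rule continuous_on_closed_Un)
    show "continuous_on (cball 0 (r/2)) u"
      by (rule continuous_on_subset[OF harm_on_continuous[OF hD]]) (use brD r in \<open>auto simp: subset_iff\<close>)
    have "continuous_on (closure D - ball 0 (r/2)) (k w)"
      by (rule continuous_on_subset[OF continuous_on_k[OF w]]) (use r in auto)
    then show "continuous_on (closure D - ball 0 (r/2)) u"
      by (rule continuous_on_eq) (use r in \<open>auto simp: u_def\<close>)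
  qed (auto intro: closed_Diff)
  then have cont: "continuous_on (closure D) u" by (rule continuous_on_subset) (auto simp: not_less)
  have "u x = - ln (dist x w) / (2*pi)" if "x \<in> frontier D" for x
  proof -
    have x: "x \<noteq> 0" "inverse x \<in> frontier (- F)" using frontier_D[OF that] by auto
    have "x \<noteq> w" using that w open_D by (auto simp: frontier_def interior_open)
    then have "ln (dist (inverse x) (inverse w)) = ln (dist x w) - (ln (norm x) + ln (norm w))"
      using x w by (simp add: dist_inverse_complex ln_div ln_mult)
    then show ?thesis using bdry_h[OF wF x(2)] x(1)
      by (simp add: u_def k_def add_divide_distrib diff_divide_distrib)
  qed
  then have "green_corr D w u" using hD cont by (simp add: green_corr_def)
  then show ?thesis unfolding u_def by blast
qed

text \<open>The regular part at the image of infinity. For w in D - {0} a suitable constant exists,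
  and continuity at 0 determines it.\<close>

definition \<kappa> :: "complex \<Rightarrow> real" where
  "\<kappa> w = (SOME c. green_corr D w ((k w)(0 := c)))"

text \<open>The limit to be expected: as z = 1/\<xi> tends to 0, the logarithmic part with pole w =
  1/\<eta> tends to \<open>- ln (norm w) / (2*pi)\<close>, and \<open>k w z\<close> tends to
  \<open>\<kappa> w\<close>.\<close>

definition \<zeta> :: "complex \<Rightarrow> real" where
  "\<zeta> \<eta> = ln (norm \<eta>) / (2*pi) - \<kappa> (inverse \<eta>)"

lemma green_corr_k: "w \<in> D - {0} \<Longrightarrow> green_corr D w ((k w)(0 := \<kappa> w))"
  unfolding \<kappa>_def by (rule someI_ex[OF ex_green_corr])

lemma inverse_mem_D: "\<eta> \<notin> F \<Longrightarrow> inverse \<eta> \<in> D - {0}"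
  using zero_mem_F by (auto simp: D_def)

text \<open>The logarithms in \<open>k\<close> are symmetric in z and w, so the symmetry on the
  bounded domain D carries over.\<close>

lemma h_symmetric:
  assumes "\<xi> \<notin> F" "\<eta> \<notin> F"
  shows "h \<xi> \<eta> = h \<eta> \<xi>"
proof -
  have z: "inverse \<xi> \<in> D - {0}" and w: "inverse \<eta> \<in> D - {0}" using inverse_mem_D assms by auto
  have "((k (inverse \<eta>))(0 := \<kappa> (inverse \<eta>))) (inverse \<xi>) = ((k (inverse \<xi>))(0 := \<kappa> (inverse \<xi>))) (inverse \<eta>)"
    by (rule green_corr_symmetric[OF bounded_D _ _ green_corr_k[OF w] green_corr_k[OF z]]) (use z w in auto)
  then have "k (inverse \<eta>) (inverse \<xi>) = k (inverse \<xi>) (inverse \<eta>)" using z w by auto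
  then show ?thesis by (simp add: k_def add.commute)
qed

text \<open>In the variable 1/\<xi> the estimated quantity is the difference of the extended
  \<open>k\<close> at 1/\<xi> and at 0, to which the Lipschitz bound, uniform in the pole,
  applies.\<close>

lemma h_expansion:
  obtains C R where "0 < C" "0 < R" "\<And>\<xi>. R \<le> norm \<xi> \<Longrightarrow> \<xi> \<notin> F"
    "\<And>\<xi> \<eta>. R \<le> norm \<xi> \<Longrightarrow> \<eta> \<notin> F \<Longrightarrow> \<bar>h \<xi> \<eta> + \<zeta> \<eta> + ln (norm \<xi>) / (2*pi)\<bar> \<le> C / norm \<xi>"
proof -
  obtain d where d: "0 < d" "ball 0 d \<subseteq> D" using ball_subset_D by blast
  obtain C where C: "0 < C" "\<And>y u x. y \<in> D \<Longrightarrow> green_corr D y u \<Longrightarrow> norm x < d/2 \<Longrightarrow> \<bar>u x - u 0\<bar> \<le> C * norm x"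
    using green_corr_Lipschitz_at_0[OF bounded_D d] by blast
  \<comment> \<open>Gives |1/\<xi>| \<le> d/4, strictly inside the disc of radius d/2 on which the
    Lipschitz bound holds.\<close>
  define R where "R = 4 / d"
  have R: "0 < R" using d by (simp add: R_def)
  have small: "norm (inverse \<xi>) < d/2" "\<xi> \<noteq> 0" "\<xi> \<notin> F" if "R \<le> norm \<xi>" for \<xi> :: complex
  proof -
    show x0: "\<xi> \<noteq> 0" using that R by auto
    have "4 \<le> d * norm \<xi>" using that d by (simp add: R_def field_simps)
    then show s: "norm (inverse \<xi>) < d/2" unfolding norm_inverse using x0 by (simp add: field_simps)
    then have "inverse \<xi> \<in> D" using d by (auto simp: subset_iff)
    then show "\<xi> \<notin> F" using x0 by (auto simp: D_def)
  qed
  have "\<bar>h \<xi> \<eta> + \<zeta> \<eta> + ln (norm \<xi>) / (2*pi)\<bar> \<le> C / norm \<xi>" if x: "R \<le> norm \<xi>" and e: "\<eta> \<notin> F" for \<xi> \<eta>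
  proof -
    have w: "inverse \<eta> \<in> D - {0}" using inverse_mem_D e by auto
    then have e0: "\<eta> \<noteq> 0" by auto
    have "\<bar>((k (inverse \<eta>))(0 := \<kappa> (inverse \<eta>))) (inverse \<xi>) - ((k (inverse \<eta>))(0 := \<kappa> (inverse \<eta>))) 0\<bar> \<le> C * norm (inverse \<xi>)"
      by (rule C(2)[OF _ green_corr_k[OF w] small(1)[OF x]]) (use w in auto)
    then have "\<bar>k (inverse \<eta>) (inverse \<xi>) - \<kappa> (inverse \<eta>)\<bar> \<le> C / norm \<xi>"
      using small(2)[OF x] by (simp add: norm_inverse divide_inverse)
    moreover have "k (inverse \<eta>) (inverse \<xi>) - \<kappa> (inverse \<eta>) = h \<xi> \<eta> + \<zeta> \<eta> + ln (norm \<xi>) / (2*pi)"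
      using small(2)[OF x] e0 by (simp add: k_def \<zeta>_def norm_inverse ln_inverse add_divide_distrib diff_divide_distrib)
    ultimately show ?thesis by simp
  qed
  then show thesis using that C R small by blast
qed

lemma g_tendsto_\<zeta>:
  assumes e: "\<eta> \<notin> F"
  shows "((\<lambda>\<xi>. g \<xi> \<eta>) \<longlongrightarrow> \<zeta> \<eta>) at_infinity"
proof -
  define w where "w = inverse \<eta>"
  have w: "w \<in> D - {0}" using inverse_mem_D e by (simp add: w_def)
  define u where "u = (k w)(0 := \<kappa> w)"
  have "harm_on D u" using green_corr_k[OF w] by (auto simp: green_corr_def u_def)
  then have "isCont u 0"
    using harm_on_continuous open_D by (intro continuous_on_interior[of D]) (auto simp: interior_open D_def)
  then have u: "((\<lambda>\<xi>. u (inverse \<xi>)) \<longlongrightarrow> u 0) at_infinity"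
    by (rule isCont_tendsto_compose[OF _ tendsto_inverse_0])
  have "((\<lambda>\<xi>. - ln (dist (inverse \<xi>) w) / (2*pi)) \<longlongrightarrow> - ln (dist 0 w) / (2*pi)) at_infinity"
    using w by (intro tendsto_intros tendsto_inverse_0) auto
  from tendsto_diff[OF this u]
  have lim: "((\<lambda>\<xi>. - ln (dist (inverse \<xi>) w) / (2*pi) - u (inverse \<xi>)) \<longlongrightarrow> \<zeta> \<eta>) at_infinity"
    using w by (simp add: u_def \<zeta>_def w_def norm_inverse ln_inverse)
  obtain B where B: "\<And>x. x \<in> F \<Longrightarrow> norm x \<le> B"
    using compact_imp_bounded[OF compact_F] bounded_iff by metis
  have "\<forall>\<^sub>F \<xi> in at_infinity. - ln (dist (inverse \<xi>) w) / (2*pi) - u (inverse \<xi>) = g \<xi> \<eta>"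
    unfolding eventually_at_infinity
  proof (intro exI[of _ "\<bar>B\<bar> + norm \<eta> + 1"] allI impI)
    fix \<xi> :: complex assume x: "\<bar>B\<bar> + norm \<eta> + 1 \<le> norm \<xi>"
    have "\<xi> \<notin> F"
    proof
      assume "\<xi> \<in> F"
      then show False using B[of \<xi>] x norm_ge_zero[of \<eta>] by linarith
    qed
    moreover have "norm \<eta> < norm \<xi>" using x by linarith
    then have "\<xi> \<noteq> \<eta>" "\<xi> \<noteq> 0" by auto
    ultimately show "- ln (dist (inverse \<xi>) w) / (2*pi) - u (inverse \<xi>) = g \<xi> \<eta>"
      using k_eq_fund_minus_g[OF inverse_mem_D[of \<xi>] w] by (auto simp: u_def w_def)
  qed
  then show ?thesis using lim by (rule Lim_transform_eventually[rotated])
qed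

text \<open>Subtracting \<open>h_expansion\<close> for the two orders of the arguments, h cancels by
  symmetry, and \<zeta> minus the logarithm is nearly constant far out. A Cauchy sequence along the
  positive reals supplies the limit together with the rate.\<close>

lemma \<zeta>_expansion:
  obtains C R Zinf where "0 < C" "0 < R" "\<And>\<xi>. R \<le> norm \<xi> \<Longrightarrow> \<xi> \<notin> F"
    "\<And>\<eta>. R \<le> norm \<eta> \<Longrightarrow> \<bar>\<zeta> \<eta> - ln (norm \<eta>) / (2*pi) - Zinf\<bar> \<le> C / norm \<eta>"
    "((\<lambda>\<eta>. \<zeta> \<eta> - ln (norm \<eta>) / (2*pi)) \<longlongrightarrow> Zinf) at_infinity"
proof -
  obtain C R where CR: "0 < C" "0 < R" "\<And>\<xi>. R \<le> norm \<xi> \<Longrightarrow> \<xi> \<notin> F"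
    "\<And>\<xi> \<eta>. R \<le> norm \<xi> \<Longrightarrow> \<eta> \<notin> F \<Longrightarrow> \<bar>h \<xi> \<eta> + \<zeta> \<eta> + ln (norm \<xi>) / (2*pi)\<bar> \<le> C / norm \<xi>"
    using h_expansion by blast
  define f where "f \<eta> = \<zeta> \<eta> - ln (norm \<eta>) / (2*pi)" for \<eta>
  have diff: "\<bar>f \<eta> - f \<xi>\<bar> \<le> C / norm \<xi> + C / norm \<eta>" if "R \<le> norm \<xi>" "R \<le> norm \<eta>" for \<xi> \<eta>
  proof -
    have n: "\<xi> \<notin> F" "\<eta> \<notin> F" using CR(3) that by auto
    show ?thesis
      using CR(4)[OF that(1) n(2)] CR(4)[OF that(2) n(1)] h_symmetric[OF n] unfolding f_def by linarith
  qed
  define x where "x n = complex_of_real (R + real n)" for n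
  have nx: "norm (x n) = R + real n" for n
    unfolding x_def norm_of_real using CR(2) by simp
  have lim0: "(\<lambda>n. C / norm (x n)) \<longlonglongrightarrow> 0"
    unfolding nx by real_asymp
  have "Cauchy (\<lambda>n. f (x n))"
    unfolding Cauchy_def
  proof (intro allI impI)
    fix e :: real assume e: "0 < e"
    obtain N where N: "\<And>n. N \<le> n \<Longrightarrow> C / norm (x n) < e/2"
      using order_tendstoD(2)[OF lim0, of "e/2"] e unfolding eventually_sequentially by auto
    show "\<exists>M. \<forall>m\<ge>M. \<forall>n\<ge>M. dist (f (x m)) (f (x n)) < e"
    proof (intro exI[of _ N] allI impI)
      fix m n assume "N \<le> m" "N \<le> n"
      then show "dist (f (x m)) (f (x n)) < e"
        using diff[of "x n" "x m"] N[of m] N[of n] unfolding dist_real_def nx by linarith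
    qed
  qed
  then obtain L where L: "(\<lambda>n. f (x n)) \<longlonglongrightarrow> L" using Cauchy_convergent_iff convergent_def by blast
  have est: "\<bar>f \<eta> - L\<bar> \<le> C / norm \<eta>" if "R \<le> norm \<eta>" for \<eta>
  proof (rule tendsto_le[OF sequentially_bot])
    show "(\<lambda>n. \<bar>f \<eta> - f (x n)\<bar>) \<longlonglongrightarrow> \<bar>f \<eta> - L\<bar>" by (intro tendsto_intros L)
    show "(\<lambda>n. C / norm (x n) + C / norm \<eta>) \<longlonglongrightarrow> C / norm \<eta>"
      using tendsto_add[OF lim0 tendsto_const] by simp
    show "\<forall>\<^sub>F n in sequentially. \<bar>f \<eta> - f (x n)\<bar> \<le> C / norm (x n) + C / norm \<eta>"
      using diff[OF _ that] CR(2) nx by (intro always_eventually allI) (metis le_add_same_cancel1 of_nat_0_le_iff)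
  qed
  have "((\<lambda>\<eta>. \<zeta> \<eta> - ln (norm \<eta>) / (2*pi)) \<longlongrightarrow> L) at_infinity"
    unfolding Lim_at_infinity
  proof (intro allI impI)
    fix e :: real assume e: "0 < e"
    show "\<exists>b. \<forall>x. b \<le> norm x \<longrightarrow> dist (\<zeta> x - ln (norm x) / (2*pi)) L < e"
    proof (intro exI[of _ "R + C/e"] allI impI)
      fix x :: complex assume x: "R + C/e \<le> norm x"
      have "0 < C/e" using CR e by simp
      then have "R \<le> norm x" "C/e < norm x" using x CR(1,2) by linarith+
      moreover from this have "C / norm x < e" using e CR(1,2) by (simp add: divide_less_eq mult.commute)
      ultimately show "dist (\<zeta> x - ln (norm x) / (2*pi)) L < e"
        using est[of x] by (simp add: dist_real_def f_def)
    qed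
  qed
  then show thesis using that[OF CR(1,2,3)] est unfolding f_def by blast
qed

text \<open>\<zeta> with its boundary value 0 put on F, where the choice in \<open>\<kappa>\<close>
  gives no information. This version is continuous up to the boundary.\<close>

definition Z :: "complex \<Rightarrow> real" where
  "Z \<eta> = (if \<eta> \<in> F then 0 else \<zeta> \<eta>)"

text \<open>One distant \<xi> serves all \<eta> at once: off F by symmetry and
  \<open>h_expansion\<close>, on the frontier because ln |\<eta> - \<xi>| and ln |\<xi>| nearly
  agree. So Z inherits continuity and harmonicity from h(.,\<xi>).\<close>

lemma Z_approx:
  assumes e: "0 < e"
  obtains \<xi> where "\<xi> \<notin> F"
    "\<And>\<eta>. \<eta> \<in> closure (- F) \<Longrightarrow> \<bar>Z \<eta> - (- h \<eta> \<xi> - ln (norm \<xi>) / (2*pi))\<bar> \<le> e"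
proof -
  obtain C R where CR: "0 < C" "0 < R" "\<And>\<xi>. R \<le> norm \<xi> \<Longrightarrow> \<xi> \<notin> F"
    "\<And>\<xi> \<eta>. R \<le> norm \<xi> \<Longrightarrow> \<eta> \<notin> F \<Longrightarrow> \<bar>h \<xi> \<eta> + \<zeta> \<eta> + ln (norm \<xi>) / (2*pi)\<bar> \<le> C / norm \<xi>"
    using h_expansion by blast
  obtain B where B: "0 < B" "\<And>x. x \<in> F \<Longrightarrow> norm x \<le> B"
    using compact_imp_bounded[OF compact_F] bounded_pos by metis
  \<comment> \<open>The summands provide, in this order, the range of the expansion, its error, the
    bound |\<eta> - \<xi>| \<ge> \<rho>/2 on F, and the error of the logarithms.\<close>
  define \<rho> where "\<rho> = R + C / e + 2*B + 2*B/e"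
  have \<rho>: "R \<le> \<rho>" "C / e \<le> \<rho>" "2*B \<le> \<rho>" "2*B/e \<le> \<rho>" "0 < \<rho>" using CR B e by (auto simp: \<rho>_def add_pos_pos)
  define \<xi> where "\<xi> = complex_of_real \<rho>"
  have n\<xi>: "norm \<xi> = \<rho>" using \<rho> by (simp add: \<xi>_def)
  have x: "\<xi> \<notin> F" using CR(3) n\<xi> \<rho> by simp
  have "\<bar>Z \<eta> - (- h \<eta> \<xi> - ln (norm \<xi>) / (2*pi))\<bar> \<le> e" if \<eta>: "\<eta> \<in> closure (- F)" for \<eta>
  proof (cases "\<eta> \<in> F")
    case False
    have "\<bar>h \<xi> \<eta> + \<zeta> \<eta> + ln (norm \<xi>) / (2*pi)\<bar> \<le> C / norm \<xi>" using CR(4)[of \<xi> \<eta>] n\<xi> \<rho> False by simp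
    also have "\<dots> \<le> e" using \<rho> e CR n\<xi> by (simp add: field_simps)
    finally show ?thesis using h_symmetric[OF x False] False by (simp add: Z_def algebra_simps)
  next
    case True
    then have fr: "\<eta> \<in> frontier (- F)" using \<eta> open_compl_F by (simp add: frontier_def interior_open)
    have "norm \<eta> \<le> B" using B True by simp
    then have d: "\<bar>dist \<eta> \<xi> - norm \<xi>\<bar> \<le> B"
      using norm_triangle_ineq4[of \<eta> \<xi>] norm_triangle_ineq2[of \<xi> \<eta>] by (simp add: dist_norm norm_minus_commute abs_le_iff)
    have "\<bar>ln (dist \<eta> \<xi>) - ln (norm \<xi>)\<bar> \<le> \<bar>dist \<eta> \<xi> - norm \<xi>\<bar> / (\<rho>/2)"
      using d \<rho> n\<xi> by (intro abs_ln_diff_le) (auto simp: abs_le_iff)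
    also have "\<dots> \<le> B / (\<rho>/2)" using d \<rho> by (intro divide_right_mono) auto
    also have "\<dots> \<le> e" using \<rho> e B by (simp add: field_simps)
    finally have l: "\<bar>ln (dist \<eta> \<xi>) - ln (norm \<xi>)\<bar> \<le> e" .
    have "Z \<eta> - (- h \<eta> \<xi> - ln (norm \<xi>) / (2*pi)) = - (ln (dist \<eta> \<xi>) - ln (norm \<xi>)) / (2*pi)"
      using bdry_h[OF x fr] True by (simp add: Z_def diff_divide_distrib)
    then have "\<bar>Z \<eta> - (- h \<eta> \<xi> - ln (norm \<xi>) / (2*pi))\<bar> = \<bar>ln (dist \<eta> \<xi>) - ln (norm \<xi>)\<bar> / (2*pi)"
      by (simp add: abs_divide)
    also have "\<dots> \<le> e / 1" using l pi_gt3 e by (intro frac_le) auto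
    finally show ?thesis by simp
  qed
  then show thesis using that x by blast
qed

lemma Z_continuous: "continuous_on (closure (- F)) Z"
proof (rule continuous_on_uniform_approx)
  fix e :: real assume "0 < e"
  then obtain \<xi> where x: "\<xi> \<notin> F"
    "\<And>\<eta>. \<eta> \<in> closure (- F) \<Longrightarrow> \<bar>Z \<eta> - (- h \<eta> \<xi> - ln (norm \<xi>) / (2*pi))\<bar> \<le> e"
    using Z_approx by blast
  moreover have "continuous_on (closure (- F)) (\<lambda>\<eta>. - h \<eta> \<xi> - ln (norm \<xi>) / (2*pi))"
    by (intro continuous_on_diff continuous_on_minus continuous_on_const cont_h x)
  ultimately show "\<exists>v. continuous_on (closure (- F)) v \<and> (\<forall>x\<in>closure (- F). \<bar>Z x - v x\<bar> \<le> e)" by blast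
qed

lemma Z_harm: "harm_on (- F) Z"
proof (rule harm_on_uniform_approx[OF open_compl_F])
  fix e :: real assume "0 < e"
  then obtain \<xi> where x: "\<xi> \<notin> F"
    "\<And>\<eta>. \<eta> \<in> closure (- F) \<Longrightarrow> \<bar>Z \<eta> - (- h \<eta> \<xi> - ln (norm \<xi>) / (2*pi))\<bar> \<le> e"
    using Z_approx by blast
  moreover have "harm_on (- F) (\<lambda>\<eta>. - h \<eta> \<xi> - ln (norm \<xi>) / (2*pi))"
    by (intro harm_on_diff harm_on_minus harm_on_const harm_h x open_compl_F)
  ultimately show "\<exists>v. harm_on (- F) v \<and> (\<forall>x\<in>- F. \<bar>Z x - v x\<bar> \<le> e)" using closure_subset by blast
qed

end

subsection \<open>The uniform expansion\<close>

text \<open>Within radius R compactness bounds Z; beyond it the expansion gives ln |y| - ln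
  \<epsilon> up to bounded terms. Growth of this order is tolerable because the denominator of the
  formula grows like |ln \<epsilon>| as well.\<close>

lemma (in exterior_problem) \<zeta>_log_bound:
  assumes Zinf: "\<And>\<eta>. R \<le> norm \<eta> \<Longrightarrow> \<bar>\<zeta> \<eta> - ln (norm \<eta>) / (2*pi) - Zinf\<bar> \<le> C / norm \<eta>" and R: "0 < R" and C: "0 < C"
    and B: "0 < B"
  obtains K where "0 \<le> K"
    "\<And>\<epsilon> y. 0 < \<epsilon> \<Longrightarrow> \<epsilon> < 1 \<Longrightarrow> norm y \<le> B \<Longrightarrow> y /\<^sub>R \<epsilon> \<notin> F \<Longrightarrow> \<bar>\<zeta> (y /\<^sub>R \<epsilon>)\<bar> \<le> - ln \<epsilon> / (2*pi) + K"
proof -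
  have "compact (Z ` (closure (- F) \<inter> cball 0 R))"
    by (intro compact_continuous_image continuous_on_subset[OF Z_continuous]) (auto intro: closed_Int_compact)
  then obtain M where M: "0 < M" "\<And>\<eta>. \<eta> \<in> closure (- F) \<inter> cball 0 R \<Longrightarrow> \<bar>Z \<eta>\<bar> \<le> M"
    using compact_imp_bounded bounded_pos by (metis imageI real_norm_def)
  define K where "K = M + \<bar>ln R\<bar> + \<bar>ln B\<bar> + \<bar>Zinf\<bar> + C / R"
  have K0: "0 \<le> K" using M R C by (simp add: K_def)
  have "\<bar>\<zeta> (y /\<^sub>R \<epsilon>)\<bar> \<le> - ln \<epsilon> / (2*pi) + K"
    if e: "0 < \<epsilon>" "\<epsilon> < 1" and y: "norm y \<le> B" "y /\<^sub>R \<epsilon> \<notin> F" for \<epsilon> y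
  proof (cases "norm (y /\<^sub>R \<epsilon>) \<le> R")
    case True
    have "\<bar>Z (y /\<^sub>R \<epsilon>)\<bar> \<le> M" using True y closure_subset[of "- F"] by (intro M(2)) auto
    then have "\<bar>\<zeta> (y /\<^sub>R \<epsilon>)\<bar> \<le> M" using y by (simp add: Z_def)
    moreover have "0 \<le> - ln \<epsilon> / (2*pi)" using e by (intro divide_nonneg_pos) auto
    moreover have "M \<le> K" using R C by (simp add: K_def)
    ultimately show ?thesis by linarith
  next
    case False
    let ?\<eta> = "y /\<^sub>R \<epsilon>"
    have ge: "R \<le> norm ?\<eta>" using False by simp
    have n: "norm ?\<eta> = norm y / \<epsilon>" using e by (simp add: divide_inverse mult.commute)
    have y0: "0 < norm y" using ge n R e by (metis divide_eq_0_iff less_le_not_le norm_eq_zero zero_less_norm_iff)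
    have l: "ln (norm ?\<eta>) = ln (norm y) - ln \<epsilon>" unfolding n using y0 e by (simp add: ln_div)
    have "ln R \<le> ln (norm ?\<eta>)" using ge R by (intro ln_mono) auto
    moreover have "ln (norm y) \<le> ln B" using y y0 by (intro ln_mono) auto
    moreover have "ln \<epsilon> \<le> 0" using e by simp
    ultimately have "\<bar>ln (norm ?\<eta>)\<bar> \<le> - ln \<epsilon> + (\<bar>ln R\<bar> + \<bar>ln B\<bar>)" using l by linarith
    then have "\<bar>ln (norm ?\<eta>)\<bar> / (2*pi) \<le> (- ln \<epsilon> + (\<bar>ln R\<bar> + \<bar>ln B\<bar>)) / (2*pi)"
      by (intro divide_right_mono) auto
    also have "\<dots> = - ln \<epsilon> / (2*pi) + (\<bar>ln R\<bar> + \<bar>ln B\<bar>) / (2*pi)" by (rule add_divide_distrib)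
    also have "(\<bar>ln R\<bar> + \<bar>ln B\<bar>) / (2*pi) \<le> (\<bar>ln R\<bar> + \<bar>ln B\<bar>) / 1" using pi_gt3 by (intro divide_left_mono) auto
    finally have a: "\<bar>ln (norm ?\<eta>) / (2*pi)\<bar> \<le> - ln \<epsilon> / (2*pi) + (\<bar>ln R\<bar> + \<bar>ln B\<bar>)" by (simp add: abs_divide)
    have "C / norm ?\<eta> \<le> C / R" using ge R C by (intro divide_left_mono mult_pos_pos) auto
    then have "\<bar>\<zeta> ?\<eta> - ln (norm ?\<eta>) / (2*pi) - Zinf\<bar> \<le> C / R" using Zinf[OF ge] by linarith
    then show ?thesis using a M(1) unfolding K_def by linarith
  qed
  then show thesis using that K0 by blast
qed

text \<open>Only regular parts occur: the logarithmic poles have cancelled, so x = y is allowed and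
  the remainder is harmonic across the pole.\<close>

lemma (in exterior_problem) perforated_green_expansion:
  assumes \<Omega>: "open \<Omega>" "bounded \<Omega>" "ball 0 1 \<subseteq> \<Omega>" and F1: "F \<subseteq> cball 0 1"
    and H: "\<And>y. y \<in> \<Omega> \<Longrightarrow> green_corr \<Omega> y (\<lambda>x. H x y)" and \<epsilon>1: "0 < \<epsilon>1"
    and He: "\<And>\<epsilon> y. 0 < \<epsilon> \<Longrightarrow> \<epsilon> < \<epsilon>1 \<Longrightarrow> y \<in> \<Omega> - {x. x /\<^sub>R \<epsilon> \<in> F} \<Longrightarrow>
        green_corr (\<Omega> - {x. x /\<^sub>R \<epsilon> \<in> F}) y (\<lambda>x. He \<epsilon> x y)"
    and Zinf: "((\<lambda>\<eta>. \<zeta> \<eta> - ln (norm \<eta>) / (2*pi)) \<longlongrightarrow> Zinf) at_infinity"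
  shows "\<exists>C \<epsilon>0. 0 < \<epsilon>0 \<and> (\<forall>\<epsilon>. 0 < \<epsilon> \<and> \<epsilon> < \<epsilon>0 \<longrightarrow>
    (\<forall>x\<in>\<Omega> - {x. x /\<^sub>R \<epsilon> \<in> F}. \<forall>y\<in>\<Omega> - {x. x /\<^sub>R \<epsilon> \<in> F}.
      \<bar>- He \<epsilon> x y + H x y + h (x /\<^sub>R \<epsilon>) (y /\<^sub>R \<epsilon>)
        - ((ln \<epsilon> / (2*pi) + \<zeta> (x /\<^sub>R \<epsilon>) - Zinf + H x 0) * (ln \<epsilon> / (2*pi) + \<zeta> (y /\<^sub>R \<epsilon>) - Zinf + H 0 y))
          / (ln \<epsilon> / (2*pi) + H 0 0 - Zinf)
        + \<zeta> (x /\<^sub>R \<epsilon>) + \<zeta> (y /\<^sub>R \<epsilon>) - Zinf\<bar> \<le> C * \<epsilon>))"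
proof -
  obtain C1 R1 where h1: "0 < C1" "0 < R1" "\<And>\<xi>. R1 \<le> norm \<xi> \<Longrightarrow> \<xi> \<notin> F"
    "\<And>\<xi> \<eta>. R1 \<le> norm \<xi> \<Longrightarrow> \<eta> \<notin> F \<Longrightarrow> \<bar>h \<xi> \<eta> + \<zeta> \<eta> + ln (norm \<xi>) / (2*pi)\<bar> \<le> C1 / norm \<xi>"
    using h_expansion by blast
  obtain C2 R2 Zi where z2: "0 < C2" "0 < R2" "\<And>\<xi>. R2 \<le> norm \<xi> \<Longrightarrow> \<xi> \<notin> F"
    "\<And>\<eta>. R2 \<le> norm \<eta> \<Longrightarrow> \<bar>\<zeta> \<eta> - ln (norm \<eta>) / (2*pi) - Zi\<bar> \<le> C2 / norm \<eta>"
    "((\<lambda>\<eta>. \<zeta> \<eta> - ln (norm \<eta>) / (2*pi)) \<longlongrightarrow> Zi) at_infinity"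
    using \<zeta>_expansion by blast
  have Zi: "Zi = Zinf" using z2(5) Zinf tendsto_unique trivial_limit_at_infinity by blast
  note z3 = z2(4)[unfolded Zi]
  obtain CL where CL: "0 < CL" "\<And>y u x. y \<in> \<Omega> \<Longrightarrow> green_corr \<Omega> y u \<Longrightarrow> norm x < 1/2 \<Longrightarrow> \<bar>u x - u 0\<bar> \<le> CL * norm x"
    using green_corr_Lipschitz_at_0[OF \<Omega>(2) _ \<Omega>(3)] by (metis zero_less_one)
  obtain CM where CM: "0 < CM" "\<And>y u x. y \<in> \<Omega> \<Longrightarrow> green_corr \<Omega> y u \<Longrightarrow> norm x \<le> 1/2 \<Longrightarrow> \<bar>u x\<bar> \<le> CM"
    using green_corr_bounded_near_0[OF \<Omega>(2) _ \<Omega>(3)] by (metis zero_less_one)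
  obtain B where B: "0 < B" "\<And>x. x \<in> \<Omega> \<Longrightarrow> norm x \<le> B" using \<Omega>(2) bounded_pos by metis
  obtain K where K: "0 \<le> K"
    "\<And>\<epsilon> y. 0 < \<epsilon> \<Longrightarrow> \<epsilon> < 1 \<Longrightarrow> norm y \<le> B \<Longrightarrow> y /\<^sub>R \<epsilon> \<notin> F \<Longrightarrow> \<bar>\<zeta> (y /\<^sub>R \<epsilon>)\<bar> \<le> - ln \<epsilon> / (2*pi) + K"
    using \<zeta>_log_bound[OF z3 z2(2) z2(1) B(1)] by blast
  \<comment> \<open>Makes L = - ln \<epsilon> / (2*pi) dominate all bounded terms, which gives |Dn|
    \<ge> L/2 and |Bn| \<le> 3 * L.\<close>
  define T where "T = 2 * K + 4 * \<bar>Zinf\<bar> + 4 * CM + 1"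
  \<comment> \<open>1/2 puts the hole into the disc of the Lipschitz bound, 1/R1 and 1/R2 put the
    scaled outer boundary into the range of the expansions, and the exponential ensures T \<le>
    L.\<close>
  define \<epsilon>0 where "\<epsilon>0 = min (min \<epsilon>1 (1/2)) (min (min (1/R1) (1/R2)) (exp (- (2*pi*T))))"
  have \<epsilon>0: "0 < \<epsilon>0" using \<epsilon>1 h1 z2 by (simp add: \<epsilon>0_def)
  \<comment> \<open>C1 + 7 * C2 is the error on the outer boundary and 7 * CL the one on the hole; 7
    = 1 + 6, where 6 bounds |q|.\<close>
  define C where "C = C1 + 7 * C2 + 7 * CL"
  have zero\<Omega>: "0 \<in> \<Omega>" using \<Omega>(3) by auto
  show ?thesis
  proof (rule exI[of _ C], rule exI[of _ \<epsilon>0], intro conjI \<epsilon>0 allI impI ballI)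
    fix \<epsilon> x y assume e: "0 < \<epsilon> \<and> \<epsilon> < \<epsilon>0" and x: "x \<in> \<Omega> - {x. x /\<^sub>R \<epsilon> \<in> F}" and y: "y \<in> \<Omega> - {x. x /\<^sub>R \<epsilon> \<in> F}"
    define U where "U = \<Omega> - {x. x /\<^sub>R \<epsilon> \<in> F}"
    have e1: "0 < \<epsilon>" "\<epsilon> < \<epsilon>1" "\<epsilon> < 1/2" "\<epsilon> < 1/R1" "\<epsilon> < 1/R2" "\<epsilon> < exp (- (2*pi*T))" using e by (auto simp: \<epsilon>0_def)
    have "ln \<epsilon> < - (2*pi*T)" using e1(1,6) by (metis exp_gt_zero ln_exp ln_less_cancel_iff)
    then have LT: "T \<le> - ln \<epsilon> / (2*pi)" by (simp add: field_simps)
    define L where "L = - ln \<epsilon> / (2*pi)"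
    have lnL: "ln \<epsilon> / (2*pi) = - L" by (simp add: L_def)
    define Y where "Y = \<zeta> (y /\<^sub>R \<epsilon>)"
    define Dn where "Dn = ln \<epsilon> / (2*pi) + H 0 0 - Zinf"
    define Bn where "Bn = ln \<epsilon> / (2*pi) + Y - Zinf + H 0 y"
    have yF: "y /\<^sub>R \<epsilon> \<notin> F" and y\<Omega>: "y \<in> \<Omega>" and yU: "y \<in> U" using y by (auto simp: U_def)
    have Yb: "\<bar>Y\<bar> \<le> L + K" unfolding Y_def L_def using K(2)[OF e1(1) _ B(2)[OF y\<Omega>] yF] e1 by simp
    have H00: "\<bar>H 0 0\<bar> \<le> CM" using CM(2)[OF zero\<Omega> H[OF zero\<Omega>], of 0] by simp
    have H0y: "\<bar>H 0 y\<bar> \<le> CM" using CM(2)[OF y\<Omega> H[OF y\<Omega>], of 0] by simp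
    have LT': "2 * K + 4 * \<bar>Zinf\<bar> + 4 * CM + 1 \<le> L" using LT by (simp add: T_def L_def)
    define m where "m = \<bar>Zinf\<bar>"
    have m: "Zinf \<le> m" "- Zinf \<le> m" "0 \<le> m" by (auto simp: m_def)
    note abs_D = abs_le_D1[OF H00] abs_le_D1[OF H0y] abs_le_D2[OF H0y] abs_le_D1[OF Yb] abs_le_D2[OF Yb]
    note LT' = LT'[folded m_def]
    have "Dn \<le> - (L / 2)" unfolding Dn_def lnL using LT' abs_D(1) K(1) CM(1) m by linarith
    then have Dn: "L / 2 \<le> \<bar>Dn\<bar>" by linarith
    have "Bn \<le> 3 * L" "- Bn \<le> 3 * L" unfolding Bn_def lnL using LT' abs_D K(1) CM(1) m by linarith+
    then have Bn: "\<bar>Bn\<bar> \<le> 3 * L" by linarith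
    have Lpos: "0 < L" using LT' K(1) CM(1) m by linarith
    have Dn0: "Dn \<noteq> 0" using Dn Lpos by auto
    \<comment> \<open>For fixed y the quotient term is q times the factor in x. The logarithmic
      growth cancels in q.\<close>
    define q where "q = Bn / Dn"
    have "\<bar>Bn\<bar> \<le> 6 * \<bar>Dn\<bar>" using Bn Dn by linarith
    then have q6: "\<bar>q\<bar> \<le> 6" using Dn0 by (simp add: q_def abs_divide divide_le_eq)
    \<comment> \<open>Z instead of \<zeta> makes the remainder continuous up to the boundary of the
      hole.\<close>
    define r where "r v = - He \<epsilon> v y + H v y + h (v /\<^sub>R \<epsilon>) (y /\<^sub>R \<epsilon>)
        - q * (ln \<epsilon> / (2*pi) + Z (v /\<^sub>R \<epsilon>) - Zinf + H v 0) + Z (v /\<^sub>R \<epsilon>) + Y - Zinf" for v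
    have gcU: "green_corr U y (\<lambda>x. He \<epsilon> x y)" using He[OF e1(1,2)] y by (simp add: U_def)
    have gcy: "green_corr \<Omega> y (\<lambda>x. H x y)" and gc0: "green_corr \<Omega> 0 (\<lambda>x. H x 0)" using H y\<Omega> zero\<Omega> by auto
    have opU: "open U" using gcU harm_on_open by (auto simp: green_corr_def)
    have U\<Omega>: "U \<subseteq> \<Omega>" by (auto simp: U_def)
    have scale_holo: "(\<lambda>v::complex. v /\<^sub>R \<epsilon>) holomorphic_on U"
      unfolding scaleR_conv_of_real by (intro holomorphic_intros)
    have scaleF: "(\<lambda>v. v /\<^sub>R \<epsilon>) ` U \<subseteq> - F" by (auto simp: U_def)
    have hr: "harm_on U r"
      unfolding r_def
    proof (intro harm_on_add harm_on_diff harm_on_minus harm_on_cmult harm_on_const opU)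
      show "harm_on U (\<lambda>v. He \<epsilon> v y)" using gcU by (simp add: green_corr_def)
      show "harm_on U (\<lambda>v. H v y)" "harm_on U (\<lambda>v. H v 0)"
        using gcy gc0 by (auto simp: green_corr_def intro: harm_on_subset[OF _ opU U\<Omega>])
      show "harm_on U (\<lambda>v. h (v /\<^sub>R \<epsilon>) (y /\<^sub>R \<epsilon>))"
        by (rule harm_on_compose_holomorphic[OF harm_h[OF yF] scale_holo opU scaleF])
      show "harm_on U (\<lambda>v. Z (v /\<^sub>R \<epsilon>))"
        by (rule harm_on_compose_holomorphic[OF Z_harm scale_holo opU scaleF])
      then show "harm_on U (\<lambda>v. Z (v /\<^sub>R \<epsilon>))" .
    qed
    have cls: "v /\<^sub>R \<epsilon> \<in> closure (- F)" if "v \<in> closure U" for v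
    proof -
      have "(\<lambda>v. v /\<^sub>R \<epsilon>) ` closure U \<subseteq> closure (- F)"
        by (rule image_closure_subset) (auto intro!: continuous_intros order_trans[OF scaleF closure_subset])
      then show ?thesis using that by blast
    qed
    have cl\<Omega>: "closure U \<subseteq> closure \<Omega>" using U\<Omega> by (rule closure_mono)
    have cr: "continuous_on (closure U) r"
      unfolding r_def
    proof (intro continuous_on_add continuous_on_diff continuous_on_minus continuous_on_mult continuous_on_const)
      show "continuous_on (closure U) (\<lambda>v. He \<epsilon> v y)" using gcU by (simp add: green_corr_def)
      show "continuous_on (closure U) (\<lambda>v. H v y)" "continuous_on (closure U) (\<lambda>v. H v 0)"
        using gcy gc0 by (auto simp: green_corr_def intro: continuous_on_subset[OF _ cl\<Omega>])
      show "continuous_on (closure U) (\<lambda>v. h (v /\<^sub>R \<epsilon>) (y /\<^sub>R \<epsilon>))"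
        by (rule continuous_on_compose2[OF cont_h[OF yF]]) (use cls in \<open>auto intro!: continuous_intros\<close>)
      show "continuous_on (closure U) (\<lambda>v. Z (v /\<^sub>R \<epsilon>))"
        by (rule continuous_on_compose2[OF Z_continuous]) (use cls in \<open>auto intro!: continuous_intros\<close>)
      then show "continuous_on (closure U) (\<lambda>v. Z (v /\<^sub>R \<epsilon>))" .
    qed
    have bdry: "\<bar>r v\<bar> \<le> C * \<epsilon>" if v: "v \<in> frontier U" for v
    proof -
      have vc: "v \<in> closure U" "v \<notin> U" using v opU by (auto simp: frontier_def interior_open)
      have vy: "v \<noteq> y" using vc yU by auto
      have HeV: "He \<epsilon> v y = - ln (dist v y) / (2*pi)" using gcU v by (simp add: green_corr_def)
      have n: "norm (v /\<^sub>R \<epsilon>) = norm v / \<epsilon>" using e1(1) by (simp add: divide_inverse mult.commute)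
      show ?thesis
      proof (cases "v \<in> \<Omega>")
        \<comment> \<open>The outer boundary: both H terms are explicit logarithms, and the
          expansions at v/\<epsilon> leave only the small quantities \<open>a1\<close> and
          \<open>a2\<close>.\<close>
        case False
        then have fr: "v \<in> frontier \<Omega>" using vc cl\<Omega> \<Omega>(1) by (auto simp: frontier_def interior_open)
        have Hv: "H v y = - ln (dist v y) / (2*pi)" "H v 0 = - ln (norm v) / (2*pi)"
          using gcy gc0 fr by (simp_all add: green_corr_def)
        have v1: "1 \<le> norm v" using False \<Omega>(3) by (metis in_mono mem_ball_0 not_le)
        have big: "1 / \<epsilon> \<le> norm (v /\<^sub>R \<epsilon>)" unfolding n using v1 e1 by (intro divide_right_mono) auto
        have inv: "c / norm (v /\<^sub>R \<epsilon>) \<le> c * \<epsilon>" if "0 < c" for c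
        proof -
          have "c / norm (v /\<^sub>R \<epsilon>) \<le> c / (1 / \<epsilon>)"
            using big that e1 by (intro divide_left_mono mult_pos_pos) (auto intro: less_le_trans[of _ "1/\<epsilon>"])
          then show ?thesis by simp
        qed
        have "R1 < 1/\<epsilon>" "R2 < 1/\<epsilon>" using e1(1,4,5) h1(2) z2(2) by (simp_all add: less_divide_eq mult.commute)
        then have R: "R1 \<le> norm (v /\<^sub>R \<epsilon>)" "R2 \<le> norm (v /\<^sub>R \<epsilon>)" using big by linarith+
        have vF: "v /\<^sub>R \<epsilon> \<notin> F" by (rule h1(3)[OF R(1)])
        define a1 where "a1 = h (v /\<^sub>R \<epsilon>) (y /\<^sub>R \<epsilon>) + Y + ln (norm (v /\<^sub>R \<epsilon>)) / (2*pi)"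
        define a2 where "a2 = \<zeta> (v /\<^sub>R \<epsilon>) - ln (norm (v /\<^sub>R \<epsilon>)) / (2*pi) - Zinf"
        have a1: "\<bar>a1\<bar> \<le> C1 * \<epsilon>" unfolding a1_def Y_def
          using h1(4)[OF R(1) yF] inv[OF h1(1)] by linarith
        have a2: "\<bar>a2\<bar> \<le> C2 * \<epsilon>" unfolding a2_def using z3[OF R(2)] inv[OF z2(1)] by linarith
        have "ln (norm (v /\<^sub>R \<epsilon>)) = ln (norm v) - ln \<epsilon>"
          unfolding n using v1 e1 by (subst ln_div) auto
        then have lnv: "ln (norm (v /\<^sub>R \<epsilon>)) / (2*pi) = ln (norm v) / (2*pi) - ln \<epsilon> / (2*pi)"
          by (simp add: diff_divide_distrib)
        have "ln \<epsilon> / (2*pi) + \<zeta> (v /\<^sub>R \<epsilon>) - Zinf + H v 0 = a2"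
          unfolding a2_def lnv Hv(2) by simp
        then have "r v = a1 + a2 - q * a2"
          using vF unfolding r_def HeV Hv(1) a1_def Z_def by (simp add: a2_def)
        moreover have "\<bar>q * a2\<bar> \<le> 6 * (C2 * \<epsilon>)"
          unfolding abs_mult using q6 a2 by (intro mult_mono) auto
        moreover have "C * \<epsilon> = C1 * \<epsilon> + 7 * (C2 * \<epsilon>) + 7 * (CL * \<epsilon>)" by (simp add: C_def algebra_simps)
        moreover have "0 < CL * \<epsilon>" using CL e1(1) by simp
        ultimately show ?thesis using a1 a2 by linarith
      next
        \<comment> \<open>The boundary of the hole: Z vanishes, h is an explicit logarithm, and |v|
          \<le> \<epsilon> turns the Lipschitz bound at 0 into an error of order \<epsilon>.\<close>
        case True
        then have vF: "v /\<^sub>R \<epsilon> \<in> F" using vc by (auto simp: U_def)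
        then have fr: "v /\<^sub>R \<epsilon> \<in> frontier (- F)"
          using cls[OF vc(1)] open_compl_F by (simp add: frontier_def interior_open)
        have "norm v / \<epsilon> \<le> 1" using vF F1 n by (metis in_mono mem_cball_0)
        then have nv: "norm v \<le> \<epsilon>" using e1(1) by (simp add: divide_le_eq)
        have "dist (v /\<^sub>R \<epsilon>) (y /\<^sub>R \<epsilon>) = dist v y / \<epsilon>"
          using e1(1) by (simp add: dist_norm divide_inverse mult.commute flip: scaleR_diff_right)
        then have hv: "h (v /\<^sub>R \<epsilon>) (y /\<^sub>R \<epsilon>) = - ln (dist v y) / (2*pi) + ln \<epsilon> / (2*pi)"
          using bdry_h[OF yF fr] vy e1(1) by (simp add: ln_div diff_divide_distrib)
        have l: "\<bar>H v y - H 0 y\<bar> \<le> CL * \<epsilon>" "\<bar>H v 0 - H 0 0\<bar> \<le> CL * \<epsilon>"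
        proof -
          have "CL * norm v \<le> CL * \<epsilon>" using nv CL by simp
          moreover have "norm v < 1/2" using nv e1 by linarith
          ultimately show "\<bar>H v y - H 0 y\<bar> \<le> CL * \<epsilon>" "\<bar>H v 0 - H 0 0\<bar> \<le> CL * \<epsilon>"
            using CL(2)[OF y\<Omega> gcy, of v] CL(2)[OF zero\<Omega> gc0, of v] by linarith+
        qed
        \<comment> \<open>The factor in x is Dn up to the Lipschitz error, so multiplication by q
          reproduces Bn, which cancels the remaining main terms.\<close>
        have q1: "q * (Dn + (H v 0 - H 0 0)) = Bn + q * (H v 0 - H 0 0)"
          using Dn0 by (simp add: q_def distrib_left)
        have q2: "ln \<epsilon> / (2*pi) + Z (v /\<^sub>R \<epsilon>) - Zinf + H v 0 = Dn + (H v 0 - H 0 0)"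
          using vF by (simp add: Z_def Dn_def)
        have q3: "Z (v /\<^sub>R \<epsilon>) = 0" using vF by (simp add: Z_def)
        have "r v = (H v y - H 0 y) - q * (H v 0 - H 0 0)"
          unfolding r_def HeV hv q2 q1 unfolding q3 Bn_def by linarith
        moreover have "\<bar>q * (H v 0 - H 0 0)\<bar> \<le> 6 * (CL * \<epsilon>)"
          unfolding abs_mult using q6 l by (intro mult_mono) auto
        moreover have "C * \<epsilon> = C1 * \<epsilon> + 7 * (C2 * \<epsilon>) + 7 * (CL * \<epsilon>)" by (simp add: C_def algebra_simps)
        moreover have "0 < C1 * \<epsilon>" "0 < C2 * \<epsilon>" using h1 z2 e1(1) by simp_all
        ultimately show ?thesis using l by linarith
      qed
    qed
    have bU: "bounded U" using \<Omega>(2) U\<Omega> bounded_subset by blast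
    have xU: "x \<in> U" using x by (simp add: U_def)
    have "r x \<le> C * \<epsilon>"
      by (rule submean_max_principle[OF harm_on_submean(1)[OF hr] bU cr _ xU]) (use bdry in \<open>auto simp: abs_le_iff\<close>)
    moreover have "- r x \<le> C * \<epsilon>"
      by (rule submean_max_principle[OF harm_on_submean(2)[OF hr] bU continuous_on_minus[OF cr] _ xU])
         (use bdry in \<open>auto simp: abs_le_iff\<close>)
    ultimately have "\<bar>r x\<bar> \<le> C * \<epsilon>" by (simp add: abs_le_iff)
    moreover have "Z (x /\<^sub>R \<epsilon>) = \<zeta> (x /\<^sub>R \<epsilon>)" using x by (simp add: Z_def)
    ultimately show "\<bar>- He \<epsilon> x y + H x y + h (x /\<^sub>R \<epsilon>) (y /\<^sub>R \<epsilon>)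
        - ((ln \<epsilon> / (2*pi) + \<zeta> (x /\<^sub>R \<epsilon>) - Zinf + H x 0) * (ln \<epsilon> / (2*pi) + \<zeta> (y /\<^sub>R \<epsilon>) - Zinf + H 0 y))
          / (ln \<epsilon> / (2*pi) + H 0 0 - Zinf)
        + \<zeta> (x /\<^sub>R \<epsilon>) + \<zeta> (y /\<^sub>R \<epsilon>) - Zinf\<bar> \<le> C * \<epsilon>"
      unfolding r_def q_def Bn_def Dn_def Y_def by (simp add: mult.commute)
  qed
qed

subsection \<open>Transfer to the coordinate plane\<close>

lemma closure_vimage_to_pt: "closure (to_pt -` S) = to_pt -` closure S"
proof -
  have "(\<exists>y. to_pt y \<in> S \<and> dist y z < e) \<longleftrightarrow> (\<exists>y\<in>S. dist y (to_pt z) < e)" for z e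
    using bij_to_pt by (metis bij_pointE dist_to_pt)
  then show ?thesis unfolding closure_approachable set_eq_iff vimage_eq mem_Collect_eq Bex_def by simp
qed

lemma frontier_vimage_to_pt: "frontier (to_pt -` S) = to_pt -` frontier S"
  unfolding frontier_closures vimage_Compl[symmetric] closure_vimage_to_pt by auto

lemma interior_vimage_to_pt: "interior (to_pt -` S) = to_pt -` interior S"
  unfolding interior_closure vimage_Compl[symmetric] closure_vimage_to_pt by auto

lemma bounded_vimage_to_pt: "bounded S \<Longrightarrow> bounded (to_pt -` S)"
  unfolding bounded_iff by (metis norm_to_pt vimageE)

lemma open_vimage_to_pt: "open S \<Longrightarrow> open (to_pt -` S)"
  using open_vimage continuous_on_to_pt by blast

lemma tendsto_at_infinity_to_pt:
  assumes "((\<lambda>z. f (to_pt z)) \<longlongrightarrow> (l::real)) at_infinity"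
  shows "(f \<longlongrightarrow> l) at_infinity"
  unfolding Lim_at_infinity
proof (intro allI impI)
  fix e :: real assume "0 < e"
  then obtain b where "\<And>z. b \<le> norm z \<Longrightarrow> dist (f (to_pt z)) l < e"
    using assms unfolding Lim_at_infinity by blast
  then show "\<exists>b. \<forall>x. b \<le> norm x \<longrightarrow> dist (f x) l < e"
    using bij_to_pt by (metis bij_pointE norm_to_pt)
qed

lemma fund_to_pt: "fund (to_pt x) (to_pt y) = - ln (dist x y) / (2*pi)"
  by (cases "x = y") (simp_all add: fund_def ln_div)

lemma green_regular_part_imp_green_corr:
  assumes "green_regular_part U H" "to_pt y \<in> U"
  shows "green_corr (to_pt -` U) y (\<lambda>x. H (to_pt x) (to_pt y))"
proof -
  have har: "harmonic_on U (\<lambda>x. H x (to_pt y))" and cont: "continuous_on (closure U) (\<lambda>x. H x (to_pt y))"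
    and bd: "\<And>x. x \<in> frontier U \<Longrightarrow> H x (to_pt y) = fund x (to_pt y)"
    using assms by (auto simp: green_regular_part_def)
  have "harm_on (to_pt -` U) (\<lambda>x. H (to_pt x) (to_pt y))"
    by (rule harmonic_on_imp_harm_on[OF har continuous_on_subset[OF cont closure_subset]])
  moreover have "continuous_on (closure (to_pt -` U)) (\<lambda>x. H (to_pt x) (to_pt y))"
    unfolding closure_vimage_to_pt
    by (rule continuous_on_compose2[OF cont continuous_on_to_pt]) auto
  ultimately show ?thesis
    using bd by (simp add: green_corr_def frontier_vimage_to_pt fund_to_pt)
qed

text \<open>A segment from 0 to a point outside S meets the frontier no farther out than its
  endpoint.\<close>

lemma ball_subset_if_infdist_frontier:
  fixes S :: "'a::euclidean_space set"
  assumes "0 \<in> S" "infdist 0 (frontier S) = d"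
  shows "ball 0 d \<subseteq> S"
proof (rule ccontr)
  assume "\<not> ball 0 d \<subseteq> S"
  then obtain x where x: "x \<in> ball 0 d" "x \<notin> S" by blast
  have "closed_segment 0 x \<inter> frontier S \<noteq> {}"
    using assms x by (intro connected_Int_frontier) auto
  then obtain z where z: "z \<in> closed_segment 0 x" "z \<in> frontier S" by blast
  have "d \<le> norm z" using infdist_le[OF z(2), of 0] assms by simp
  moreover have "norm z \<le> norm x" using segment_bound1[OF z(1)] by simp
  ultimately show False using x by simp
qed

text \<open>A point of F of maximal norm lies on the frontier, since an interior point could be
  pushed outwards.\<close>

lemma compact_subset_cball_if_frontier:
  fixes F :: "'a::euclidean_space set"
  assumes F: "compact F" and r: "(SUP \<xi>\<in>frontier (- F). norm \<xi>) = r"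
  shows "F \<subseteq> cball 0 r"
proof
  fix x assume x: "x \<in> F"
  obtain m where m: "m \<in> F" "\<And>y. y \<in> F \<Longrightarrow> norm y \<le> norm m"
    using continuous_attains_sup[OF F, of norm] x by (auto intro: continuous_on_norm_id)
  have fr: "frontier (- F) \<subseteq> F"
    using F by (auto simp: frontier_complement intro: compact_imp_closed frontier_subset_closed[THEN subsetD])
  have "m \<in> frontier F"
  proof (rule ccontr)
    assume "m \<notin> frontier F"
    then have "m \<in> interior F" using m F by (simp add: frontier_def compact_imp_closed)
    then obtain e where e: "0 < e" "cball m e \<subseteq> F" unfolding mem_interior_cball by blast
    obtain b :: 'a where b: "norm b = 1" by (meson SOME_Basis norm_Basis)
    \<comment> \<open>The origin has no outward direction of its own; there any unit vector
      serves.\<close>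
    define v where "v = (if m = 0 then e *\<^sub>R b else m + (e / norm m) *\<^sub>R m)"
    have "v \<in> cball m e" using e b by (auto simp: v_def dist_norm)
    then have "norm v \<le> norm m" using e m by blast
    moreover have "norm m < norm v"
    proof (cases "m = 0")
      case False
      then have "v = (1 + e / norm m) *\<^sub>R m" by (simp add: v_def scaleR_add_left)
      then have "norm v = \<bar>1 + e / norm m\<bar> * norm m" by simp
      also have "\<dots> = norm m + e" using e False by (simp add: abs_of_pos add_pos_pos field_simps)
      finally show ?thesis using e by simp
    qed (use e b in \<open>simp add: v_def\<close>)
    ultimately show False by simp
  qed
  then have "norm m \<le> (SUP \<xi>\<in>frontier (- F). norm \<xi>)"
    using fr m by (intro cSUP_upper bdd_aboveI2[of _ _ "norm m"]) (auto simp: frontier_complement)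
  then show "x \<in> cball 0 r" using m(2)[OF x] r by simp
qed

theorem theorem2:
  fixes \<Omega> F :: "pt set" and G H :: "pt \<Rightarrow> pt \<Rightarrow> real"
    and G\<epsilon> :: "real \<Rightarrow> pt \<Rightarrow> pt \<Rightarrow> real" and g :: "pt \<Rightarrow> pt \<Rightarrow> real"
    and \<epsilon>1 :: real
  assumes "open \<Omega>" and "connected \<Omega>" and "bounded \<Omega>" and "0 \<in> \<Omega>"
    and "infdist 0 (frontier \<Omega>) = 1"
    and "compact F" and "0 \<in> interior F"
    and "(SUP \<xi>\<in>frontier (- F). norm \<xi>) = 1"
    and "green_regular_part \<Omega> H"
    and "\<forall>x\<in>\<Omega>. \<forall>y\<in>\<Omega>. x \<noteq> y \<longrightarrow> G x y = fund x y - H x y"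
    and "exterior_green F g"
    and "\<epsilon>1 > 0"
    and "\<forall>\<epsilon>. 0 < \<epsilon> \<and> \<epsilon> < \<epsilon>1 \<longrightarrow> dirichlet_green (\<Omega> - scaled_set \<epsilon> F) (G\<epsilon> \<epsilon>)"
  shows "\<exists>C \<epsilon>0. 0 < \<epsilon>0 \<and> (\<forall>\<epsilon>. 0 < \<epsilon> \<and> \<epsilon> < \<epsilon>0 \<longrightarrow>
          (\<forall>x\<in>\<Omega> - scaled_set \<epsilon> F. \<forall>y\<in>\<Omega> - scaled_set \<epsilon> F. x \<noteq> y \<longrightarrow>
            \<bar>G\<epsilon> \<epsilon> x y -
              (G x y + g (inverse \<epsilon> *\<^sub>R x) (inverse \<epsilon> *\<^sub>R y)
               + ln (inverse \<epsilon> * dist x y) / (2 * pi)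
               + ((ln \<epsilon> / (2 * pi) + zeta g (inverse \<epsilon> *\<^sub>R x) - zeta_inf g + H x 0)
                  * (ln \<epsilon> / (2 * pi) + zeta g (inverse \<epsilon> *\<^sub>R y) - zeta_inf g + H 0 y))
                 / (ln \<epsilon> / (2 * pi) + H 0 0 - zeta_inf g)
               - zeta g (inverse \<epsilon> *\<^sub>R x) - zeta g (inverse \<epsilon> *\<^sub>R y) + zeta_inf g)\<bar>
            \<le> C * \<epsilon>))"
proof -
  note a = assms
  define \<Omega>' where "\<Omega>' = to_pt -` \<Omega>"
  define F' where "F' = to_pt -` F"
  obtain h where h: "green_regular_part (- F) h"
     "\<And>\<xi> \<eta>. \<xi> \<notin> F \<Longrightarrow> \<eta> \<notin> F \<Longrightarrow> \<xi> \<noteq> \<eta> \<Longrightarrow> g \<xi> \<eta> = fund \<xi> \<eta> - h \<xi> \<eta>"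
     "\<And>\<eta>. \<eta> \<notin> F \<Longrightarrow> \<exists>R M. \<forall>\<xi>\<in>- F. R \<le> norm \<xi> \<longrightarrow> \<bar>g \<xi> \<eta>\<bar> \<le> M"
    using a(11) unfolding exterior_green_def by auto
  \<comment> \<open>Regular parts exist for each \<epsilon> separately; this form lets them be
    chosen as one function of \<epsilon>.\<close>
  have "\<forall>\<epsilon>. \<exists>He. 0 < \<epsilon> \<and> \<epsilon> < \<epsilon>1 \<longrightarrow> green_regular_part (\<Omega> - scaled_set \<epsilon> F) He \<and>
     (\<forall>x\<in>\<Omega> - scaled_set \<epsilon> F. \<forall>y\<in>\<Omega> - scaled_set \<epsilon> F. x \<noteq> y \<longrightarrow> G\<epsilon> \<epsilon> x y = fund x y - He x y)"
    using a(13) unfolding dirichlet_green_def by blast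
  then obtain He where He: "\<And>\<epsilon>. 0 < \<epsilon> \<and> \<epsilon> < \<epsilon>1 \<Longrightarrow> green_regular_part (\<Omega> - scaled_set \<epsilon> F) (He \<epsilon>)"
     "\<And>\<epsilon> x y. 0 < \<epsilon> \<and> \<epsilon> < \<epsilon>1 \<Longrightarrow> x \<in> \<Omega> - scaled_set \<epsilon> F \<Longrightarrow> y \<in> \<Omega> - scaled_set \<epsilon> F \<Longrightarrow> x \<noteq> y \<Longrightarrow>
        G\<epsilon> \<epsilon> x y = fund x y - He \<epsilon> x y"
    by metis
  let ?h = "\<lambda>\<xi> \<eta>. h (to_pt \<xi>) (to_pt \<eta>)" and ?g = "\<lambda>\<xi> \<eta>. g (to_pt \<xi>) (to_pt \<eta>)"
  have Fc: "- F' = to_pt -` (- F)" by (auto simp: F'_def)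
  have hc: "green_corr (- F') \<eta> (\<lambda>\<xi>. ?h \<xi> \<eta>)" if "\<eta> \<notin> F'" for \<eta>
    unfolding Fc by (rule green_regular_part_imp_green_corr[OF h(1)]) (use that in \<open>simp add: F'_def\<close>)
  interpret exterior_problem F' ?h ?g
  proof
    show "compact F'"
      using a(6) closed_vimage[OF compact_imp_closed continuous_on_to_pt] bounded_vimage_to_pt compact_imp_bounded
      unfolding F'_def compact_eq_bounded_closed by blast
    show "0 \<in> interior F'" unfolding F'_def interior_vimage_to_pt using a(7) by simp
    fix \<eta> assume e: "\<eta> \<notin> F'"
    show "harm_on (- F') (\<lambda>\<xi>. ?h \<xi> \<eta>)" "continuous_on (closure (- F')) (\<lambda>\<xi>. ?h \<xi> \<eta>)"
      using hc[OF e] by (auto simp: green_corr_def)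
    show "?h \<xi> \<eta> = - ln (dist \<xi> \<eta>) / (2*pi)" if "\<xi> \<in> frontier (- F')" for \<xi>
      using hc[OF e] that by (auto simp: green_corr_def)
    show "?g \<xi> \<eta> = - ln (dist \<xi> \<eta>) / (2*pi) - ?h \<xi> \<eta>" if "\<xi> \<notin> F'" "\<xi> \<noteq> \<eta>" for \<xi>
    proof -
      have "to_pt \<xi> \<noteq> to_pt \<eta>" using that bij_to_pt by (auto simp: bij_def inj_eq)
      then show ?thesis using h(2)[of "to_pt \<xi>" "to_pt \<eta>"] that e by (simp add: F'_def fund_to_pt)
    qed
    obtain R M where "\<forall>\<xi>\<in>- F. R \<le> norm \<xi> \<longrightarrow> \<bar>g \<xi> (to_pt \<eta>)\<bar> \<le> M"
      using h(3)[of "to_pt \<eta>"] e by (auto simp: F'_def)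
    then have "\<forall>\<xi>. \<xi> \<notin> F' \<longrightarrow> R \<le> norm \<xi> \<longrightarrow> \<bar>?g \<xi> \<eta>\<bar> \<le> M" by (simp add: F'_def)
    then show "\<exists>R M. \<forall>\<xi>. \<xi> \<notin> F' \<longrightarrow> R \<le> norm \<xi> \<longrightarrow> \<bar>?g \<xi> \<eta>\<bar> \<le> M"
      by blast
  qed
  \<comment> \<open>\<open>Lim\<close> carries information only once convergence is known; infinity
    of the coordinate plane matches that of the complex plane because \<open>to_pt\<close> preserves
    norms.\<close>
  have zeta_eq: "zeta g (to_pt \<eta>) = \<zeta> \<eta>" if "\<eta> \<notin> F'" for \<eta>
    unfolding zeta_def
    by (rule tendsto_Lim[OF trivial_limit_at_infinity tendsto_at_infinity_to_pt[OF g_tendsto_\<zeta>[OF that]]])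
  obtain C2 R2 Zi where z2: "0 < C2" "0 < R2" "\<And>\<xi>. R2 \<le> norm \<xi> \<Longrightarrow> \<xi> \<notin> F'"
    "\<And>\<eta>. R2 \<le> norm \<eta> \<Longrightarrow> \<bar>\<zeta> \<eta> - ln (norm \<eta>) / (2*pi) - Zi\<bar> \<le> C2 / norm \<eta>"
    "((\<lambda>\<eta>. \<zeta> \<eta> - ln (norm \<eta>) / (2*pi)) \<longlongrightarrow> Zi) at_infinity"
    using \<zeta>_expansion by blast
  have zeta_inf_eq: "zeta_inf g = Zi"
    unfolding zeta_inf_def
  proof (rule tendsto_Lim[OF trivial_limit_at_infinity tendsto_at_infinity_to_pt])
    have "\<forall>\<^sub>F \<eta> in at_infinity. \<zeta> \<eta> - ln (norm \<eta>) / (2*pi) = zeta g (to_pt \<eta>) - ln (norm (to_pt \<eta>)) / (2*pi)"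
      unfolding eventually_at_infinity by (intro exI[of _ R2]) (simp add: zeta_eq z2(3))
    then show "((\<lambda>\<eta>. zeta g (to_pt \<eta>) - ln (norm (to_pt \<eta>)) / (2*pi)) \<longlongrightarrow> Zi) at_infinity"
      by (rule Lim_transform_eventually[OF z2(5)])
  qed
  have scaled: "to_pt -` (\<Omega> - scaled_set \<epsilon> F) = \<Omega>' - {x. x /\<^sub>R \<epsilon> \<in> F'}" for \<epsilon>
    by (auto simp: scaled_set_def \<Omega>'_def F'_def to_pt_scaleR)
  have ball: "ball 0 1 \<subseteq> \<Omega>'"
    using ball_subset_if_infdist_frontier[OF a(4,5)] by (auto simp: \<Omega>'_def subset_iff)
  have F1: "F' \<subseteq> cball 0 1"
    using compact_subset_cball_if_frontier[OF a(6,8)] by (auto simp: F'_def subset_iff)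
  have H': "green_corr \<Omega>' y (\<lambda>x. H (to_pt x) (to_pt y))" if "y \<in> \<Omega>'" for y
    using green_regular_part_imp_green_corr[OF a(9)] that by (simp add: \<Omega>'_def)
  have He': "green_corr (\<Omega>' - {x. x /\<^sub>R \<epsilon> \<in> F'}) y (\<lambda>x. He \<epsilon> (to_pt x) (to_pt y))"
    if "0 < \<epsilon>" "\<epsilon> < \<epsilon>1" "y \<in> \<Omega>' - {x. x /\<^sub>R \<epsilon> \<in> F'}" for \<epsilon> y
    unfolding scaled[symmetric]
    by (rule green_regular_part_imp_green_corr[OF He(1)]) (use that in \<open>auto simp: scaled[symmetric]\<close>)
  obtain C \<epsilon>0 where C: "0 < \<epsilon>0" "\<And>\<epsilon> x y. 0 < \<epsilon> \<Longrightarrow> \<epsilon> < \<epsilon>0 \<Longrightarrow> x \<in> \<Omega>' - {x. x /\<^sub>R \<epsilon> \<in> F'} \<Longrightarrow>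
      y \<in> \<Omega>' - {x. x /\<^sub>R \<epsilon> \<in> F'} \<Longrightarrow>
      \<bar>- He \<epsilon> (to_pt x) (to_pt y) + H (to_pt x) (to_pt y) + ?h (x /\<^sub>R \<epsilon>) (y /\<^sub>R \<epsilon>)
        - ((ln \<epsilon> / (2*pi) + \<zeta> (x /\<^sub>R \<epsilon>) - Zi + H (to_pt x) 0) * (ln \<epsilon> / (2*pi) + \<zeta> (y /\<^sub>R \<epsilon>) - Zi + H 0 (to_pt y)))
          / (ln \<epsilon> / (2*pi) + H 0 0 - Zi)
        + \<zeta> (x /\<^sub>R \<epsilon>) + \<zeta> (y /\<^sub>R \<epsilon>) - Zi\<bar> \<le> C * \<epsilon>"
    using perforated_green_expansion[OF open_vimage_to_pt[OF a(1), folded \<Omega>'_def] bounded_vimage_to_pt[OF a(3), folded \<Omega>'_def]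
        ball F1 H' a(12) He' z2(5)] unfolding to_pt_0 by blast
  show ?thesis
  \<comment> \<open>The minimum with \<epsilon>1 is taken because \<open>G\<epsilon>\<close> is
    expressed through \<open>He\<close> only below \<epsilon>1.\<close>
  proof (rule exI[of _ C], rule exI[of _ "min \<epsilon>0 \<epsilon>1"], intro conjI allI impI ballI)
    show "0 < min \<epsilon>0 \<epsilon>1" using C a(12) by simp
    fix \<epsilon> x y assume e: "0 < \<epsilon> \<and> \<epsilon> < min \<epsilon>0 \<epsilon>1" and x: "x \<in> \<Omega> - scaled_set \<epsilon> F" and y: "y \<in> \<Omega> - scaled_set \<epsilon> F" and xy: "x \<noteq> y"
    obtain x' y' where x': "x = to_pt x'" and y': "y = to_pt y'" using bij_to_pt by (metis bij_pointE)
    have xU: "x' \<in> \<Omega>' - {x. x /\<^sub>R \<epsilon> \<in> F'}" and yU: "y' \<in> \<Omega>' - {x. x /\<^sub>R \<epsilon> \<in> F'}"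
      using x y by (auto simp: x' y' scaled[symmetric])
    have sx: "inverse \<epsilon> *\<^sub>R x = to_pt (x' /\<^sub>R \<epsilon>)" "inverse \<epsilon> *\<^sub>R y = to_pt (y' /\<^sub>R \<epsilon>)"
      by (simp_all add: x' y' to_pt_scaleR)
    have z: "zeta g (inverse \<epsilon> *\<^sub>R x) = \<zeta> (x' /\<^sub>R \<epsilon>)" "zeta g (inverse \<epsilon> *\<^sub>R y) = \<zeta> (y' /\<^sub>R \<epsilon>)"
      unfolding sx using xU yU by (simp_all add: zeta_eq)
    have xy': "x' /\<^sub>R \<epsilon> \<noteq> y' /\<^sub>R \<epsilon>" using xy e by (auto simp: x' y')
    have d: "dist (x' /\<^sub>R \<epsilon>) (y' /\<^sub>R \<epsilon>) = inverse \<epsilon> * dist x y"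
      unfolding x' y' dist_to_pt using e by (simp add: dist_norm flip: scaleR_diff_right)
    have "g (inverse \<epsilon> *\<^sub>R x) (inverse \<epsilon> *\<^sub>R y) = - ln (dist (x' /\<^sub>R \<epsilon>) (y' /\<^sub>R \<epsilon>)) / (2*pi) - ?h (x' /\<^sub>R \<epsilon>) (y' /\<^sub>R \<epsilon>)"
      unfolding sx using g_eq[OF _ _ xy'] xU yU by simp
    \<comment> \<open>The scaled logarithm removes the pole of g and leaves minus its regular part;
      the poles of the other two Green's functions cancel each other.\<close>
    then have g1: "g (inverse \<epsilon> *\<^sub>R x) (inverse \<epsilon> *\<^sub>R y) + ln (inverse \<epsilon> * dist x y) / (2*pi) = - ?h (x' /\<^sub>R \<epsilon>) (y' /\<^sub>R \<epsilon>)"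
      unfolding d by simp
    have G1: "G\<epsilon> \<epsilon> x y = fund x y - He \<epsilon> x y" by (rule He(2)) (use e x y xy in auto)
    have G2: "G x y = fund x y - H x y" using a(10) x y xy by simp
    show "\<bar>G\<epsilon> \<epsilon> x y -
              (G x y + g (inverse \<epsilon> *\<^sub>R x) (inverse \<epsilon> *\<^sub>R y)
               + ln (inverse \<epsilon> * dist x y) / (2 * pi)
               + ((ln \<epsilon> / (2 * pi) + zeta g (inverse \<epsilon> *\<^sub>R x) - zeta_inf g + H x 0)
                  * (ln \<epsilon> / (2 * pi) + zeta g (inverse \<epsilon> *\<^sub>R y) - zeta_inf g + H 0 y))
                 / (ln \<epsilon> / (2 * pi) + H 0 0 - zeta_inf g)
               - zeta g (inverse \<epsilon> *\<^sub>R x) - zeta g (inverse \<epsilon> *\<^sub>R y) + zeta_inf g)\<bar>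
            \<le> C * \<epsilon>" (is "\<bar>?lhs\<bar> \<le> _")
    proof -
      have "?lhs = - He \<epsilon> (to_pt x') (to_pt y') + H (to_pt x') (to_pt y') + ?h (x' /\<^sub>R \<epsilon>) (y' /\<^sub>R \<epsilon>)
        - ((ln \<epsilon> / (2*pi) + \<zeta> (x' /\<^sub>R \<epsilon>) - Zi + H (to_pt x') 0) * (ln \<epsilon> / (2*pi) + \<zeta> (y' /\<^sub>R \<epsilon>) - Zi + H 0 (to_pt y')))
          / (ln \<epsilon> / (2*pi) + H 0 0 - Zi)
        + \<zeta> (x' /\<^sub>R \<epsilon>) + \<zeta> (y' /\<^sub>R \<epsilon>) - Zi"
        using g1 unfolding G1 G2 z zeta_inf_eq x'[symmetric] y'[symmetric] by linarith
      then show ?thesis using C(2)[OF _ _ xU yU] e by simp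
    qed
  qed
qed

end
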